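(* Let $M$ be a finite monoid and $N,K\subseteq M$ two submonoids with the same identity element as $M$. Let $\Delta$ be a complete set of representatives for $M/\mathcal{L}_N\mathcal{R}_K$. For each $m\in\Delta$ let $x_1,\dots,x_{\alpha_m^N}$ be a complete set of representatives for $L_m^N/H_m^{(N,K)}$ and $y_1,\dots,y_{\beta_m^K}$ a complete set of representatives for $H_m^{(N,K)}\backslash R_m^K$. Then: (1) $M=\bigsqcup_{m\in\Delta}J_m^{(N,K)}=\bigsqcup_{m\in\Delta}L_m^N\otimes_{H_m^{(N,K)}}R_m^K=\bigsqcup_{m\in\Delta}\bigsqcup_{i=1,j=1}^{\alpha_m^N,\beta_m^K}x_i\circ_m H_m^{(N,K)}\circ_m y_j$. (2) Assume that $\mathbb{C}[N]$ and $\mathbb{C}[K]$ are both semi-simple. Then, as $N$-$K$-bimodules, $\mathbb{C}[M]\simeq\bigoplus_{m\in\Delta}\mathbb{C}[L_m^N]\otimes_{\mathbb{C}[H_m^{(N,K)}]}\mathbb{C}[R_m^K]$.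
   Context: For $m_1,m_2\in M$: $m_1\,\mathcal{L}_N\mathcal{R}_K\,m_2$ iff $Nm_1K=Nm_2K$ (an equivalence relation). For $m\in M$: $L_m^N=\{x\in M: Nx=Nm\}$, $R_m^K=\{y\in M: yK=mK\}$, $J_m^{(N,K)}=\{z\in M: NzK=NmK\}$, $H_m^{(N,K)}=L_m^N\cap R_m^K$. Operation $\circ_m$: for $x=x_lm\in Nm$ ($x_l\in N$) and $y=my_r\in mK$ ($y_r\in K$), $x\circ_m y:=x_lmy_r=x\,y_r=x_l\,y$ (independent of choices). With $\circ_m$, $H_m^{(N,K)}$ is a monoid with identity $m$, acting on the right on $L_m^N$ by $(x,h)\mapsto x\circ_m h$ and on the left on $R_m^K$ by $(h,y)\mapsto h\circ_m y$. The quotients $L_m^N/H_m^{(N,K)}$ and $H_m^{(N,K)}\backslash R_m^K$ are the orbit sets, so $L_m^N=\bigsqcup_i x_i\circ_mH_m^{(N,K)}$ and $R_m^K=\bigsqcup_jH_m^{(N,K)}\circ_my_j$. The set $L_m^N\otimes_{H_m^{(N,K)}}R_m^K$ is the quotient of $L_m^N\times R_m^K$ by $(x\circ_mh,y)\sim(x,h\circ_my)$, identified with a subset of $M$ via $x\otimes y\mapsto x\circ_my$. Module structures: $\mathbb{C}[M]$ is an $N$-$K$-bimodule by left and right multiplication. $\mathbb{C}[L_m^N]$ is a left $N$-module by $n\odot x=nx$ if $nx\in L_m^N$ and $0$ otherwise, and a right $\mathbb{C}[H_m^{(N,K)}]$-module by $\circ_m$; $\mathbb{C}[R_m^K]$ is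 a right $K$-module by $y\odot k=yk$ if $yk\in R_m^K$ and $0$ otherwise, and a left $\mathbb{C}[H_m^{(N,K)}]$-module by $\circ_m$. *)

theory Defs
  imports
    Complex_Main
    "HOL-Library.Disjoint_Sets"
    "HOL-Library.Poly_Mapping"
    "HOL-Algebra.Algebra"
begin

section \<open>The relative Green classes\<close>

definition LR_rel :: "('a, 'c) monoid_scheme \<Rightarrow> 'a set \<Rightarrow> 'a set \<Rightarrow> ('a \<times> 'a) set" where
  "LR_rel M N K = {(m1, m2). m1 \<in> carrier M \<and> m2 \<in> carrier M \<and>
     (N #>\<^bsub>M\<^esub> m1) <#>\<^bsub>M\<^esub> K = (N #>\<^bsub>M\<^esub> m2) <#>\<^bsub>M\<^esub> K}"

definition L_class :: "('a, 'c) monoid_scheme \<Rightarrow> 'a set \<Rightarrow> 'a \<Rightarrow> 'a set" where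
  "L_class M N m = {x \<in> carrier M. N #>\<^bsub>M\<^esub> x = N #>\<^bsub>M\<^esub> m}"

definition R_class :: "('a, 'c) monoid_scheme \<Rightarrow> 'a set \<Rightarrow> 'a \<Rightarrow> 'a set" where
  "R_class M K m = {y \<in> carrier M. y <#\<^bsub>M\<^esub> K = m <#\<^bsub>M\<^esub> K}"

definition J_class :: "('a, 'c) monoid_scheme \<Rightarrow> 'a set \<Rightarrow> 'a set \<Rightarrow> 'a \<Rightarrow> 'a set" where
  "J_class M N K m =
     {z \<in> carrier M. (N #>\<^bsub>M\<^esub> z) <#>\<^bsub>M\<^esub> K = (N #>\<^bsub>M\<^esub> m) <#>\<^bsub>M\<^esub> K}"

definition H_class :: "('a, 'c) monoid_scheme \<Rightarrow> 'a set \<Rightarrow> 'a set \<Rightarrow> 'a \<Rightarrow> 'a set" where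
  "H_class M N K m = L_class M N m \<inter> R_class M K m"


section \<open>The sandwich operation\<close>

text \<open>Only meaningful for \<open>x \<in> N m\<close> and \<open>y \<in> m K\<close>; see \<open>circ_eq\<close> for independence of the choices.\<close>

definition circ :: "('a, 'c) monoid_scheme \<Rightarrow> 'a set \<Rightarrow> 'a set \<Rightarrow> 'a \<Rightarrow> 'a \<Rightarrow> 'a \<Rightarrow> 'a" where
  "circ M N K m x y = (THE z. \<exists>xl\<in>N. \<exists>yr\<in>K.
     x = xl \<otimes>\<^bsub>M\<^esub> m \<and> y = m \<otimes>\<^bsub>M\<^esub> yr \<and> z = xl \<otimes>\<^bsub>M\<^esub> m \<otimes>\<^bsub>M\<^esub> yr)"

lemma circ_eq:
  assumes "monoid M" "N \<subseteq> carrier M" "K \<subseteq> carrier M" "m \<in> carrier M" "xl \<in> N" "yr \<in> K"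
  shows "circ M N K m (xl \<otimes>\<^bsub>M\<^esub> m) (m \<otimes>\<^bsub>M\<^esub> yr) = xl \<otimes>\<^bsub>M\<^esub> m \<otimes>\<^bsub>M\<^esub> yr"
proof -
  interpret monoid M by fact
  have "z = xl \<otimes>\<^bsub>M\<^esub> m \<otimes>\<^bsub>M\<^esub> yr"
    if "xl' \<in> N" "yr' \<in> K" "xl \<otimes>\<^bsub>M\<^esub> m = xl' \<otimes>\<^bsub>M\<^esub> m" "m \<otimes>\<^bsub>M\<^esub> yr = m \<otimes>\<^bsub>M\<^esub> yr'"
      "z = xl' \<otimes>\<^bsub>M\<^esub> m \<otimes>\<^bsub>M\<^esub> yr'" for z xl' yr'
  proof -
    have c: "xl \<in> carrier M" "xl' \<in> carrier M" "yr \<in> carrier M" "yr' \<in> carrier M"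
      using assms that by auto
    have "z = xl' \<otimes>\<^bsub>M\<^esub> (m \<otimes>\<^bsub>M\<^esub> yr')" using c assms(4) that(5) by (simp add: m_assoc)
    also have "\<dots> = xl' \<otimes>\<^bsub>M\<^esub> m \<otimes>\<^bsub>M\<^esub> yr" using c assms(4) that(4) by (simp add: m_assoc)
    finally show ?thesis using that(3) by simp
  qed
  then show ?thesis
    unfolding circ_def using assms(5,6) by (intro the_equality) blast+
qed

definition H_monoid :: "('a, 'c) monoid_scheme \<Rightarrow> 'a set \<Rightarrow> 'a set \<Rightarrow> 'a \<Rightarrow> 'a monoid" where
  "H_monoid M N K m = \<lparr>carrier = H_class M N K m, monoid.mult = circ M N K m, one = m\<rparr>"

text \<open>The orbit sets \<open>L/H\<close> and \<open>H\R\<close>.\<close>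

definition L_orbits :: "('a, 'c) monoid_scheme \<Rightarrow> 'a set \<Rightarrow> 'a set \<Rightarrow> 'a \<Rightarrow> 'a set set" where
  "L_orbits M N K m = (\<lambda>x. circ M N K m x ` H_class M N K m) ` L_class M N m"

definition R_orbits :: "('a, 'c) monoid_scheme \<Rightarrow> 'a set \<Rightarrow> 'a set \<Rightarrow> 'a \<Rightarrow> 'a set set" where
  "R_orbits M N K m = (\<lambda>y. (\<lambda>h. circ M N K m h y) ` H_class M N K m) ` R_class M K m"

definition complete_reps :: "'a set set \<Rightarrow> 'a set \<Rightarrow> bool" where
  "complete_reps \<C> A \<longleftrightarrow> A \<subseteq> \<Union>\<C> \<and> (\<forall>c\<in>\<C>. \<exists>!x. x \<in> A \<and> x \<in> c)"


section \<open>The set-theoretic tensor product of the classes\<close>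

definition tensor_step :: "('a, 'c) monoid_scheme \<Rightarrow> 'a set \<Rightarrow> 'a set \<Rightarrow> 'a \<Rightarrow> (('a \<times> 'a) \<times> ('a \<times> 'a)) set" where
  "tensor_step M N K m = {((circ M N K m x h, y), (x, circ M N K m h y)) | x h y.
     x \<in> L_class M N m \<and> h \<in> H_class M N K m \<and> y \<in> R_class M K m}"

definition tensor_equiv :: "('a, 'c) monoid_scheme \<Rightarrow> 'a set \<Rightarrow> 'a set \<Rightarrow> 'a \<Rightarrow> (('a \<times> 'a) \<times> ('a \<times> 'a)) set" where
  "tensor_equiv M N K m =
     Restr ((tensor_step M N K m \<union> (tensor_step M N K m)\<inverse>)\<^sup>*) (L_class M N m \<times> R_class M K m)"

definition set_tensor :: "('a, 'c) monoid_scheme \<Rightarrow> 'a set \<Rightarrow> 'a set \<Rightarrow> 'a \<Rightarrow> ('a \<times> 'a) set set" where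
  "set_tensor M N K m = (L_class M N m \<times> R_class M K m) // tensor_equiv M N K m"

text \<open>The map sending the class of \<open>(x, y)\<close> to \<open>circ M N K m x y\<close>; it is well defined by
  \<open>circ_respects_tensor_equiv\<close>.\<close>

definition tensor_incl :: "('a, 'c) monoid_scheme \<Rightarrow> 'a set \<Rightarrow> 'a set \<Rightarrow> 'a \<Rightarrow> ('a \<times> 'a) set \<Rightarrow> 'a" where
  "tensor_incl M N K m C = the_elem ((\<lambda>(x, y). circ M N K m x y) ` C)"

lemma circ_respects_tensor_equiv:
  assumes "monoid M" "submonoid N M" "submonoid K M" "m \<in> carrier M"
  shows "(\<lambda>(x, y). circ M N K m x y) respects tensor_equiv M N K m"
proof -
  interpret monoid M by fact
  interpret N: submonoid N M by fact
  interpret K: submonoid K M by fact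
  have L: "\<exists>a\<in>N. x = a \<otimes>\<^bsub>M\<^esub> m" if "x \<in> L_class M N m" for x
  proof -
    have "\<one>\<^bsub>M\<^esub> \<otimes>\<^bsub>M\<^esub> x \<in> N #>\<^bsub>M\<^esub> x" unfolding r_coset_def using N.one_closed by blast
    then show ?thesis using that by (auto simp: L_class_def r_coset_def)
  qed
  have R: "\<exists>b\<in>K. y = m \<otimes>\<^bsub>M\<^esub> b" if "y \<in> R_class M K m" for y
  proof -
    have "y \<otimes>\<^bsub>M\<^esub> \<one>\<^bsub>M\<^esub> \<in> y <#\<^bsub>M\<^esub> K" unfolding l_coset_def using K.one_closed by blast
    then show ?thesis using that by (auto simp: R_class_def l_coset_def)
  qed
  have step: "circ M N K m (fst p) (snd p) = circ M N K m (fst q) (snd q)"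
    if pq: "(p, q) \<in> tensor_step M N K m" for p q
  proof -
    obtain x h y where p: "p = (circ M N K m x h, y)" and q: "q = (x, circ M N K m h y)"
      and xhy: "x \<in> L_class M N m" "h \<in> H_class M N K m" "y \<in> R_class M K m"
      using pq by (auto simp: tensor_step_def)
    obtain a where a: "a \<in> N" "x = a \<otimes>\<^bsub>M\<^esub> m" using L xhy(1) by blast
    obtain c where c: "c \<in> N" "h = c \<otimes>\<^bsub>M\<^esub> m" using L xhy(2) by (auto simp: H_class_def)
    obtain d where d: "d \<in> K" "h = m \<otimes>\<^bsub>M\<^esub> d" using R xhy(2) by (auto simp: H_class_def)
    obtain b where b: "b \<in> K" "y = m \<otimes>\<^bsub>M\<^esub> b" using R xhy(3) by blast
    have cl: "a \<in> carrier M" "c \<in> carrier M" "d \<in> carrier M" "b \<in> carrier M"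
      using a b c d N.subset K.subset by auto
    note ce = circ_eq[OF assms(1) N.subset K.subset assms(4)]
    have cd: "c \<otimes>\<^bsub>M\<^esub> m = m \<otimes>\<^bsub>M\<^esub> d" using c d by simp
    have "circ M N K m x h = a \<otimes>\<^bsub>M\<^esub> m \<otimes>\<^bsub>M\<^esub> d" using ce[OF a(1) d(1)] a d by simp
    also have "\<dots> = (a \<otimes>\<^bsub>M\<^esub> c) \<otimes>\<^bsub>M\<^esub> m" using cl assms(4) cd by (simp add: m_assoc)
    finally have l: "circ M N K m (circ M N K m x h) y = (a \<otimes>\<^bsub>M\<^esub> c) \<otimes>\<^bsub>M\<^esub> m \<otimes>\<^bsub>M\<^esub> b"
      using ce[OF N.m_closed[OF a(1) c(1)] b(1)] b by simp
    have "circ M N K m h y = c \<otimes>\<^bsub>M\<^esub> m \<otimes>\<^bsub>M\<^esub> b" using ce[OF c(1) b(1)] c b by simp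
    also have "\<dots> = m \<otimes>\<^bsub>M\<^esub> (d \<otimes>\<^bsub>M\<^esub> b)" using cl assms(4) cd by (simp add: m_assoc)
    finally have "circ M N K m x (circ M N K m h y) = a \<otimes>\<^bsub>M\<^esub> m \<otimes>\<^bsub>M\<^esub> (d \<otimes>\<^bsub>M\<^esub> b)"
      using ce[OF a(1) K.m_closed[OF d(1) b(1)]] a by simp
    also have "\<dots> = a \<otimes>\<^bsub>M\<^esub> (m \<otimes>\<^bsub>M\<^esub> d) \<otimes>\<^bsub>M\<^esub> b" using cl assms(4) by (simp add: m_assoc)
    also have "\<dots> = (a \<otimes>\<^bsub>M\<^esub> c) \<otimes>\<^bsub>M\<^esub> m \<otimes>\<^bsub>M\<^esub> b"
      using cl assms(4) by (simp add: m_assoc flip: cd)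
    finally show ?thesis using l p q by simp
  qed
  have "circ M N K m (fst p) (snd p) = circ M N K m (fst q) (snd q)"
    if "(p, q) \<in> (tensor_step M N K m \<union> (tensor_step M N K m)\<inverse>)\<^sup>*" for p q
    using that by (induction rule: rtrancl_induct) (auto dest!: step)
  then show ?thesis
    by (intro congruentI) (auto simp: tensor_equiv_def)
qed


section \<open>Monoid algebras and semisimplicity\<close>

definition bilin :: "('x \<Rightarrow> 'y \<Rightarrow> 'z \<Rightarrow>\<^sub>0 complex) \<Rightarrow>
    ('x \<Rightarrow>\<^sub>0 complex) \<Rightarrow> ('y \<Rightarrow>\<^sub>0 complex) \<Rightarrow> ('z \<Rightarrow>\<^sub>0 complex)" where
  "bilin b f g = (\<Sum>x\<in>Poly_Mapping.keys f. \<Sum>y\<in>Poly_Mapping.keys g.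
     Poly_Mapping.map ((*) (Poly_Mapping.lookup f x * Poly_Mapping.lookup g y)) (b x y))"

abbreviation basis_vec :: "'x \<Rightarrow> 'x \<Rightarrow>\<^sub>0 complex" where
  "basis_vec x \<equiv> Poly_Mapping.single x 1"

definition monoid_algebra :: "('a, 'c) monoid_scheme \<Rightarrow> ('a \<Rightarrow>\<^sub>0 complex) ring" where
  "monoid_algebra M = \<lparr>carrier = {f. Poly_Mapping.keys f \<subseteq> carrier M},
     monoid.mult = bilin (\<lambda>x y. basis_vec (x \<otimes>\<^bsub>M\<^esub> y)), one = basis_vec \<one>\<^bsub>M\<^esub>,
     ring.zero = 0, ring.add = (+)\<rparr>"

definition left_ideal :: "'r set \<Rightarrow> ('r, 'c) ring_scheme \<Rightarrow> bool" where
  "left_ideal I R \<longleftrightarrow> additive_subgroup I R \<and> (\<forall>a\<in>carrier R. \<forall>x\<in>I. a \<otimes>\<^bsub>R\<^esub> x \<in> I)"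

definition simple_left_ideal :: "'r set \<Rightarrow> ('r, 'c) ring_scheme \<Rightarrow> bool" where
  "simple_left_ideal I R \<longleftrightarrow> left_ideal I R \<and> I \<noteq> {\<zero>\<^bsub>R\<^esub>} \<and>
     (\<forall>I'. left_ideal I' R \<and> I' \<subseteq> I \<longrightarrow> I' = {\<zero>\<^bsub>R\<^esub>} \<or> I' = I)"

text \<open>The left regular module is a direct sum of simple submodules. Restricting to finite families
  loses nothing, since the unit already lies in a finite subsum.\<close>

definition semisimple_ring :: "('r, 'c) ring_scheme \<Rightarrow> bool" where
  "semisimple_ring R \<longleftrightarrow> (\<exists>S. finite S \<and> (\<forall>I\<in>S. simple_left_ideal I R) \<and>
     (\<forall>a\<in>carrier R. \<exists>!f. f \<in> (\<Pi>\<^sub>E I\<in>S. I) \<and> a = (\<Oplus>\<^bsub>R\<^esub>I\<in>S. f I)))"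


section \<open>Bimodules\<close>

text \<open>The underlying additive group is written multiplicatively, as for \<open>free_Abelian_group\<close>. The
  scalars act through the algebras, so isomorphisms compatible with the actions are linear.\<close>

record ('r, 's, 'v) bimod = "'v monoid" +
  lact :: "'r \<Rightarrow> 'v \<Rightarrow> 'v"
  ract :: "'v \<Rightarrow> 's \<Rightarrow> 'v"

definition bimod_iso :: "('r, 'c) ring_scheme \<Rightarrow> ('s, 'd) ring_scheme \<Rightarrow>
    ('r, 's, 'v) bimod \<Rightarrow> ('r, 's, 'w) bimod \<Rightarrow> bool" where
  "bimod_iso A B V W \<longleftrightarrow> (\<exists>\<phi>\<in>iso V W.
     (\<forall>a\<in>carrier A. \<forall>v\<in>carrier V. \<phi> (lact V a v) = lact W a (\<phi> v)) \<and>
     (\<forall>b\<in>carrier B. \<forall>v\<in>carrier V. \<phi> (ract V v b) = ract W (\<phi> v) b))"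

definition linear_bimod :: "'x set \<Rightarrow> ('n \<Rightarrow> 'x \<Rightarrow> 'x \<Rightarrow>\<^sub>0 complex) \<Rightarrow> ('x \<Rightarrow> 'k \<Rightarrow> 'x \<Rightarrow>\<^sub>0 complex) \<Rightarrow>
    ('n \<Rightarrow>\<^sub>0 complex, 'k \<Rightarrow>\<^sub>0 complex, 'x \<Rightarrow>\<^sub>0 complex) bimod" where
  "linear_bimod S l r = \<lparr>carrier = {f. Poly_Mapping.keys f \<subseteq> S}, monoid.mult = (+), one = 0,
     lact = bilin l, ract = bilin r\<rparr>"

definition regular_bimod :: "('a, 'c) monoid_scheme \<Rightarrow>
    ('a \<Rightarrow>\<^sub>0 complex, 'a \<Rightarrow>\<^sub>0 complex, 'a \<Rightarrow>\<^sub>0 complex) bimod" where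
  "regular_bimod M = linear_bimod (carrier M)
     (\<lambda>n x. basis_vec (n \<otimes>\<^bsub>M\<^esub> x)) (\<lambda>x k. basis_vec (x \<otimes>\<^bsub>M\<^esub> k))"

definition L_bimod :: "('a, 'c) monoid_scheme \<Rightarrow> 'a set \<Rightarrow> 'a set \<Rightarrow> 'a \<Rightarrow>
    ('a \<Rightarrow>\<^sub>0 complex, 'a \<Rightarrow>\<^sub>0 complex, 'a \<Rightarrow>\<^sub>0 complex) bimod" where
  "L_bimod M N K m = linear_bimod (L_class M N m)
     (\<lambda>n x. if n \<otimes>\<^bsub>M\<^esub> x \<in> L_class M N m then basis_vec (n \<otimes>\<^bsub>M\<^esub> x) else 0)
     (\<lambda>x h. basis_vec (circ M N K m x h))"

definition R_bimod :: "('a, 'c) monoid_scheme \<Rightarrow> 'a set \<Rightarrow> 'a set \<Rightarrow> 'a \<Rightarrow>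
    ('a \<Rightarrow>\<^sub>0 complex, 'a \<Rightarrow>\<^sub>0 complex, 'a \<Rightarrow>\<^sub>0 complex) bimod" where
  "R_bimod M N K m = linear_bimod (R_class M K m)
     (\<lambda>h y. basis_vec (circ M N K m h y))
     (\<lambda>y k. if y \<otimes>\<^bsub>M\<^esub> k \<in> R_class M K m then basis_vec (y \<otimes>\<^bsub>M\<^esub> k) else 0)"

text \<open>The tensor product over a ring \<open>R\<close>: the free abelian group on pairs modulo biadditivity and
  \<open>R\<close>-balancedness, with the outer actions extended additively from pure tensors to cosets.\<close>

definition tensor_relations :: "('r, 'c) ring_scheme \<Rightarrow> ('n, 'r, 'v) bimod \<Rightarrow> ('r, 'k, 'w) bimod \<Rightarrow>
    (('v \<times> 'w) \<Rightarrow>\<^sub>0 int) set" where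
  "tensor_relations R V W =
     {frag_of (v \<otimes>\<^bsub>V\<^esub> v', w) - frag_of (v, w) - frag_of (v', w) | v v' w.
        v \<in> carrier V \<and> v' \<in> carrier V \<and> w \<in> carrier W} \<union>
     {frag_of (v, w \<otimes>\<^bsub>W\<^esub> w') - frag_of (v, w) - frag_of (v, w') | v w w'.
        v \<in> carrier V \<and> w \<in> carrier W \<and> w' \<in> carrier W} \<union>
     {frag_of (ract V v r, w) - frag_of (v, lact W r w) | v r w.
        v \<in> carrier V \<and> r \<in> carrier R \<and> w \<in> carrier W}"

definition tensor_bimod :: "('r, 'c) ring_scheme \<Rightarrow> ('n, 'r, 'v) bimod \<Rightarrow> ('r, 'k, 'w) bimod \<Rightarrow>
    ('n, 'k, (('v \<times> 'w) \<Rightarrow>\<^sub>0 int) set) bimod" where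
  "tensor_bimod R V W =
     (let F = free_Abelian_group (carrier V \<times> carrier W);
          T = generate F (tensor_relations R V W)
      in monoid.extend (F Mod T)
        \<lparr>lact = (\<lambda>a C. \<Union>c\<in>C. T #>\<^bsub>F\<^esub> frag_extend (\<lambda>(v, w). frag_of (lact V a v, w)) c),
         ract = (\<lambda>C b. \<Union>c\<in>C. T #>\<^bsub>F\<^esub> frag_extend (\<lambda>(v, w). frag_of (v, ract W w b)) c)\<rparr>)"

definition direct_sum_bimod :: "'i set \<Rightarrow> ('i \<Rightarrow> ('r, 's, 'v) bimod) \<Rightarrow> ('r, 's, 'i \<Rightarrow> 'v) bimod" where
  "direct_sum_bimod I V = monoid.extend (sum_group I V)
     \<lparr>lact = (\<lambda>a f. \<lambda>i\<in>I. lact (V i) a (f i)), ract = (\<lambda>f b. \<lambda>i\<in>I. ract (V i) (f i) b)\<rparr>"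

end

theory Submission
  imports Defs "Jordan_Normal_Form.Schur_Decomposition"
begin

text \<open>Part (1) is a relative version of Green's lemmas: if \<open>x \<circ> y = x' \<circ> y'\<close> then \<open>x' = x \<circ> h\<close> and
  \<open>y = h \<circ> y'\<close> for some \<open>h \<in> H\<close>, while finiteness forces \<open>a m \<in> L\<close> and \<open>m b \<in> R\<close> as soon as
  \<open>a m b \<in> J\<close>.

  For part (2), the right-hand side is the graded bimodule of \<open>\<complex>[M]\<close> for the filtration by the double
  ideals \<open>N z K\<close>, so the filtration has to be split. In characteristic 0 the regular trace form of a
  finite-dimensional semisimple algebra is nondegenerate, and its Casimir element is a separability
  idempotent. Averaging the identity of \<open>\<complex>[M]\<close> over the separability idempotents of \<open>\<complex>[N]\<close> and \<open>\<complex>[K]\<close>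
  gives a bimodule map from \<open>\<complex>[M]\<close> to its graded bimodule which is unitriangular, hence bijective.\<close>

section \<open>Complex matrices\<close>

text \<open>Semisimplicity is given separately for each algebra and through one-sided ideals,
  whereas bimodules have to be split. Separability idempotents bridge this gap: averaging over the
  one of C[N] and over the one of C[K] concerns different sides and can be done in one fourfold sum.
  Nondegeneracy of the trace form rests on two facts: a nonzero left ideal of a semisimple ring
  contains a nonzero idempotent, and a complex idempotent matrix of trace zero vanishes. The second
  is where characteristic 0 enters. The average stays unitriangular because the two legs of a
  separability idempotent multiply to 1, and truncation can only remove terms that generate a
  smaller double ideal. The other obstacle is the tensor product, given by generators and relations
  over the integers. Its relation subgroup has to be exactly the kernel of the evaluation sending a
  pair \<open>(v, w)\<close> to the bilinear extension of \<open>\<circ>\<close>. The element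
  \<open>h\<close> of the Green-type lemma supplies the required balanced relations, and complex
  scalars cross the tensor sign as multiples of the identity \<open>m\<close> of the monoid
  \<open>H\<close>.\<close>

lemma sum_diag_mult_comm:
  fixes A B :: "'a :: comm_semiring_1 mat"
  assumes "A \<in> carrier_mat n n" "B \<in> carrier_mat n n"
  shows "(\<Sum>i<n. (A * B) $$ (i, i)) = (\<Sum>i<n. (B * A) $$ (i, i))"
proof -
  have "(A * B) $$ (i, i) = (\<Sum>j<n. A $$ (i, j) * B $$ (j, i))"
    "(B * A) $$ (i, i) = (\<Sum>j<n. A $$ (j, i) * B $$ (i, j))" if "i < n" for i
    using assms that by (auto simp: scalar_prod_def atLeast0LessThan mult.commute)
  then have "(\<Sum>i<n. (A * B) $$ (i, i)) = (\<Sum>i<n. \<Sum>j<n. A $$ (i, j) * B $$ (j, i))"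
    "(\<Sum>i<n. (B * A) $$ (i, i)) = (\<Sum>i<n. \<Sum>j<n. A $$ (j, i) * B $$ (i, j))"
    by simp_all
  then show ?thesis by (simp only:) (rule sum.swap)
qed

text \<open>The diagonal entries are idempotent complex numbers, hence 0 or 1, so trace zero makes
  all of them vanish. What remains is strictly triangular, hence nilpotent, and a nilpotent
  idempotent is zero.\<close>

lemma idempotent_upper_triangular_trace_0:
  fixes B :: "complex mat"
  assumes B: "B \<in> carrier_mat n n" and ut: "upper_triangular B" and idem: "B * B = B"
    and tr: "(\<Sum>i<n. B $$ (i, i)) = 0"
  shows "B = 0\<^sub>m n n"
proof -
  have entry: "B $$ (i, j) = (\<Sum>k<n. B $$ (i, k) * B $$ (k, j))" if "i < n" "j < n" for i j
    using B that by (subst idem[symmetric]) (auto simp: scalar_prod_def atLeast0LessThan)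
  have low: "B $$ (i, j) = 0" if "i < n" "j < i" for i j
    using ut B that by auto
  have diag: "B $$ (i, i) = 0 \<or> B $$ (i, i) = 1" if "i < n" for i
  proof -
    have "(\<Sum>k<n. B $$ (i, k) * B $$ (k, i)) = (\<Sum>k\<in>{i}. B $$ (i, k) * B $$ (k, i))"
      using that low by (intro sum.mono_neutral_right) (auto, metis linorder_neqE_nat)
    with entry[OF that that] show ?thesis by simp
  qed
  have "(\<Sum>i<n. Re (B $$ (i, i))) = 0" using arg_cong[OF tr, of Re] by simp
  moreover have "0 \<le> Re (B $$ (i, i))" if "i < n" for i using diag[OF that] by auto
  ultimately have "\<forall>i<n. Re (B $$ (i, i)) = 0"
    by (subst (asm) sum_nonneg_eq_0_iff) auto
  then have diag0: "B $$ (i, i) = 0" if "i < n" for i using diag[OF that] that by auto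
  \<comment> \<open>Induction on the distance from the diagonal. In the sum for
    \<open>B $$ (i, j)\<close>, a term with \<open>i < k\<close> and \<open>k < j\<close> contains
    the entry \<open>B $$ (i, k)\<close>, which is nearer to the diagonal; every other term has a
    factor on or below the diagonal.\<close>
  have "i < n \<Longrightarrow> j < n \<Longrightarrow> B $$ (i, j) = 0" for i j
  proof (induction "j - i" arbitrary: i j rule: less_induct)
    case less
    have "B $$ (i, k) * B $$ (k, j) = 0" if k: "k < n" for k
    proof (cases "i < k \<and> k < j")
      case True
      then show ?thesis using less(1)[of k i] less(2) k by auto
    next
      case False
      then have "k < i \<or> k = i \<or> j < k \<or> k = j" by auto
      then show ?thesis using low[OF less(2)] low[OF k] diag0[OF k] by auto
    qed
    then have "(\<Sum>k<n. B $$ (i, k) * B $$ (k, j)) = 0" by (intro sum.neutral) blast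
    then show ?case using entry[OF less(2,3)] by metis
  qed
  then show ?thesis using B by (intro eq_matI) auto
qed

text \<open>Over the complex numbers the characteristic polynomial splits, so a Schur decomposition
  makes the matrix similar to a triangular one. Idempotency and trace survive the
  conjugation.\<close>

lemma idempotent_mat_trace_0:
  fixes A :: "complex mat"
  assumes A: "A \<in> carrier_mat n n" and idem: "A * A = A" and tr: "(\<Sum>i<n. A $$ (i, i)) = 0"
  shows "A = 0\<^sub>m n n"
proof -
  obtain es where "char_poly A = (\<Prod>a\<leftarrow>es. [:- a, 1:])" using char_poly_factorized[OF A] by blast
  from schur_decomposition_exists[OF A this] obtain B where B: "B \<in> carrier_mat n n"
    "upper_triangular B" "similar_mat A B" by blast
  then obtain P Q where wit: "similar_mat_wit A B P Q" by (auto simp: similar_mat_def)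
  note w = similar_mat_witD2[OF A wit]
  have 1: "A * P = P * B"
  proof -
    have "A * P = P * B * (Q * P)" using w by (simp add: assoc_mult_mat[of _ n n _ n _ n])
    then show ?thesis using w by simp
  qed
  have 2: "B = Q * (A * P)"
  proof -
    have "B = (Q * P) * B" using w by simp
    also have "\<dots> = Q * (P * B)" using w by (intro assoc_mult_mat) auto
    finally show ?thesis using 1 by simp
  qed
  have AP: "A * P \<in> carrier_mat n n" using w A by auto
  have "B * B = Q * (A * P) * B" by (simp add: 2[symmetric])
  also have "\<dots> = Q * ((A * P) * B)" using w AP by (intro assoc_mult_mat) auto
  also have "(A * P) * B = A * (P * B)" using w A by (intro assoc_mult_mat) auto
  also have "A * (P * B) = (A * A) * P"
    unfolding 1[symmetric] using w A by (intro assoc_mult_mat[symmetric]) auto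
  finally have idB: "B * B = B" using 2 idem by simp
  have "(\<Sum>i<n. B $$ (i, i)) = (\<Sum>i<n. (A * P * Q) $$ (i, i))"
    by (subst 2, rule sum_diag_mult_comm) (use w AP in auto)
  also have "A * P * Q = A * (P * Q)" using w A by (intro assoc_mult_mat) auto
  also have "\<dots> = A" using w A by simp
  finally have "B = 0\<^sub>m n n"
    using tr idempotent_upper_triangular_trace_0[OF B(1,2) idB] by simp
  then show ?thesis using w by simp
qed

text \<open>The form in which the matrix result is applied: rows and columns are indexed by the
  elements of a finite monoid, numbered here by an arbitrary bijection.\<close>

lemma finite_idempotent_trace_0:
  fixes P :: "'a \<Rightarrow> 'a \<Rightarrow> complex"
  assumes S: "finite S" and idem: "\<And>r t. r \<in> S \<Longrightarrow> t \<in> S \<Longrightarrow> (\<Sum>s\<in>S. P r s * P s t) = P r t"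
    and tr: "(\<Sum>s\<in>S. P s s) = 0" and rt: "r \<in> S" "t \<in> S"
  shows "P r t = 0"
proof -
  obtain f where f: "bij_betw f {..<card S} S"
    using ex_bij_betw_nat_finite[OF S] by (auto simp: atLeast0LessThan)
  note re = sum.reindex_bij_betw[OF f]
  let ?n = "card S"
  let ?A = "mat ?n ?n (\<lambda>(i, j). P (f i) (f j))"
  have fS: "f i \<in> S" if "i < ?n" for i using f that by (auto simp: bij_betw_def)
  have z: "?A = 0\<^sub>m ?n ?n"
  proof (rule idempotent_mat_trace_0)
    show "?A * ?A = ?A"
    proof (rule eq_matI)
      fix i j assume "i < dim_row ?A" "j < dim_col ?A"
      then have ij: "i < ?n" "j < ?n" by auto
      then have "(?A * ?A) $$ (i, j) = (\<Sum>k<?n. P (f i) (f k) * P (f k) (f j))"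
        by (auto simp: scalar_prod_def atLeast0LessThan)
      also have "\<dots> = P (f i) (f j)" using re[of "\<lambda>s. P (f i) s * P s (f j)"] idem fS ij by simp
      finally show "(?A * ?A) $$ (i, j) = ?A $$ (i, j)" using ij by simp
    qed auto
    show "(\<Sum>i<?n. ?A $$ (i, i)) = 0" using tr re[of "\<lambda>s. P s s"] by simp
  qed auto
  obtain i j where ij: "i < ?n" "j < ?n" "r = f i" "t = f j"
    using f rt by (metis bij_betw_imp_surj_on imageE lessThan_iff)
  have "P r t = ?A $$ (i, j)" using ij by simp
  then show ?thesis using ij(1,2) unfolding z by simp
qed

text \<open>A trivial kernel forces a nonzero determinant. Both one-sided inverse laws are recorded
  because the Casimir computation uses each of them.\<close>

lemma finite_matrix_inverse:
  fixes g :: "'a \<Rightarrow> 'a \<Rightarrow> 'b :: field"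
  assumes S: "finite S"
    and nondeg: "\<And>v. (\<forall>p\<in>S. (\<Sum>q\<in>S. g p q * v q) = 0) \<Longrightarrow> \<forall>q\<in>S. v q = 0"
  obtains e where "\<And>p r. p \<in> S \<Longrightarrow> r \<in> S \<Longrightarrow> (\<Sum>q\<in>S. g p q * e q r) = (if p = r then 1 else 0)"
    "\<And>p r. p \<in> S \<Longrightarrow> r \<in> S \<Longrightarrow> (\<Sum>q\<in>S. e p q * g q r) = (if p = r then 1 else 0)"
proof -
  obtain f where f: "bij_betw f {..<card S} S"
    using ex_bij_betw_nat_finite[OF S] by (auto simp: atLeast0LessThan)
  note re = sum.reindex_bij_betw[OF f]
  let ?n = "card S"
  let ?A = "mat ?n ?n (\<lambda>(i, j). g (f i) (f j))"
  define f' where "f' = the_inv_into {..<?n} f"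
  have f': "f' s < ?n" "f (f' s) = s" if "s \<in> S" for s
    using f that f_the_inv_into_f_bij_betw[OF f] the_inv_into_into[of f "{..<?n}" s "{..<?n}"]
    by (auto simp: f'_def bij_betw_def)
  have f'f: "f' (f i) = i" if "i < ?n" for i
    using f that by (auto simp: f'_def bij_betw_def the_inv_into_f_f)
  have "det ?A \<noteq> 0"
  proof
    assume "det ?A = 0"
    then obtain v where v: "v \<in> carrier_vec ?n" "v \<noteq> 0\<^sub>v ?n" "?A *\<^sub>v v = 0\<^sub>v ?n"
      using det_0_iff_vec_prod_zero_field[of ?A ?n] by auto
    have "(\<Sum>q\<in>S. g p q * (v $ f' q)) = 0" if p: "p \<in> S" for p
    proof -
      have "(\<Sum>q\<in>S. g p q * (v $ f' q)) = (\<Sum>j<?n. g p (f j) * (v $ f' (f j)))" by (rule re[symmetric])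
      also have "\<dots> = (\<Sum>j<?n. g (f (f' p)) (f j) * v $ j)"
        using f'(2)[OF p] f'f by (intro sum.cong) auto
      also have "\<dots> = (?A *\<^sub>v v) $ f' p"
        using f'(1)[OF p] v(1) by (simp add: scalar_prod_def atLeast0LessThan)
      finally show ?thesis using v(3) f'(1)[OF p] by simp
    qed
    from nondeg[of "\<lambda>q. v $ f' q"] this have "\<forall>q\<in>S. v $ f' q = 0" by blast
    moreover have "f i \<in> S" if "i < ?n" for i using f that by (auto simp: bij_betw_def)
    ultimately have "v $ i = 0" if "i < ?n" for i using f'f that by metis
    then have "v = 0\<^sub>v ?n" using v(1) by (intro eq_vecI) auto
    with v(2) show False by blast
  qed
  from det_non_zero_imp_unit[OF _ this, of ?n "()"] obtain E where E: "E \<in> carrier_mat ?n ?n"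
    "?A * E = 1\<^sub>m ?n" "E * ?A = 1\<^sub>m ?n" by (auto simp: Units_def ring_mat_simps)
  have inj: "f' p = f' r \<longleftrightarrow> p = r" if "p \<in> S" "r \<in> S" for p r using f'(2) that by metis
  show ?thesis
  proof (rule that[of "\<lambda>p q. E $$ (f' p, f' q)"])
    fix p r assume pr: "p \<in> S" "r \<in> S"
    have "(\<Sum>q\<in>S. g p q * E $$ (f' q, f' r)) = (\<Sum>j<?n. g p (f j) * E $$ (f' (f j), f' r))"
      by (rule re[symmetric])
    also have "\<dots> = (\<Sum>j<?n. g (f (f' p)) (f j) * E $$ (j, f' r))"
      using f'(2)[OF pr(1)] f'f by (intro sum.cong) auto
    also have "\<dots> = (?A * E) $$ (f' p, f' r)"
      using f'(1) pr E(1) by (simp add: scalar_prod_def atLeast0LessThan)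
    finally show "(\<Sum>q\<in>S. g p q * E $$ (f' q, f' r)) = (if p = r then 1 else 0)"
      using E(2) f'(1) inj pr by simp
    have "(\<Sum>q\<in>S. E $$ (f' p, f' q) * g q r) = (\<Sum>j<?n. E $$ (f' p, f' (f j)) * g (f j) r)"
      by (rule re[symmetric])
    also have "\<dots> = (\<Sum>j<?n. E $$ (f' p, j) * g (f j) (f (f' r)))"
      using f'(2)[OF pr(2)] f'f by (intro sum.cong) auto
    also have "\<dots> = (E * ?A) $$ (f' p, f' r)"
      using f'(1) pr E(1) by (simp add: scalar_prod_def atLeast0LessThan)
    finally show "(\<Sum>q\<in>S. E $$ (f' p, f' q) * g q r) = (if p = r then 1 else 0)"
      using E(3) f'(1) inj pr by simp
  qed
qed

section \<open>Linear algebra in monoid algebras\<close>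

abbreviation pscale :: "complex \<Rightarrow> ('x \<Rightarrow>\<^sub>0 complex) \<Rightarrow> 'x \<Rightarrow>\<^sub>0 complex" where
  "pscale c f \<equiv> Poly_Mapping.map ((*) c) f"

lemma lookup_pscale [simp]: "Poly_Mapping.lookup (pscale c f) x = c * Poly_Mapping.lookup f x"
  by (simp add: Poly_Mapping.map.rep_eq when_def)

lemma lookup_basis_vec: "Poly_Mapping.lookup (basis_vec x) y = (if x = y then 1 else 0)"
  by (simp add: lookup_single when_def)

lemma lookup_eq_0: "Poly_Mapping.keys f \<subseteq> A \<Longrightarrow> x \<notin> A \<Longrightarrow> Poly_Mapping.lookup f x = 0"
  by (auto simp: in_keys_iff)

lemma keys_subset_iff: "Poly_Mapping.keys f \<subseteq> A \<longleftrightarrow> (\<forall>x. x \<notin> A \<longrightarrow> Poly_Mapping.lookup f x = 0)"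
  by (auto simp: in_keys_iff)

text \<open>The one-variable counterpart of \<open>bilin\<close>: the linear map with prescribed
  values on basis vectors.\<close>

definition lext :: "('x \<Rightarrow> 'y \<Rightarrow>\<^sub>0 complex) \<Rightarrow> ('x \<Rightarrow>\<^sub>0 complex) \<Rightarrow> 'y \<Rightarrow>\<^sub>0 complex" where
  "lext b f = (\<Sum>x\<in>Poly_Mapping.keys f. pscale (Poly_Mapping.lookup f x) (b x))"

lemma lookup_lext:
  assumes "finite A" "Poly_Mapping.keys f \<subseteq> A"
  shows "Poly_Mapping.lookup (lext b f) z = (\<Sum>x\<in>A. Poly_Mapping.lookup f x * Poly_Mapping.lookup (b x) z)"
  unfolding lext_def lookup_sum lookup_pscale
  using assms by (intro sum.mono_neutral_left) (auto simp: in_keys_iff)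

lemma lookup_bilin:
  assumes "finite A" "Poly_Mapping.keys f \<subseteq> A" "finite B" "Poly_Mapping.keys g \<subseteq> B"
  shows "Poly_Mapping.lookup (bilin b f g) z =
    (\<Sum>x\<in>A. \<Sum>y\<in>B. Poly_Mapping.lookup f x * Poly_Mapping.lookup g y * Poly_Mapping.lookup (b x y) z)"
proof -
  have "Poly_Mapping.lookup (bilin b f g) z = (\<Sum>x\<in>Poly_Mapping.keys f. \<Sum>y\<in>Poly_Mapping.keys g.
      Poly_Mapping.lookup f x * Poly_Mapping.lookup g y * Poly_Mapping.lookup (b x y) z)"
    by (simp add: bilin_def lookup_sum)
  also have "\<dots> = (\<Sum>x\<in>Poly_Mapping.keys f. \<Sum>y\<in>B.
      Poly_Mapping.lookup f x * Poly_Mapping.lookup g y * Poly_Mapping.lookup (b x y) z)"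
    using assms by (intro sum.cong refl sum.mono_neutral_left) (auto simp: in_keys_iff)
  also have "\<dots> = (\<Sum>x\<in>A. \<Sum>y\<in>B.
      Poly_Mapping.lookup f x * Poly_Mapping.lookup g y * Poly_Mapping.lookup (b x y) z)"
    using assms by (intro sum.mono_neutral_left) (auto simp: in_keys_iff)
  finally show ?thesis .
qed

definition clinear :: "(('x \<Rightarrow>\<^sub>0 complex) \<Rightarrow> ('y \<Rightarrow>\<^sub>0 complex)) \<Rightarrow> bool" where
  "clinear F \<longleftrightarrow> (\<forall>f g. F (f + g) = F f + F g) \<and> (\<forall>c f. F (pscale c f) = pscale c (F f))"

lemma clinear_add: "clinear F \<Longrightarrow> F (f + g) = F f + F g"
  and clinear_pscale: "clinear F \<Longrightarrow> F (pscale c f) = pscale c (F f)"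
  by (auto simp: clinear_def)

lemma clinear_zero: "clinear F \<Longrightarrow> F 0 = 0"
  using clinear_add[of F 0 0] by simp

lemma clinear_minus: "clinear F \<Longrightarrow> F (- f) = - F f"
  using clinear_add[of F f "- f"] clinear_zero[of F] by (simp add: eq_neg_iff_add_eq_0 add.commute)

lemma clinear_diff: "clinear F \<Longrightarrow> F (f - g) = F f - F g"
  using clinear_add[of F f "- g"] clinear_minus[of F g] by simp

lemma clinear_sum: "clinear F \<Longrightarrow> F (\<Sum>i\<in>I. f i) = (\<Sum>i\<in>I. F (f i))"
  by (induction I rule: infinite_finite_induct) (auto simp: clinear_zero clinear_add)

lemma clinear_compose: "clinear F \<Longrightarrow> clinear G \<Longrightarrow> clinear (\<lambda>f. F (G f))"
  by (simp add: clinear_def)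

lemma clinear_id: "clinear (\<lambda>f. f)"
  by (simp add: clinear_def)

lemma pscale_pscale: "pscale c (pscale d f) = pscale (c * d) f"
  by (rule poly_mapping_eqI) simp

lemma pscale_one [simp]: "pscale 1 f = f"
  by (rule poly_mapping_eqI) simp

lemma pscale_0 [simp]: "pscale 0 f = 0"
  by (rule poly_mapping_eqI) simp

lemma pscale_basis_vec: "pscale c (basis_vec x) = Poly_Mapping.single x c"
  by (rule poly_mapping_eqI) (simp add: lookup_single when_def)

lemma keys_pscale_subset: "Poly_Mapping.keys f \<subseteq> A \<Longrightarrow> Poly_Mapping.keys (pscale c f) \<subseteq> A"
  by (auto simp: in_keys_iff)

lemma keys_add_subset: "Poly_Mapping.keys f \<subseteq> A \<Longrightarrow> Poly_Mapping.keys g \<subseteq> A \<Longrightarrow>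
    Poly_Mapping.keys (f + g) \<subseteq> A"
  using keys_add[of f g] by blast

lemma keys_sum_subset: "(\<And>i. i \<in> I \<Longrightarrow> Poly_Mapping.keys (f i) \<subseteq> A) \<Longrightarrow>
    Poly_Mapping.keys (\<Sum>i\<in>I. f i) \<subseteq> A"
  using keys_sum[of f I] by fast

lemma clinear_lext: "clinear (lext b)"
  unfolding clinear_def
proof (intro conjI allI)
  fix f g :: "'a \<Rightarrow>\<^sub>0 complex" and c
  let ?A = "Poly_Mapping.keys f \<union> Poly_Mapping.keys g"
  show "lext b (f + g) = lext b f + lext b g"
    by (rule poly_mapping_eqI)
      (simp add: lookup_add lookup_lext[of ?A] keys_add sum.distrib algebra_simps)
  show "lext b (pscale c f) = pscale c (lext b f)"
    by (rule poly_mapping_eqI)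
      (simp add: lookup_lext[of "Poly_Mapping.keys f"] keys_pscale_subset sum_distrib_left mult.assoc)
qed

lemma clinear_bilin1: "clinear (\<lambda>f :: 'a \<Rightarrow>\<^sub>0 complex. bilin b f g)"
  unfolding clinear_def
proof (intro conjI allI)
  fix f f' :: "'a \<Rightarrow>\<^sub>0 complex" and c
  let ?A = "Poly_Mapping.keys f \<union> Poly_Mapping.keys f'" and ?B = "Poly_Mapping.keys g"
  show "bilin b (f + f') g = bilin b f g + bilin b f' g"
    by (rule poly_mapping_eqI)
      (simp add: lookup_add lookup_bilin[of ?A _ ?B] keys_add sum.distrib distrib_left distrib_right)
  show "bilin b (pscale c f) g = pscale c (bilin b f g)"
    by (rule poly_mapping_eqI)
      (simp add: lookup_bilin[of ?A _ ?B] keys_pscale_subset sum_distrib_left mult.assoc)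
qed

lemma clinear_bilin2: "clinear (\<lambda>g :: 'b \<Rightarrow>\<^sub>0 complex. bilin b f g)"
  unfolding clinear_def
proof (intro conjI allI)
  fix g g' :: "'b \<Rightarrow>\<^sub>0 complex" and c
  let ?B = "Poly_Mapping.keys g \<union> Poly_Mapping.keys g'" and ?A = "Poly_Mapping.keys f"
  show "bilin b f (g + g') = bilin b f g + bilin b f g'"
    by (rule poly_mapping_eqI)
      (simp add: lookup_add lookup_bilin[of ?A _ ?B] keys_add sum.distrib distrib_left distrib_right)
  show "bilin b f (pscale c g) = pscale c (bilin b f g)"
    by (rule poly_mapping_eqI)
      (simp add: lookup_bilin[of ?A _ ?B] keys_pscale_subset sum_distrib_left ac_simps)
qed

lemma lext_basis_vec [simp]: "lext b (basis_vec x) = b x"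
  by (rule poly_mapping_eqI) (simp add: lookup_lext[of "{x}"])

lemma bilin_basis_vec [simp]: "bilin b (basis_vec x) (basis_vec y) = b x y"
  by (rule poly_mapping_eqI) (simp add: lookup_bilin[of "{x}" _ "{y}"])

lemma lext_basis_vec_id: "lext basis_vec f = f"
  by (rule poly_mapping_eqI)
    (auto simp: lookup_lext[of "Poly_Mapping.keys f"] lookup_basis_vec in_keys_iff if_distrib[of "(*) _"]
      cong: if_cong)

text \<open>The tool for all identities between multilinear expressions below: applied once per
  variable, it reduces them to basis vectors. The support condition matters because the identities
  hold only for elements of a given submonoid or Green class.\<close>

lemma clinear_ext:
  assumes F: "clinear F" and G: "clinear G" and eq: "\<And>x. x \<in> S \<Longrightarrow> F (basis_vec x) = G (basis_vec x)"
    and f: "Poly_Mapping.keys f \<subseteq> S"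
  shows "F f = G f"
proof -
  have "F (lext basis_vec f) = G (lext basis_vec f)"
    unfolding lext_def clinear_sum[OF F] clinear_sum[OF G] clinear_pscale[OF F] clinear_pscale[OF G]
    using eq f by (intro sum.cong) auto
  then show ?thesis by (simp add: lext_basis_vec_id)
qed

lemma keys_lext: "(\<And>x. x \<in> Poly_Mapping.keys f \<Longrightarrow> Poly_Mapping.keys (b x) \<subseteq> S) \<Longrightarrow> Poly_Mapping.keys (lext b f) \<subseteq> S"
  unfolding lext_def by (intro keys_sum_subset keys_pscale_subset)

lemma keys_bilin:
  "(\<And>x y. x \<in> Poly_Mapping.keys f \<Longrightarrow> y \<in> Poly_Mapping.keys g \<Longrightarrow> Poly_Mapping.keys (b x y) \<subseteq> S)
    \<Longrightarrow> Poly_Mapping.keys (bilin b f g) \<subseteq> S"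
  unfolding bilin_def by (intro keys_sum_subset keys_pscale_subset)

lemma keys_diff_subset: "Poly_Mapping.keys c \<subseteq> A \<Longrightarrow> Poly_Mapping.keys d \<subseteq> A \<Longrightarrow>
    Poly_Mapping.keys (c - d) \<subseteq> A" for c d :: "'x \<Rightarrow>\<^sub>0 'y :: cancel_comm_monoid_add"
  using keys_diff[of c d] by blast

lemma keys_frag_of_subset: "p \<in> A \<Longrightarrow> Poly_Mapping.keys (frag_of p) \<subseteq> A"
  by simp

lemma sum_single_lookup:
  assumes "finite A" "Poly_Mapping.keys f \<subseteq> A"
  shows "(\<Sum>z\<in>A. Poly_Mapping.single z (Poly_Mapping.lookup f z)) = f"
proof (rule poly_mapping_eqI)
  fix k
  show "Poly_Mapping.lookup (\<Sum>z\<in>A. Poly_Mapping.single z (Poly_Mapping.lookup f z)) k = Poly_Mapping.lookup f k"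
    using assms by (cases "k \<in> A") (auto simp: lookup_sum lookup_single when_def in_keys_iff)
qed

text \<open>The coordinate projection onto C[J], written as a linear extension so that linearity is
  immediate.\<close>

definition restrict_pm :: "'x set \<Rightarrow> ('x \<Rightarrow>\<^sub>0 complex) \<Rightarrow> 'x \<Rightarrow>\<^sub>0 complex" where
  "restrict_pm J = lext (\<lambda>z. if z \<in> J then basis_vec z else 0)"

lemma lookup_restrict_pm: "Poly_Mapping.lookup (restrict_pm J f) z = (if z \<in> J then Poly_Mapping.lookup f z else 0)"
proof -
  have "Poly_Mapping.lookup (restrict_pm J f) z =
      (\<Sum>x\<in>Poly_Mapping.keys f. if x = z then (if z \<in> J then Poly_Mapping.lookup f z else 0) else 0)"
    unfolding restrict_pm_def lookup_lext[OF finite_keys subset_refl]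
    by (intro sum.cong) (auto simp: lookup_basis_vec)
  then show ?thesis by (simp add: in_keys_iff)
qed

lemma restrict_pm_keys: "Poly_Mapping.keys (restrict_pm J f) \<subseteq> J"
  by (simp add: keys_subset_iff lookup_restrict_pm)

lemma clinear_restrict_pm: "clinear (restrict_pm J)"
  unfolding restrict_pm_def by (rule clinear_lext)

lemma restrict_pm_basis_vec: "restrict_pm J (basis_vec z) = (if z \<in> J then basis_vec z else 0)"
  by (simp add: restrict_pm_def)

lemma monoid_algebra_simps [simp]:
  "carrier (monoid_algebra G) = {f. Poly_Mapping.keys f \<subseteq> carrier G}"
  "monoid.mult (monoid_algebra G) = bilin (\<lambda>x y. basis_vec (x \<otimes>\<^bsub>G\<^esub> y))"
  "\<one>\<^bsub>monoid_algebra G\<^esub> = basis_vec \<one>\<^bsub>G\<^esub>"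
  "\<zero>\<^bsub>monoid_algebra G\<^esub> = 0"
  "ring.add (monoid_algebra G) = (+)"
  by (simp_all add: monoid_algebra_def)

lemma (in monoid) ring_monoid_algebra: "ring (monoid_algebra G)"
proof -
  let ?m = "bilin (\<lambda>x y. basis_vec (x \<otimes> y))"
  have closed: "Poly_Mapping.keys (?m f g) \<subseteq> carrier G"
    if "Poly_Mapping.keys f \<subseteq> carrier G" "Poly_Mapping.keys g \<subseteq> carrier G" for f g
    by (rule keys_bilin) (use that in auto)
  have "?m (basis_vec \<one>) f = f" if "Poly_Mapping.keys f \<subseteq> carrier G" for f
    by (rule clinear_ext[OF clinear_bilin2 clinear_id _ that]) simp
  moreover have "?m f (basis_vec \<one>) = f" if "Poly_Mapping.keys f \<subseteq> carrier G" for f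
    by (rule clinear_ext[OF clinear_bilin1 clinear_id _ that]) simp
  moreover have "?m (?m f g) h = ?m f (?m g h)"
    if f: "Poly_Mapping.keys f \<subseteq> carrier G" and g: "Poly_Mapping.keys g \<subseteq> carrier G"
      and h: "Poly_Mapping.keys h \<subseteq> carrier G" for f g h
  proof (rule clinear_ext[OF clinear_compose[OF clinear_bilin1 clinear_bilin1] clinear_bilin1 _ f])
    fix x assume x: "x \<in> carrier G"
    show "?m (?m (basis_vec x) g) h = ?m (basis_vec x) (?m g h)"
    proof (rule clinear_ext[OF clinear_compose[OF clinear_bilin1 clinear_bilin2]
          clinear_compose[OF clinear_bilin2 clinear_bilin1] _ g])
      fix y assume y: "y \<in> carrier G"
      show "?m (?m (basis_vec x) (basis_vec y)) h = ?m (basis_vec x) (?m (basis_vec y) h)"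
        by (rule clinear_ext[OF clinear_bilin2 clinear_compose[OF clinear_bilin2 clinear_bilin2] _ h])
          (use x y in \<open>simp add: m_assoc\<close>)
    qed
  qed
  ultimately have mon: "monoid (monoid_algebra G)"
    using closed by (intro monoidI) auto
  have ab: "abelian_group (monoid_algebra G)"
  proof (rule abelian_groupI)
    fix f assume "f \<in> carrier (monoid_algebra G)"
    then show "\<exists>g\<in>carrier (monoid_algebra G). g \<oplus>\<^bsub>monoid_algebra G\<^esub> f = \<zero>\<^bsub>monoid_algebra G\<^esub>"
      by (intro bexI[of _ "- f"]) (auto simp: in_keys_iff)
  qed (auto simp: add_ac dest!: subsetD[OF keys_add])
  show ?thesis
    by (rule ringI[OF ab mon]) (auto simp: clinear_add[OF clinear_bilin1] clinear_add[OF clinear_bilin2])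
qed

section \<open>Left ideals of a semisimple ring: complements and idempotents\<close>

context ring begin

lemma left_idealD:
  assumes "left_ideal I R"
  shows "I \<subseteq> carrier R" "\<zero> \<in> I" "x \<in> I \<Longrightarrow> y \<in> I \<Longrightarrow> x \<oplus> y \<in> I" "x \<in> I \<Longrightarrow> \<ominus> x \<in> I"
    "a \<in> carrier R \<Longrightarrow> x \<in> I \<Longrightarrow> a \<otimes> x \<in> I"
proof -
  interpret additive_subgroup I R using assms by (simp add: left_ideal_def)
  show "I \<subseteq> carrier R" "\<zero> \<in> I" "x \<in> I \<Longrightarrow> y \<in> I \<Longrightarrow> x \<oplus> y \<in> I" "x \<in> I \<Longrightarrow> \<ominus> x \<in> I"
    by (auto intro: a_inv_closed)
  show "a \<in> carrier R \<Longrightarrow> x \<in> I \<Longrightarrow> a \<otimes> x \<in> I" using assms by (simp add: left_ideal_def)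
qed

text \<open>Closure under negation follows from
  \<open>\<ominus> x = (\<ominus> \<one>) \<otimes> x\<close>.\<close>

lemma left_idealI:
  assumes "I \<subseteq> carrier R" "\<zero> \<in> I" "\<And>x y. x \<in> I \<Longrightarrow> y \<in> I \<Longrightarrow> x \<oplus> y \<in> I"
    "\<And>a x. a \<in> carrier R \<Longrightarrow> x \<in> I \<Longrightarrow> a \<otimes> x \<in> I"
  shows "left_ideal I R"
proof -
  have "\<ominus> x \<in> I" if "x \<in> I" for x
    using assms(4)[OF a_inv_closed[OF one_closed] that] assms(1) that by (auto simp: l_minus)
  then have "subgroup I (add_monoid R)"
    using assms by (intro add.subgroupI) (auto simp: a_inv_def)
  then show ?thesis using assms(4) by (auto simp: left_ideal_def additive_subgroup_def)
qed

lemma left_ideal_set_add: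
  assumes "left_ideal I R" "left_ideal J R"
  shows "left_ideal (I <+>\<^bsub>R\<^esub> J) R"
proof -
  note I = left_idealD[OF assms(1)] and J = left_idealD[OF assms(2)]
  have mem: "z \<in> I <+>\<^bsub>R\<^esub> J \<longleftrightarrow> (\<exists>x\<in>I. \<exists>y\<in>J. z = x \<oplus> y)" for z
    by (auto simp: set_add_def set_mult_def)
  show ?thesis
  proof (rule left_idealI)
    show "I <+>\<^bsub>R\<^esub> J \<subseteq> carrier R" using I(1) J(1) unfolding subset_iff mem by blast
    show "\<zero> \<in> I <+>\<^bsub>R\<^esub> J" unfolding mem using I(2) J(2) by (metis zero_closed r_zero)
  next
    fix x y assume "x \<in> I <+>\<^bsub>R\<^esub> J" "y \<in> I <+>\<^bsub>R\<^esub> J"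
    then obtain a b c d where abcd: "a \<in> I" "b \<in> J" "c \<in> I" "d \<in> J" "x = a \<oplus> b" "y = c \<oplus> d"
      unfolding mem by blast
    then have "x \<oplus> y = (a \<oplus> c) \<oplus> (b \<oplus> d)"
      using I(1) J(1) by (simp add: subset_iff a_ac)
    then show "x \<oplus> y \<in> I <+>\<^bsub>R\<^esub> J" unfolding mem using I(3) J(3) abcd by blast
  next
    fix a x assume a: "a \<in> carrier R" and "x \<in> I <+>\<^bsub>R\<^esub> J"
    then obtain b c where bc: "b \<in> I" "c \<in> J" "x = b \<oplus> c" unfolding mem by blast
    then have "a \<otimes> x = a \<otimes> b \<oplus> a \<otimes> c"
      using I(1) J(1) a by (simp add: subset_iff r_distr)
    then show "a \<otimes> x \<in> I <+>\<^bsub>R\<^esub> J" unfolding mem using I(5) J(5) a bc by blast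
  qed
qed

lemma set_add_iff: "z \<in> I <+>\<^bsub>R\<^esub> J \<longleftrightarrow> (\<exists>x\<in>I. \<exists>y\<in>J. z = x \<oplus> y)"
  by (auto simp: set_add_def set_mult_def)

lemma left_ideal_Int: "left_ideal I R \<Longrightarrow> left_ideal J R \<Longrightarrow> left_ideal (I \<inter> J) R"
  using left_idealD by (intro left_idealI) auto

lemma subset_set_add:
  assumes "left_ideal I R" "left_ideal J R"
  shows "I \<subseteq> I <+>\<^bsub>R\<^esub> J" "J \<subseteq> I <+>\<^bsub>R\<^esub> J"
proof -
  note I = left_idealD[OF assms(1)] and J = left_idealD[OF assms(2)]
  show "I \<subseteq> I <+>\<^bsub>R\<^esub> J" "J \<subseteq> I <+>\<^bsub>R\<^esub> J"
    unfolding subset_iff set_add_iff using I(1,2) J(1,2) by (metis r_zero l_zero subsetD)+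
qed

text \<open>Greedy construction of a complement. A simple \<open>J\<close> not contained in
  \<open>I + U\<close> meets \<open>I + U\<close> only in zero, so it can be added to
  \<open>U\<close> while \<open>U\<close> still meets \<open>I\<close> trivially.\<close>

lemma complement_of_simple_left_ideals:
  assumes "finite S" "\<forall>J\<in>S. simple_left_ideal J R" "left_ideal I R"
  shows "\<exists>U. left_ideal U R \<and> I \<inter> U = {\<zero>} \<and> (\<forall>J\<in>S. J \<subseteq> I <+>\<^bsub>R\<^esub> U)"
  using assms(1,2)
proof (induction S rule: finite_induct)
  case empty
  have "left_ideal {\<zero>} R" by (rule left_idealI) auto
  then show ?case using left_idealD(2)[OF assms(3)] by blast
next
  case (insert J S)
  then obtain U where U: "left_ideal U R" "I \<inter> U = {\<zero>}" "\<forall>J\<in>S. J \<subseteq> I <+>\<^bsub>R\<^esub> U" by auto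
  note IU = left_ideal_set_add[OF assms(3) U(1)]
  have J: "left_ideal J R" "\<And>I'. left_ideal I' R \<Longrightarrow> I' \<subseteq> J \<Longrightarrow> I' = {\<zero>} \<or> I' = J"
    using insert(4) by (auto simp: simple_left_ideal_def)
  show ?case
  proof (cases "J \<subseteq> I <+>\<^bsub>R\<^esub> U")
    case True
    with U show ?thesis by blast
  next
    case False
    then have JIU: "J \<inter> (I <+>\<^bsub>R\<^esub> U) = {\<zero>}" using J(2)[OF left_ideal_Int[OF J(1) IU]] by blast
    note UJ = left_ideal_set_add[OF U(1) J(1)]
    have "x = \<zero>" if x: "x \<in> I" "x \<in> U <+>\<^bsub>R\<^esub> J" for x
    proof -
      obtain u j where uj: "u \<in> U" "j \<in> J" "x = u \<oplus> j" using x(2) by (auto simp: set_add_iff)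
      have c: "x \<in> carrier R" "u \<in> carrier R" "j \<in> carrier R"
        using x(1) uj left_idealD(1)[OF U(1)] left_idealD(1)[OF J(1)] left_idealD(1)[OF assms(3)] by auto
      \<comment> \<open>An element \<open>x = u \<oplus> j\<close> of \<open>I\<close> puts
        \<open>j\<close> into both \<open>J\<close> and \<open>I + U\<close>, whose intersection is
        zero.\<close>
      have "j = x \<oplus> (\<ominus> u)" using c uj(3) by (simp add: a_ac r_neg)
      then have "j \<in> I <+>\<^bsub>R\<^esub> U" using x(1) left_idealD(4)[OF U(1) uj(1)] by (auto simp: set_add_iff)
      then have "j = \<zero>" using uj(2) JIU by blast
      then have "x = u" using uj(3) c by simp
      then show ?thesis using x(1) uj(1) U(2) by blast
    qed
    then have "I \<inter> (U <+>\<^bsub>R\<^esub> J) = {\<zero>}"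
      using left_idealD(2)[OF assms(3)] left_idealD(2)[OF UJ] by blast
    moreover have "I <+>\<^bsub>R\<^esub> U \<subseteq> I <+>\<^bsub>R\<^esub> (U <+>\<^bsub>R\<^esub> J)"
      using subset_set_add(1)[OF U(1) J(1)] unfolding subset_iff set_add_iff[of _ I] by blast
    moreover have "J \<subseteq> I <+>\<^bsub>R\<^esub> (U <+>\<^bsub>R\<^esub> J)"
      using subset_set_add(2)[OF U(1) J(1)] subset_set_add(2)[OF assms(3) UJ] by blast
    ultimately show ?thesis using UJ U(3) by blast
  qed
qed

text \<open>With a complement \<open>U\<close> of \<open>I\<close>, write
  \<open>\<one> = e \<oplus> u\<close>. For \<open>x\<close> in \<open>I\<close> the element
  \<open>x \<otimes> u = x \<oplus> \<ominus> (x \<otimes> e)\<close> lies in \<open>I\<close> and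
  in \<open>U\<close>, so it vanishes. Thus \<open>e\<close> is a right identity on
  \<open>I\<close>; it is therefore idempotent, and nonzero because \<open>I\<close> is.\<close>

lemma semisimple_left_ideal_idempotent:
  assumes ss: "semisimple_ring R" and I: "left_ideal I R" and nz: "I \<noteq> {\<zero>}"
  obtains e where "e \<in> I" "e \<noteq> \<zero>" "e \<otimes> e = e"
proof -
  obtain S where S: "finite S" "\<forall>J\<in>S. simple_left_ideal J R"
    "\<forall>a\<in>carrier R. \<exists>!f. f \<in> (\<Pi>\<^sub>E J\<in>S. J) \<and> a = (\<Oplus>J\<in>S. f J)"
    using ss by (auto simp: semisimple_ring_def)
  obtain U where U: "left_ideal U R" "I \<inter> U = {\<zero>}" "\<forall>J\<in>S. J \<subseteq> I <+>\<^bsub>R\<^esub> U"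
    using complement_of_simple_left_ideals[OF S(1,2) I] by blast
  note IU = left_ideal_set_add[OF I U(1)]
  \<comment> \<open>The unit is a sum of elements of the simple ideals in \<open>S\<close>, each of
    which lies in \<open>I + U\<close>; hence so does the unit.\<close>
  obtain f where f: "f \<in> (\<Pi>\<^sub>E J\<in>S. J)" "\<one> = (\<Oplus>J\<in>S. f J)" using S(3) one_closed by blast
  have fIU: "f J \<in> I <+>\<^bsub>R\<^esub> U" if "J \<in> S" for J using f(1) U(3) that by (auto simp: PiE_def Pi_def)
  have "T \<subseteq> S \<Longrightarrow> (\<Oplus>J\<in>T. f J) \<in> I <+>\<^bsub>R\<^esub> U" for T
  proof (induction T rule: infinite_finite_induct)
    case (insert J T)
    then have "f \<in> insert J T \<rightarrow> carrier R" using fIU left_idealD(1)[OF IU] by blast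
    then show ?case using insert fIU left_idealD(3)[OF IU] by (auto simp: Pi_iff)
  qed (use left_idealD(2)[OF IU] in \<open>auto simp: finsum_infinite\<close>)
  with f(2) have "\<one> \<in> I <+>\<^bsub>R\<^esub> U" by auto
  then obtain e u where eu: "e \<in> I" "u \<in> U" "\<one> = e \<oplus> u" by (auto simp: set_add_iff)
  have c: "e \<in> carrier R" "u \<in> carrier R"
    using eu left_idealD(1)[OF I] left_idealD(1)[OF U(1)] by auto
  have fixed: "x \<otimes> e = x" if x: "x \<in> I" for x
  proof -
    have xc: "x \<in> carrier R" using x left_idealD(1)[OF I] by blast
    have eq: "x = x \<otimes> e \<oplus> x \<otimes> u" using xc c by (simp add: r_distr[symmetric] eu(3)[symmetric])
    then have "x \<otimes> u = x \<oplus> \<ominus> (x \<otimes> e)"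
      using xc c by (metis a_comm a_inv_closed m_closed r_neg2 a_assoc r_neg1)
    then have "x \<otimes> u \<in> I" using x xc eu(1) left_idealD(3-5)[OF I] by metis
    then have "x \<otimes> u = \<zero>" using U(2) left_idealD(5)[OF U(1) xc eu(2)] by blast
    then show ?thesis using eq xc c by simp
  qed
  have "e \<noteq> \<zero>"
  proof
    assume "e = \<zero>"
    then have "x = \<zero>" if "x \<in> I" for x
      using fixed[OF that] left_idealD(1)[OF I] that by auto
    then show False using nz left_idealD(2)[OF I] by blast
  qed
  with fixed[OF eu(1)] eu(1) that show ?thesis by blast
qed

end

section \<open>Separability of semisimple monoid algebras\<close>

context monoid begin

text \<open>The trace of left multiplication by \<open>x\<close> on the regular module, computed in
  the basis of monoid elements: the number of fixed points of \<open>x\<close>.\<close>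

definition regular_char :: "'a \<Rightarrow> complex" where
  "regular_char x = (\<Sum>r\<in>carrier G. if x \<otimes> r = r then 1 else 0)"

text \<open>Multiplication by \<open>q\<close> maps fixed points of \<open>p \<otimes> q\<close> to
  fixed points of \<open>q \<otimes> p\<close>, and injectively so, since \<open>p\<close> undoes
  it. Exchanging the roles gives the other inequality.\<close>

lemma regular_char_comm:
  assumes fin: "finite (carrier G)" and p: "p \<in> carrier G" and q: "q \<in> carrier G"
  shows "regular_char (p \<otimes> q) = regular_char (q \<otimes> p)"
proof -
  have card: "regular_char x = of_nat (card {r \<in> carrier G. x \<otimes> r = r})" for x
    using fin by (simp add: regular_char_def sum.If_cases Int_def)
  have le: "card {r \<in> carrier G. (p \<otimes> q) \<otimes> r = r} \<le> card {r \<in> carrier G. (q \<otimes> p) \<otimes> r = r}"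
    if p: "p \<in> carrier G" and q: "q \<in> carrier G" for p q
  proof (rule card_inj_on_le[of "(\<otimes>) q"])
    show "inj_on ((\<otimes>) q) {r \<in> carrier G. (p \<otimes> q) \<otimes> r = r}"
    proof (rule inj_onI)
      fix r s assume "r \<in> {r \<in> carrier G. (p \<otimes> q) \<otimes> r = r}" "s \<in> {r \<in> carrier G. (p \<otimes> q) \<otimes> r = r}"
        "q \<otimes> r = q \<otimes> s"
      then show "r = s" using p q by (metis (mono_tags, lifting) m_assoc mem_Collect_eq)
    qed
    have "(q \<otimes> p) \<otimes> (q \<otimes> r) = q \<otimes> r" if "r \<in> carrier G" "(p \<otimes> q) \<otimes> r = r" for r
    proof -
      have "(q \<otimes> p) \<otimes> (q \<otimes> r) = q \<otimes> ((p \<otimes> q) \<otimes> r)" using p q that(1) by (simp add: m_assoc)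
      with that show ?thesis by simp
    qed
    then show "(\<otimes>) q ` {r \<in> carrier G. (p \<otimes> q) \<otimes> r = r} \<subseteq> {r \<in> carrier G. (q \<otimes> p) \<otimes> r = r}"
      using q by auto
  qed (use fin in auto)
  show ?thesis unfolding card using le[OF p q] le[OF q p] by simp
qed

context
  assumes fin: "finite (carrier G)" and ss: "semisimple_ring (monoid_algebra G)"
begin

text \<open>The radical of the trace form is a left ideal, and it contains no nonzero idempotent \<open>e\<close>
  because left multiplication by \<open>e\<close> would be an idempotent matrix of trace zero.\<close>

lemma regular_trace_form_nondegenerate:
  assumes v: "\<forall>p\<in>carrier G. (\<Sum>q\<in>carrier G. regular_char (p \<otimes> q) * v q) = 0"
  shows "\<forall>q\<in>carrier G. v q = 0"
proof -
  interpret A: ring "monoid_algebra G" by (rule ring_monoid_algebra)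
  let ?C = "carrier G"
  let ?m = "bilin (\<lambda>x y. basis_vec (x \<otimes> y))"
  let ?l = Poly_Mapping.lookup
  have assoc: "?m (?m f g) h = ?m f (?m g h)"
    if "Poly_Mapping.keys f \<subseteq> ?C" "Poly_Mapping.keys g \<subseteq> ?C" "Poly_Mapping.keys h \<subseteq> ?C" for f g h
    using A.m_assoc[of f g h] that by simp
  have closed: "Poly_Mapping.keys (?m f g) \<subseteq> ?C"
    if "Poly_Mapping.keys f \<subseteq> ?C" "Poly_Mapping.keys g \<subseteq> ?C" for f g
    using A.m_closed[of f g] that by simp
  have lookup_m: "?l (?m f g) r = (\<Sum>x\<in>?C. \<Sum>y\<in>?C. ?l f x * ?l g y * (if x \<otimes> y = r then 1 else 0))"
    if "Poly_Mapping.keys f \<subseteq> ?C" "Poly_Mapping.keys g \<subseteq> ?C" for f g r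
    by (subst lookup_bilin[OF fin that(1) fin that(2)]) (simp add: lookup_basis_vec)
  define \<tau> where "\<tau> f = (\<Sum>x\<in>?C. ?l f x * regular_char x)" for f
  have \<tau>_mult: "\<tau> (?m f g) = (\<Sum>x\<in>?C. \<Sum>y\<in>?C. ?l f x * ?l g y * regular_char (x \<otimes> y))"
    if "Poly_Mapping.keys f \<subseteq> ?C" "Poly_Mapping.keys g \<subseteq> ?C" for f g
  proof -
    have "\<tau> (?m f g) = (\<Sum>z\<in>?C. \<Sum>x\<in>?C. \<Sum>y\<in>?C.
        ?l f x * ?l g y * (if x \<otimes> y = z then 1 else 0) * regular_char z)"
      by (simp add: \<tau>_def lookup_m[OF that] sum_distrib_right)
    also have "\<dots> = (\<Sum>x\<in>?C. \<Sum>y\<in>?C. \<Sum>z\<in>?C.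
        ?l f x * ?l g y * (if x \<otimes> y = z then 1 else 0) * regular_char z)"
      by (subst sum.swap) (intro sum.cong refl sum.swap)
    also have "\<dots> = (\<Sum>x\<in>?C. \<Sum>y\<in>?C. ?l f x * ?l g y * regular_char (x \<otimes> y))"
    proof (intro sum.cong refl)
      fix x y assume xy: "x \<in> ?C" "y \<in> ?C"
      have "(\<Sum>z\<in>?C. ?l f x * ?l g y * (if x \<otimes> y = z then 1 else 0) * regular_char z)
        = (\<Sum>z\<in>?C. if z = x \<otimes> y then ?l f x * ?l g y * regular_char z else 0)"
        by (intro sum.cong) auto
      also have "\<dots> = ?l f x * ?l g y * regular_char (x \<otimes> y)"
        using xy by (subst sum.delta[OF fin]) simp
      finally show "(\<Sum>z\<in>?C. ?l f x * ?l g y * (if x \<otimes> y = z then 1 else 0) * regular_char z)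
        = ?l f x * ?l g y * regular_char (x \<otimes> y)" .
    qed
    finally show ?thesis .
  qed
  \<comment> \<open>The radical is formed with the test element \<open>b\<close> on the left: by
    associativity, multiplying \<open>a\<close> from the left then only changes the test element,
    which makes \<open>I\<close> a left ideal.\<close>
  define I where "I = {a. Poly_Mapping.keys a \<subseteq> ?C \<and> (\<forall>b. Poly_Mapping.keys b \<subseteq> ?C \<longrightarrow> \<tau> (?m b a) = 0)}"
  have "left_ideal I (monoid_algebra G)"
  proof (rule A.left_idealI)
    show "\<zero>\<^bsub>monoid_algebra G\<^esub> \<in> I"
      by (simp add: I_def clinear_zero[OF clinear_bilin2] \<tau>_def)
    show "f \<oplus>\<^bsub>monoid_algebra G\<^esub> g \<in> I" if "f \<in> I" "g \<in> I" for f g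
      using that by (auto simp: I_def clinear_add[OF clinear_bilin2] \<tau>_def lookup_add distrib_right
          sum.distrib dest!: subsetD[OF keys_add])
    show "a \<otimes>\<^bsub>monoid_algebra G\<^esub> f \<in> I" if "a \<in> carrier (monoid_algebra G)" "f \<in> I" for a f
      using that closed by (simp add: I_def flip: assoc)
  qed (auto simp: I_def)
  moreover have "e = 0" if e: "e \<in> I" "?m e e = e" for e
  proof -
    have ke: "Poly_Mapping.keys e \<subseteq> ?C" using e by (simp add: I_def)
    have "\<tau> (?m (basis_vec \<one>) e) = 0" using e(1) by (simp add: I_def)
    then have \<tau>e: "\<tau> e = 0" using A.l_one[of e] ke by simp
    \<comment> \<open>The matrix of left multiplication by \<open>e\<close>. Its trace is
      \<open>\<tau> e\<close>, which is zero because the unit is one of the test elements, and its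
      column at \<open>\<one>\<close> holds the coefficients of \<open>e\<close>.\<close>
    define P where "P r s = (\<Sum>x\<in>?C. ?l e x * (if x \<otimes> s = r then 1 else 0))" for r s
    have P_basis: "P r s = ?l (?m e (basis_vec s)) r" if "s \<in> ?C" for r s
    proof -
      have "?l (?m e (basis_vec s)) r = (\<Sum>x\<in>?C. \<Sum>y\<in>{s}. ?l e x * ?l (basis_vec s) y * ?l (basis_vec (x \<otimes> y)) r)"
        by (rule lookup_bilin) (use ke fin in auto)
      then show ?thesis by (simp add: P_def lookup_basis_vec)
    qed
    have P_mult: "(\<Sum>s\<in>?C. P r s * ?l w s) = ?l (?m e w) r" if "Poly_Mapping.keys w \<subseteq> ?C" for w r
    proof -
      have "(\<Sum>s\<in>?C. P r s * ?l w s) = (\<Sum>s\<in>?C. \<Sum>x\<in>?C. ?l e x * ?l w s * (if x \<otimes> s = r then 1 else 0))"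
        unfolding P_def sum_distrib_right by (intro sum.cong refl) (simp add: ac_simps)
      also have "\<dots> = ?l (?m e w) r" unfolding lookup_m[OF ke that] by (rule sum.swap)
      finally show ?thesis .
    qed
    have "(\<Sum>s\<in>?C. P r s * P s t) = P r t" if "r \<in> ?C" "t \<in> ?C" for r t
    proof -
      have "(\<Sum>s\<in>?C. P r s * P s t) = ?l (?m e (?m e (basis_vec t))) r"
        using P_mult[OF closed[OF ke], of "basis_vec t" r] that by (simp add: P_basis)
      also have "\<dots> = ?l (?m (?m e e) (basis_vec t)) r" using assoc[OF ke ke, of "basis_vec t"] that by simp
      finally show ?thesis using e(2) that by (simp add: P_basis)
    qed
    moreover have "(\<Sum>s\<in>?C. P s s) = 0"
    proof -
      have "(\<Sum>s\<in>?C. P s s) = \<tau> e"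
        unfolding P_def \<tau>_def regular_char_def by (subst sum.swap) (simp add: sum_distrib_left)
      with \<tau>e show ?thesis by simp
    qed
    ultimately have P0: "P r s = 0" if "r \<in> ?C" "s \<in> ?C" for r s
      using finite_idempotent_trace_0[OF fin, of P] that by blast
    have "?l e r = 0" for r
    proof (cases "r \<in> ?C")
      case True
      have "P r \<one> = ?l e r" using P_basis[of \<one> r] A.r_one[of e] ke by simp
      with P0[OF True one_closed] show ?thesis by simp
    qed (use ke in \<open>auto simp: in_keys_iff\<close>)
    then show "e = 0" by (intro poly_mapping_eqI) simp
  qed
  ultimately have I0: "I = {0}"
    using A.semisimple_left_ideal_idempotent[OF ss] by (metis monoid_algebra_simps(2,4))
  \<comment> \<open>The hypothesis on \<open>v\<close> says exactly that the element with
    coefficient vector \<open>v\<close> lies in the radical.\<close>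
  define a where "a = (\<Sum>q\<in>?C. pscale (v q) (basis_vec q))"
  have la: "?l a q = v q" if "q \<in> ?C" for q
    using that fin by (simp add: a_def lookup_sum lookup_single when_def)
  have ka: "Poly_Mapping.keys a \<subseteq> ?C"
    unfolding a_def by (intro keys_sum_subset keys_pscale_subset) simp
  have "\<tau> (?m b a) = 0" if b: "Poly_Mapping.keys b \<subseteq> ?C" for b
  proof -
    have "\<tau> (?m b a) = (\<Sum>x\<in>?C. ?l b x * (\<Sum>q\<in>?C. regular_char (x \<otimes> q) * v q))"
      unfolding \<tau>_mult[OF b ka] sum_distrib_left using la by (intro sum.cong refl) (simp add: ac_simps)
    with v show ?thesis by simp
  qed
  with ka have "a \<in> I" by (simp add: I_def)
  then have "a = 0" using I0 by simp
  with la show ?thesis by auto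
qed

text \<open>The inverse of the Gram matrix of the trace form is the Casimir element. It is a separability
  idempotent, because \<open>\<Sum>\<^bsub>n, n'\<^esub> e n n' \<chi> (u n n') = \<chi> u\<close> is the formula for the trace of \<open>u\<close>.\<close>

lemma separability_idempotent:
  obtains e :: "'a \<Rightarrow> 'a \<Rightarrow> complex" where
    "\<And>x F. x \<in> carrier G \<Longrightarrow>
      (\<Sum>n\<in>carrier G. \<Sum>n'\<in>carrier G. e n n' * F (x \<otimes> n) n') =
      (\<Sum>n\<in>carrier G. \<Sum>n'\<in>carrier G. e n n' * F n (n' \<otimes> x))"
    "\<And>F. (\<Sum>n\<in>carrier G. \<Sum>n'\<in>carrier G. e n n' * F (n \<otimes> n')) = F \<one>"
proof -
  let ?C = "carrier G"
  let ?g = "\<lambda>p q. regular_char (p \<otimes> q)"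
  obtain e where e: "\<And>p r. p \<in> ?C \<Longrightarrow> r \<in> ?C \<Longrightarrow> (\<Sum>q\<in>?C. ?g p q * e q r) = (if p = r then 1 else 0)"
    "\<And>p r. p \<in> ?C \<Longrightarrow> r \<in> ?C \<Longrightarrow> (\<Sum>q\<in>?C. e p q * ?g q r) = (if p = r then 1 else 0)"
    using finite_matrix_inverse[OF fin, of ?g] regular_trace_form_nondegenerate by blast
  \<comment> \<open>Expansion of an arbitrary function in dual bases: \<open>e\<close> is the
    inverse of the Gram matrix. This brings the trace form into sums where only an unspecified
    function occurs.\<close>
  have expand: "f k = (\<Sum>r\<in>?C. f r * (\<Sum>u\<in>?C. e r u * ?g u k))" if k: "k \<in> ?C" for f :: "'a \<Rightarrow> complex" and k
  proof -
    have "(\<Sum>r\<in>?C. f r * (\<Sum>u\<in>?C. e r u * ?g u k)) = (\<Sum>r\<in>?C. if r = k then f r else 0)"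
      using k by (intro sum.cong) (auto simp: e(2))
    then show ?thesis using k fin by simp
  qed
  show ?thesis
  proof (rule that[of e])
    fix x and F :: "'a \<Rightarrow> 'a \<Rightarrow> complex" assume x: "x \<in> ?C"
    \<comment> \<open>Invariance of the form,
      \<open>?g u (x \<otimes> n) = ?g (u \<otimes> x) n\<close>, moves \<open>x\<close> to the
      other argument; summing over \<open>n\<close> against \<open>e n q\<close> then leaves only
      the terms with \<open>u \<otimes> x = q\<close>.\<close>
    have left: "(\<Sum>n\<in>?C. e n q * f (x \<otimes> n)) = (\<Sum>r\<in>?C. \<Sum>u\<in>?C. f r * e r u * (if u \<otimes> x = q then 1 else 0))"
      if q: "q \<in> ?C" for q and f :: "'a \<Rightarrow> complex"
    proof -
      have "(\<Sum>n\<in>?C. e n q * f (x \<otimes> n)) =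
          (\<Sum>n\<in>?C. e n q * (\<Sum>r\<in>?C. f r * (\<Sum>u\<in>?C. e r u * ?g u (x \<otimes> n))))"
        using x by (intro sum.cong refl arg_cong[of _ _ "(*) _"] expand) simp
      also have "\<dots> = (\<Sum>n\<in>?C. \<Sum>r\<in>?C. \<Sum>u\<in>?C. f r * e r u * (?g (u \<otimes> x) n * e n q))"
        unfolding sum_distrib_left using x by (intro sum.cong refl) (simp add: m_assoc ac_simps)
      also have "\<dots> = (\<Sum>r\<in>?C. \<Sum>u\<in>?C. \<Sum>n\<in>?C. f r * e r u * (?g (u \<otimes> x) n * e n q))"
        by (subst sum.swap) (intro sum.cong refl sum.swap)
      also have "\<dots> = (\<Sum>r\<in>?C. \<Sum>u\<in>?C. f r * e r u * (if u \<otimes> x = q then 1 else 0))"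
        using x q by (intro sum.cong refl) (simp add: e(1) flip: sum_distrib_left)
      finally show ?thesis .
    qed
    have "(\<Sum>n\<in>?C. \<Sum>n'\<in>?C. e n n' * F (x \<otimes> n) n') = (\<Sum>n'\<in>?C. \<Sum>n\<in>?C. e n n' * F (x \<otimes> n) n')"
      by (rule sum.swap)
    also have "\<dots> = (\<Sum>q\<in>?C. \<Sum>r\<in>?C. \<Sum>u\<in>?C. F r q * e r u * (if u \<otimes> x = q then 1 else 0))"
      by (intro sum.cong refl left)
    also have "\<dots> = (\<Sum>r\<in>?C. \<Sum>u\<in>?C. \<Sum>q\<in>?C. F r q * e r u * (if u \<otimes> x = q then 1 else 0))"
      by (subst sum.swap) (intro sum.cong refl sum.swap)
    also have "\<dots> = (\<Sum>r\<in>?C. \<Sum>u\<in>?C. e r u * F r (u \<otimes> x))"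
    proof (intro sum.cong refl)
      fix r u assume "r \<in> ?C" "u \<in> ?C"
      have "(\<Sum>q\<in>?C. F r q * e r u * (if u \<otimes> x = q then 1 else 0)) =
          (\<Sum>q\<in>?C. if q = u \<otimes> x then e r u * F r q else 0)"
        by (intro sum.cong) auto
      then show "(\<Sum>q\<in>?C. F r q * e r u * (if u \<otimes> x = q then 1 else 0)) = e r u * F r (u \<otimes> x)"
        using \<open>u \<in> ?C\<close> x fin by simp
    qed
    finally show "(\<Sum>n\<in>?C. \<Sum>n'\<in>?C. e n n' * F (x \<otimes> n) n') = (\<Sum>n\<in>?C. \<Sum>n'\<in>?C. e n n' * F n (n' \<otimes> x))" .
  next
    fix F :: "'a \<Rightarrow> complex"
    \<comment> \<open>By cyclicity of the trace the form becomes
      \<open>?g n' (u \<otimes> n)\<close>. The inner sum against \<open>e\<close> is then 1 if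
      \<open>n = u \<otimes> n\<close> and 0 otherwise, so the total counts the fixed points of
      \<open>u\<close>, which is the trace of \<open>u\<close>.\<close>
    have unit: "(\<Sum>n\<in>?C. \<Sum>n'\<in>?C. e n n' * ?g u (n \<otimes> n')) = ?g u \<one>" if u: "u \<in> ?C" for u
    proof -
      have "?g u (n \<otimes> n') = ?g n' (u \<otimes> n)" if "n \<in> ?C" "n' \<in> ?C" for n n'
        using u that regular_char_comm[OF fin, of "u \<otimes> n" n'] by (simp add: m_assoc)
      then have "(\<Sum>n\<in>?C. \<Sum>n'\<in>?C. e n n' * ?g u (n \<otimes> n')) = (\<Sum>n\<in>?C. \<Sum>n'\<in>?C. e n n' * ?g n' (u \<otimes> n))"
        by (intro sum.cong refl) simp
      also have "\<dots> = (\<Sum>n\<in>?C. if n = u \<otimes> n then 1 else 0)"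
        by (intro sum.cong refl e(2)) (use u in auto)
      also have "\<dots> = ?g u \<one>"
        using u unfolding regular_char_def by (intro sum.cong) auto
      finally show ?thesis .
    qed
    have "(\<Sum>n\<in>?C. \<Sum>n'\<in>?C. e n n' * F (n \<otimes> n')) =
        (\<Sum>n\<in>?C. \<Sum>n'\<in>?C. e n n' * (\<Sum>r\<in>?C. F r * (\<Sum>u\<in>?C. e r u * ?g u (n \<otimes> n'))))"
      by (intro sum.cong refl arg_cong[of _ _ "(*) _"] expand) simp
    also have "\<dots> = (\<Sum>n\<in>?C. \<Sum>n'\<in>?C. \<Sum>r\<in>?C. \<Sum>u\<in>?C. F r * e r u * (e n n' * ?g u (n \<otimes> n')))"
      unfolding sum_distrib_left by (intro sum.cong refl) (simp add: ac_simps)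
    also have "\<dots> = (\<Sum>n\<in>?C. \<Sum>r\<in>?C. \<Sum>u\<in>?C. \<Sum>n'\<in>?C. F r * e r u * (e n n' * ?g u (n \<otimes> n')))"
      by (rule sum.cong[OF refl], subst sum.swap) (rule sum.cong[OF refl], rule sum.swap)
    also have "\<dots> = (\<Sum>r\<in>?C. \<Sum>u\<in>?C. \<Sum>n\<in>?C. \<Sum>n'\<in>?C. F r * e r u * (e n n' * ?g u (n \<otimes> n')))"
      by (subst sum.swap) (intro sum.cong refl sum.swap)
    also have "\<dots> = (\<Sum>r\<in>?C. F r * (\<Sum>u\<in>?C. e r u * ?g u \<one>))"
      using unit by (intro sum.cong refl) (simp add: mult.assoc flip: sum_distrib_left)
    also have "\<dots> = F \<one>" by (rule expand[symmetric]) simp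
    finally show "(\<Sum>n\<in>?C. \<Sum>n'\<in>?C. e n n' * F (n \<otimes> n')) = F \<one>" .
  qed
qed

end

end

section \<open>Relative Green classes\<close>

locale submonoid_pair = monoid M + N: submonoid N M + K: submonoid K M
  for M (structure) and N K
begin

abbreviation ideal :: "'a \<Rightarrow> 'a set" where
  "ideal z \<equiv> (N #> z) <#> K"

lemma ideal_eq: "ideal z = {n \<otimes> z \<otimes> k | n k. n \<in> N \<and> k \<in> K}"
  by (auto simp: r_coset_def set_mult_def)

lemma idealI: "n \<in> N \<Longrightarrow> k \<in> K \<Longrightarrow> n \<otimes> z \<otimes> k \<in> ideal z"
  by (auto simp: ideal_eq)

lemma idealE:
  assumes "w \<in> ideal z"
  obtains n k where "n \<in> N" "k \<in> K" "w = n \<otimes> z \<otimes> k"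
  using assms by (auto simp: ideal_eq)

lemma ideal_self: "z \<in> carrier M \<Longrightarrow> z \<in> ideal z"
  using idealI[OF N.one_closed K.one_closed, of z] by simp

lemma ideal_subset_iff:
  assumes "z \<in> carrier M" "w \<in> carrier M"
  shows "ideal z \<subseteq> ideal w \<longleftrightarrow> z \<in> ideal w"
proof
  assume "z \<in> ideal w"
  then obtain n k where nk: "n \<in> N" "k \<in> K" "z = n \<otimes> w \<otimes> k" by (rule idealE)
  show "ideal z \<subseteq> ideal w"
  proof
    fix u assume "u \<in> ideal z"
    then obtain n' k' where "n' \<in> N" "k' \<in> K" "u = n' \<otimes> z \<otimes> k'" by (rule idealE)
    with nk assms have "u = (n' \<otimes> n) \<otimes> w \<otimes> (k \<otimes> k')" by (simp add: m_assoc)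
    with nk \<open>n' \<in> N\<close> \<open>k' \<in> K\<close> show "u \<in> ideal w" by (auto intro: idealI)
  qed
qed (use ideal_self assms in blast)

lemma ideal_mult_subset:
  assumes "n \<in> N" "k \<in> K" "z \<in> carrier M"
  shows "ideal (n \<otimes> z \<otimes> k) \<subseteq> ideal z"
  using assms by (subst ideal_subset_iff) (auto intro: idealI)

lemma ideal_subset_carrier: "z \<in> carrier M \<Longrightarrow> ideal z \<subseteq> carrier M"
  by (auto simp: ideal_eq)

lemma N_coset_subset: "a \<in> N \<Longrightarrow> z \<in> carrier M \<Longrightarrow> N #> (a \<otimes> z) \<subseteq> N #> z"
  by (auto simp: r_coset_def simp flip: m_assoc)

lemma K_coset_subset: "b \<in> K \<Longrightarrow> z \<in> carrier M \<Longrightarrow> (z \<otimes> b) <# K \<subseteq> z <# K"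
  by (auto simp: l_coset_def m_assoc)

text \<open>Equality of principal left sets becomes mutual divisibility; later proofs compute with
  the two multipliers, one leading from \<open>m\<close> to \<open>x\<close> and one leading
  back.\<close>

lemma L_class_iff:
  assumes "m \<in> carrier M"
  shows "x \<in> L_class M N m \<longleftrightarrow> (\<exists>a\<in>N. x = a \<otimes> m) \<and> (\<exists>c\<in>N. m = c \<otimes> x)" (is "_ \<longleftrightarrow> ?A \<and> ?B")
proof
  assume x: "x \<in> L_class M N m"
  then have c: "x \<in> carrier M" and e: "N #> x = N #> m" by (auto simp: L_class_def)
  have "\<one> \<otimes> x \<in> N #> x" "\<one> \<otimes> m \<in> N #> m"
    unfolding r_coset_def using N.one_closed by blast+
  with c e assms show "?A \<and> ?B" by (auto simp: r_coset_def)
next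
  assume "?A \<and> ?B"
  then obtain a c where ac: "a \<in> N" "c \<in> N" "x = a \<otimes> m" "m = c \<otimes> x" by blast
  then have x: "x \<in> carrier M" using assms by (metis N.mem_carrier m_closed)
  have "N #> x = N #> m"
    using N_coset_subset[OF ac(1) assms] N_coset_subset[OF ac(2) x] ac(3,4)[symmetric] by simp
  with x show "x \<in> L_class M N m" by (simp add: L_class_def)
qed

lemma R_class_iff:
  assumes "m \<in> carrier M"
  shows "y \<in> R_class M K m \<longleftrightarrow> (\<exists>b\<in>K. y = m \<otimes> b) \<and> (\<exists>d\<in>K. m = y \<otimes> d)" (is "_ \<longleftrightarrow> ?A \<and> ?B")
proof
  assume y: "y \<in> R_class M K m"
  then have c: "y \<in> carrier M" and e: "y <# K = m <# K" by (auto simp: R_class_def)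
  have "y \<otimes> \<one> \<in> y <# K" "m \<otimes> \<one> \<in> m <# K"
    unfolding l_coset_def using K.one_closed by blast+
  with c e assms show "?A \<and> ?B" by (auto simp: l_coset_def)
next
  assume "?A \<and> ?B"
  then obtain b d where bd: "b \<in> K" "d \<in> K" "y = m \<otimes> b" "m = y \<otimes> d" by blast
  then have y: "y \<in> carrier M" using assms by (metis K.mem_carrier m_closed)
  have "y <# K = m <# K"
    using K_coset_subset[OF bd(1) assms] K_coset_subset[OF bd(2) y] bd(3,4)[symmetric] by simp
  with y show "y \<in> R_class M K m" by (simp add: R_class_def)
qed

lemma L_class_carrier: "L_class M N m \<subseteq> carrier M"
  and R_class_carrier: "R_class M K m \<subseteq> carrier M"
  and H_class_carrier: "H_class M N K m \<subseteq> carrier M"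
  and J_class_carrier: "J_class M N K m \<subseteq> carrier M"
  by (auto simp: L_class_def R_class_def H_class_def J_class_def)

lemma L_classE:
  assumes "x \<in> L_class M N m" "m \<in> carrier M"
  obtains a c where "a \<in> N" "c \<in> N" "x = a \<otimes> m" "c \<otimes> x = m"
  using assms by (auto simp: L_class_iff)

lemma R_classE:
  assumes "y \<in> R_class M K m" "m \<in> carrier M"
  obtains b d where "b \<in> K" "d \<in> K" "y = m \<otimes> b" "y \<otimes> d = m"
  using assms by (auto simp: R_class_iff)

lemma self_in_classes:
  assumes "m \<in> carrier M"
  shows "m \<in> L_class M N m" "m \<in> R_class M K m" "m \<in> H_class M N K m" "m \<in> J_class M N K m"
  using assms by (auto simp: L_class_def R_class_def H_class_def J_class_def)

lemma H_classD:
  "h \<in> H_class M N K m \<Longrightarrow> h \<in> L_class M N m" "h \<in> H_class M N K m \<Longrightarrow> h \<in> R_class M K m"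
  by (auto simp: H_class_def)

context
  fixes m assumes m: "m \<in> carrier M"
begin

text \<open>Together with \<open>circ_right\<close> this replaces the definite description by an
  ordinary product, in which either argument may be the one that is factored through
  \<open>m\<close>.\<close>

lemma circ_left:
  assumes "a \<in> N" "y \<in> R_class M K m"
  shows "circ M N K m (a \<otimes> m) y = a \<otimes> y"
  using assms(2)
  by (rule R_classE[OF _ m]) (use assms circ_eq[OF monoid_axioms N.subset K.subset m] m in
    \<open>auto simp: m_assoc\<close>)

lemma circ_right:
  assumes "x \<in> L_class M N m" "b \<in> K"
  shows "circ M N K m x (m \<otimes> b) = x \<otimes> b"
  using assms(1)
  by (rule L_classE[OF _ m]) (use assms circ_eq[OF monoid_axioms N.subset K.subset m] in auto)

lemma circ_one:
  "x \<in> L_class M N m \<Longrightarrow> circ M N K m x m = x"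
  "y \<in> R_class M K m \<Longrightarrow> circ M N K m m y = y"
  using circ_right[of x \<one>] circ_left[of \<one> y] m L_class_carrier[of m] R_class_carrier[of m]
  by auto

text \<open>The multiplier \<open>c\<close> that takes \<open>x\<close> back to \<open>m\<close>
  takes \<open>x \<circ> h\<close> back to \<open>h\<close>, since \<open>h = m \<otimes> d\<close>
  and left and right multiplications commute. From \<open>h\<close> there is a way back to
  \<open>m\<close> inside \<open>N\<close>.\<close>

lemma circ_L_closed:
  assumes "x \<in> L_class M N m" "h \<in> H_class M N K m"
  shows "circ M N K m x h \<in> L_class M N m"
proof -
  obtain d where d: "d \<in> K" "h = m \<otimes> d" using H_classD(2)[OF assms(2)] R_class_iff[OF m] by blast
  obtain a c where a: "a \<in> N" "c \<in> N" "x = a \<otimes> m" "c \<otimes> x = m" using assms(1) m by (rule L_classE)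
  obtain a' c' where a': "a' \<in> N" "c' \<in> N" "h = a' \<otimes> m" "c' \<otimes> h = m"
    using H_classD(1)[OF assms(2)] m by (rule L_classE)
  have eq: "circ M N K m x h = a \<otimes> h" using circ_left[OF a(1) H_classD(2)[OF assms(2)]] a(3) by simp
  have h: "h \<in> carrier M" using H_class_carrier assms(2) by blast
  have "a \<otimes> h = (a \<otimes> a') \<otimes> m" using a(1) a'(1) m by (simp add: a'(3) m_assoc)
  moreover have "c \<otimes> (a \<otimes> h) = c \<otimes> x \<otimes> d" using a(1,2) m d by (simp add: a(3) m_assoc)
  then have "c \<otimes> (a \<otimes> h) = h" using a(4) d(2) by simp
  then have "m = (c' \<otimes> c) \<otimes> (a \<otimes> h)" using a(1,2) a'(2,4) h by (simp add: m_assoc)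
  ultimately show ?thesis
    unfolding eq L_class_iff[OF m] using a(1,2) a'(1,2) N.m_closed by blast
qed

lemma circ_R_closed:
  assumes "h \<in> H_class M N K m" "y \<in> R_class M K m"
  shows "circ M N K m h y \<in> R_class M K m"
proof -
  obtain a where a: "a \<in> N" "h = a \<otimes> m" using H_classD(1)[OF assms(1)] L_class_iff[OF m] by blast
  obtain b d where b: "b \<in> K" "d \<in> K" "y = m \<otimes> b" "y \<otimes> d = m" using assms(2) m by (rule R_classE)
  obtain b' d' where b': "b' \<in> K" "d' \<in> K" "h = m \<otimes> b'" "h \<otimes> d' = m"
    using H_classD(2)[OF assms(1)] m by (rule R_classE)
  have eq: "circ M N K m h y = h \<otimes> b" using circ_right[OF H_classD(1)[OF assms(1)] b(1)] b(3) by simp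
  have h: "h \<in> carrier M" using H_class_carrier assms(1) by blast
  have "h \<otimes> b = m \<otimes> (b' \<otimes> b)" using b(1) b'(1) m by (simp add: b'(3) m_assoc)
  moreover have "h \<otimes> b \<otimes> d = a \<otimes> (y \<otimes> d)" using a b(1,2) m by (simp add: b(3) m_assoc)
  then have "h \<otimes> b \<otimes> d = h" using a b by simp
  then have "m = (h \<otimes> b) \<otimes> (d \<otimes> d')" using b(1,2) b' h m by (simp flip: m_assoc)
  ultimately show ?thesis
    unfolding eq R_class_iff[OF m] using b(1,2) b'(1,2) K.m_closed by blast
qed

text \<open>Both bracketings equal \<open>a \<otimes> h \<otimes> b\<close> when
  \<open>x = a \<otimes> m\<close> and \<open>y = m \<otimes> b\<close>: the middle element lies in
  both classes and can be multiplied from either side.\<close>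

lemma circ_assoc:
  assumes "x \<in> L_class M N m" "h \<in> H_class M N K m" "y \<in> R_class M K m"
  shows "circ M N K m (circ M N K m x h) y = circ M N K m x (circ M N K m h y)"
proof -
  obtain a where a: "a \<in> N" "x = a \<otimes> m" using assms(1) L_class_iff[OF m] by blast
  obtain b where b: "b \<in> K" "y = m \<otimes> b" using assms(3) R_class_iff[OF m] by blast
  note h = H_classD[OF assms(2)] 
  have hc: "h \<in> carrier M" using H_class_carrier assms(2) by blast
  have "circ M N K m (circ M N K m x h) y = circ M N K m x h \<otimes> b"
    using circ_right[OF circ_L_closed[OF assms(1,2)] b(1)] b(2) by simp
  also have "\<dots> = a \<otimes> h \<otimes> b" using circ_left[OF a(1) h(2)] a(2) by simp
  also have "\<dots> = a \<otimes> circ M N K m h y" using circ_right[OF h(1) b(1)] a b hc by (simp add: m_assoc)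
  also have "\<dots> = circ M N K m x (circ M N K m h y)"
    using circ_left[OF a(1) circ_R_closed[OF assms(2,3)]] a(2) by simp
  finally show ?thesis .
qed

lemma circ_H_closed:
  assumes "h \<in> H_class M N K m" "h' \<in> H_class M N K m"
  shows "circ M N K m h h' \<in> H_class M N K m"
  using circ_L_closed[of h h'] circ_R_closed[of h h'] assms by (auto simp: H_class_def)

text \<open>The multipliers leading from \<open>x\<close> and from \<open>y\<close> back to
  \<open>m\<close> act on opposite sides, so together they recover \<open>m\<close> from the
  product, and the two double ideals coincide.\<close>

lemma circ_J:
  assumes "x \<in> L_class M N m" "y \<in> R_class M K m"
  shows "circ M N K m x y \<in> J_class M N K m"
proof -
  obtain a c where a: "a \<in> N" "c \<in> N" "x = a \<otimes> m" "c \<otimes> x = m" using assms(1) m by (rule L_classE)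
  obtain b d where b: "b \<in> K" "d \<in> K" "y = m \<otimes> b" "y \<otimes> d = m" using assms(2) m by (rule R_classE)
  have z: "circ M N K m x y = a \<otimes> m \<otimes> b"
    using a b by (simp add: circ_eq[OF monoid_axioms N.subset K.subset m])
  then have zc: "circ M N K m x y \<in> carrier M" using a b m by auto
  have "c \<otimes> circ M N K m x y \<otimes> d = (c \<otimes> x) \<otimes> b \<otimes> d"
    unfolding z using a(1,2) b(1,2) m by (simp add: a(3) m_assoc)
  also have "\<dots> = m" using a(4) b(3,4) by simp
  finally have "m \<in> ideal (circ M N K m x y)" using idealI[OF a(2) b(2)] by metis
  moreover have "circ M N K m x y \<in> ideal m" using z idealI[OF a(1) b(1)] by metis
  ultimately show ?thesis using zc m ideal_subset_iff by (auto simp: J_class_def)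
qed

text \<open>The element \<open>h\<close> is obtained as \<open>c x'\<close> with \<open>c x = m\<close>, and equals \<open>y d'\<close> with \<open>y' d' = m\<close>.\<close>

lemma circ_eq_imp_H:
  assumes x: "x \<in> L_class M N m" "x' \<in> L_class M N m"
    and y: "y \<in> R_class M K m" "y' \<in> R_class M K m"
    and eq: "circ M N K m x y = circ M N K m x' y'"
  shows "\<exists>h\<in>H_class M N K m. x' = circ M N K m x h \<and> y = circ M N K m h y'"
proof -
  obtain a c where a: "a \<in> N" "c \<in> N" "x = a \<otimes> m" "c \<otimes> x = m" using x(1) m by (rule L_classE)
  obtain a' c' where a': "a' \<in> N" "c' \<in> N" "x' = a' \<otimes> m" "c' \<otimes> x' = m" using x(2) m by (rule L_classE)
  obtain b d where b: "b \<in> K" "d \<in> K" "y = m \<otimes> b" "y \<otimes> d = m" using y(1) m by (rule R_classE)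
  obtain b' d' where b': "b' \<in> K" "d' \<in> K" "y' = m \<otimes> b'" "y' \<otimes> d' = m" using y(2) m by (rule R_classE)
  have xc: "x \<in> carrier M" "x' \<in> carrier M" "y \<in> carrier M" "y' \<in> carrier M"
    using x y L_class_carrier R_class_carrier by blast+
  \<comment> \<open>In this form both ends can be cancelled: multiplying by \<open>c\<close> on the
    left removes \<open>a\<close> and expresses \<open>y\<close> through \<open>x'\<close>, while
    multiplying by \<open>d'\<close> on the right removes \<open>b'\<close> and expresses
    \<open>x'\<close> through \<open>y\<close>.\<close>
  have eq1: "a \<otimes> y = x' \<otimes> b'"
    using eq circ_left[OF a(1) y(1)] circ_right[OF x(2) b'(1)] a(3) b'(3) by simp
  have eq2: "x \<otimes> b = a' \<otimes> y'"
    using eq circ_right[OF x(1) b(1)] circ_left[OF a'(1) y(2)] b(3) a'(3) by simp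
  have y_eq: "y = c \<otimes> x' \<otimes> b'"
  proof -
    have "c \<otimes> x' \<otimes> b' = c \<otimes> (a \<otimes> y)" using eq1 a b' xc by (simp add: m_assoc)
    also have "\<dots> = (c \<otimes> x) \<otimes> b" using a(1,2) b(1) m by (simp add: a(3) b(3) m_assoc)
    finally show ?thesis using a b by simp
  qed
  have x_eq: "x' = a \<otimes> (y \<otimes> d')"
  proof -
    have "a \<otimes> (y \<otimes> d') = x' \<otimes> b' \<otimes> d'" using eq1 a b' xc by (simp flip: m_assoc)
    also have "\<dots> = a' \<otimes> (y' \<otimes> d')" using a'(1) b'(1,2) m by (simp add: a'(3) b'(3) m_assoc)
    finally show ?thesis using a' b' by simp
  qed
  define h where "h = c \<otimes> x'"
  have h2: "h = y \<otimes> d'"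
  proof -
    have "y \<otimes> d' = c \<otimes> (x' \<otimes> b' \<otimes> d')" using y_eq a b' xc by (simp add: m_assoc)
    also have "x' \<otimes> b' \<otimes> d' = a' \<otimes> (y' \<otimes> d')" using a'(1) b'(1,2) m by (simp add: a'(3) b'(3) m_assoc)
    finally show ?thesis using a' b' by (simp add: h_def)
  qed
  have hc: "h \<in> carrier M" using a xc by (simp add: h_def)
  have "h = (c \<otimes> a') \<otimes> m" using a a' m by (simp add: h_def m_assoc)
  moreover have "m = (c' \<otimes> a) \<otimes> h"
    using a'(2,4) a(1) x_eq h2 hc by (simp add: m_assoc)
  moreover have "h = m \<otimes> (b \<otimes> d')" using b b' m by (simp add: h2 m_assoc)
  moreover have "m = h \<otimes> (b' \<otimes> d)"
    using b(2,4) b'(1) y_eq hc by (simp add: h_def flip: m_assoc)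
  ultimately have H: "h \<in> H_class M N K m"
    unfolding H_class_def Int_iff L_class_iff[OF m] R_class_iff[OF m]
    using a(1,2) a'(1,2) b(1,2) b'(1,2) N.m_closed K.m_closed by blast
  moreover have "circ M N K m x h = x'"
    using circ_left[OF a(1) H_classD(2)[OF H]] a(3) x_eq h2 by simp
  moreover have "circ M N K m h y' = y"
    using circ_right[OF H_classD(1)[OF H] b'(1)] b'(3) y_eq by (simp add: h_def)
  ultimately show ?thesis by auto
qed

end

end

section \<open>Stability of the classes in a finite monoid\<close>

locale finite_submonoid_pair = submonoid_pair +
  assumes finite_carrier: "finite (carrier M)"
begin

lemma finite_NK: "finite N" "finite K"
  using finite_carrier N.subset K.subset finite_subset by blast+

text \<open>The powers of \<open>u\<close> and \<open>v\<close> are eventually periodic.\<close>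

lemma periodic_fixed:
  assumes u: "u \<in> carrier M" and v: "v \<in> carrier M" and m: "m \<in> carrier M"
    and fx: "u \<otimes> m \<otimes> v = m"
  shows "\<exists>p. u [^] Suc p \<otimes> m = m" "\<exists>p. m \<otimes> v [^] Suc p = m"
proof -
  \<comment> \<open>Iterating the relation writes \<open>m\<close> as
    \<open>u [^] i \<otimes> m \<otimes> v [^] i\<close> with the exponent \<open>i\<close> at which
    the powers become periodic; one more period on either side then leaves \<open>m\<close>
    unchanged.\<close>
  have pw: "u [^] k \<otimes> m \<otimes> v [^] k = m" for k :: nat
  proof (induction k)
    case (Suc k)
    have "u [^] Suc k \<otimes> m \<otimes> v [^] Suc k = u [^] k \<otimes> (u \<otimes> m \<otimes> v) \<otimes> v [^] k"
      using u v m by (simp add: m_assoc nat_pow_comm[of v k 1, simplified])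
    then show ?case using Suc fx by simp
  qed (use m in simp)
  have per: "\<exists>i p. w [^] (Suc p + i) = w [^] i" if w: "w \<in> carrier M" for w
  proof -
    have "range (\<lambda>i::nat. w [^] i) \<subseteq> carrier M" using w by auto
    then have "finite (range (\<lambda>i::nat. w [^] i))" using finite_carrier by (rule finite_subset)
    then have "\<not> inj (\<lambda>i::nat. w [^] i)" using finite_imageD infinite_UNIV_nat by blast
    then obtain i j :: nat where "i < j" "w [^] i = w [^] j"
      by (metis injI linorder_neqE_nat)
    moreover from \<open>i < j\<close> obtain p where "j = Suc p + i"
      by (metis add.commute add_Suc_right less_imp_Suc_add)
    ultimately show ?thesis by metis
  qed
  obtain i p where ip: "u [^] (Suc p + i) = u [^] i" using per[OF u] by blast
  have "u [^] Suc p \<otimes> (u [^] i \<otimes> m \<otimes> v [^] i) = (u [^] Suc p \<otimes> u [^] i) \<otimes> m \<otimes> v [^] i"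
    using u v m by (simp add: m_assoc del: nat_pow_Suc)
  also have "u [^] Suc p \<otimes> u [^] i = u [^] (Suc p + i)" using u by (rule nat_pow_mult)
  finally have "u [^] Suc p \<otimes> (u [^] i \<otimes> m \<otimes> v [^] i) = u [^] (Suc p + i) \<otimes> m \<otimes> v [^] i" .
  then show "\<exists>p. u [^] Suc p \<otimes> m = m" using ip pw by metis
  obtain j q where jq: "v [^] (Suc q + j) = v [^] j" using per[OF v] by blast
  have "(u [^] j \<otimes> m \<otimes> v [^] j) \<otimes> v [^] Suc q = u [^] j \<otimes> m \<otimes> (v [^] j \<otimes> v [^] Suc q)"
    using u v m by (simp add: m_assoc del: nat_pow_Suc)
  also have "v [^] j \<otimes> v [^] Suc q = v [^] (j + Suc q)" using v by (rule nat_pow_mult)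
  finally have "(u [^] j \<otimes> m \<otimes> v [^] j) \<otimes> v [^] Suc q = u [^] j \<otimes> m \<otimes> v [^] (j + Suc q)" .
  then show "\<exists>p. m \<otimes> v [^] Suc p = m" using jq pw by (metis add.commute)
qed

text \<open>The analogue of stability of finite monoids. If \<open>m\<close> is recovered by
  multipliers \<open>a'\<close> and \<open>b'\<close>, then \<open>m\<close> is fixed by
  \<open>a' \<otimes> a\<close> on the left and \<open>b \<otimes> b'\<close> on the right jointly,
  hence by a positive power of each one alone. A power ending in \<open>a\<close> or starting with
  \<open>b\<close> exhibits \<open>m\<close> as a multiple of \<open>a \<otimes> m\<close> or of
  \<open>m \<otimes> b\<close>.\<close>

lemma J_class_factors:
  assumes m: "m \<in> carrier M" and ab: "a \<in> N" "b \<in> K" and J: "a \<otimes> m \<otimes> b \<in> J_class M N K m"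
  shows "a \<otimes> m \<in> L_class M N m" "m \<otimes> b \<in> R_class M K m"
proof -
  have "m \<in> ideal (a \<otimes> m \<otimes> b)" using J ideal_self[OF m] by (auto simp: J_class_def)
  then obtain a' b' where ab': "a' \<in> N" "b' \<in> K" "m = a' \<otimes> (a \<otimes> m \<otimes> b) \<otimes> b'" by (rule idealE)
  have fx: "(a' \<otimes> a) \<otimes> m \<otimes> (b \<otimes> b') = m"
    by (subst (2) ab'(3)) (use ab ab'(1,2) m in \<open>simp add: m_assoc\<close>)
  have powN: "w [^] p \<in> N" if "w \<in> N" for w and p :: nat
    using that by (induction p) auto
  have powK: "w [^] p \<in> K" if "w \<in> K" for w and p :: nat
    using that by (induction p) auto
  obtain p where p: "(a' \<otimes> a) [^] Suc p \<otimes> m = m"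
    using periodic_fixed(1)[OF _ _ m fx] ab ab' by auto
  have "m = ((a' \<otimes> a) [^] p \<otimes> a') \<otimes> (a \<otimes> m)"
    by (subst p[symmetric]) (use ab ab'(1,2) m in \<open>simp add: m_assoc\<close>)
  moreover have "(a' \<otimes> a) [^] p \<otimes> a' \<in> N" using powN ab ab' by auto
  ultimately show "a \<otimes> m \<in> L_class M N m" unfolding L_class_iff[OF m] using ab by blast
  obtain q where q: "m \<otimes> (b \<otimes> b') [^] Suc q = m"
    using periodic_fixed(2)[OF _ _ m fx] ab ab' by auto
  \<comment> \<open>The power is unrolled from the front, so that \<open>b\<close> stands next to
    \<open>m\<close>; on the left side the default unrolling from the end already places
    \<open>a\<close> there.\<close>
  have "(b \<otimes> b') [^] Suc q = b \<otimes> b' \<otimes> (b \<otimes> b') [^] q"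
    using ab ab' nat_pow_Suc2[of "b \<otimes> b'"] by auto
  then have "m = (m \<otimes> b) \<otimes> (b' \<otimes> (b \<otimes> b') [^] q)"
    using q ab ab'(1,2) m by (simp add: m_assoc)
  moreover have "b' \<otimes> (b \<otimes> b') [^] q \<in> K" using powK ab ab' by auto
  ultimately show "m \<otimes> b \<in> R_class M K m" unfolding R_class_iff[OF m] using ab by blast
qed

text \<open>A factorization \<open>z = a \<otimes> m \<otimes> b\<close> always exists; stability
  places \<open>a \<otimes> m\<close> and \<open>m \<otimes> b\<close> in the right classes.\<close>

lemma J_class_eq_circ:
  assumes m: "m \<in> carrier M"
  shows "J_class M N K m = (\<lambda>(x, y). circ M N K m x y) ` (L_class M N m \<times> R_class M K m)"
proof (intro equalityI subsetI)
  fix z assume z: "z \<in> J_class M N K m"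
  then have "z \<in> ideal m" using ideal_self by (auto simp: J_class_def)
  then obtain a b where ab: "a \<in> N" "b \<in> K" "z = a \<otimes> m \<otimes> b" by (rule idealE)
  then have "z = circ M N K m (a \<otimes> m) (m \<otimes> b)"
    by (simp add: circ_eq[OF monoid_axioms N.subset K.subset m])
  with J_class_factors[OF m ab(1,2)] z ab(3)
  show "z \<in> (\<lambda>(x, y). circ M N K m x y) ` (L_class M N m \<times> R_class M K m)" by (auto intro!: image_eqI[of _ _ "(a \<otimes> m, m \<otimes> b)"])
qed (use circ_J[OF m] in auto)

text \<open>Leaving the class \<open>L\<close> is detected by the product leaving \<open>J\<close>,
  whatever \<open>y\<close> is. This makes the truncated action on C[L] correspond to the truncated
  action on C[J].\<close>

lemma L_class_mult_iff:
  assumes m: "m \<in> carrier M" and "x \<in> L_class M N m" "y \<in> R_class M K m" "n \<in> N"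
  shows "n \<otimes> circ M N K m x y \<in> J_class M N K m \<longleftrightarrow> n \<otimes> x \<in> L_class M N m"
    and "n \<otimes> x \<in> L_class M N m \<Longrightarrow> circ M N K m (n \<otimes> x) y = n \<otimes> circ M N K m x y"
proof -
  obtain a where a: "a \<in> N" "x = a \<otimes> m" using assms(2) L_class_iff[OF m] by blast
  obtain b where b: "b \<in> K" "y = m \<otimes> b" using assms(3) R_class_iff[OF m] by blast
  have eq: "n \<otimes> circ M N K m x y = (n \<otimes> a) \<otimes> m \<otimes> b" and nx: "n \<otimes> x = (n \<otimes> a) \<otimes> m"
    using a b m assms(4) by (simp_all add: circ_eq[OF monoid_axioms N.subset K.subset m] m_assoc)
  have eq': "circ M N K m (n \<otimes> x) y = n \<otimes> circ M N K m x y"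
    unfolding eq unfolding nx b(2) using a b assms(4)
    by (intro circ_eq[OF monoid_axioms N.subset K.subset m]) auto
  then show "circ M N K m (n \<otimes> x) y = n \<otimes> circ M N K m x y" .
  show "n \<otimes> circ M N K m x y \<in> J_class M N K m \<longleftrightarrow> n \<otimes> x \<in> L_class M N m"
    using J_class_factors(1)[OF m _ b(1), of "n \<otimes> a"] eq nx a(1) assms(4)
      circ_J[OF m _ assms(3), of "n \<otimes> x"] eq' by auto
qed

lemma R_class_mult_iff:
  assumes m: "m \<in> carrier M" and "x \<in> L_class M N m" "y \<in> R_class M K m" "k \<in> K"
  shows "circ M N K m x y \<otimes> k \<in> J_class M N K m \<longleftrightarrow> y \<otimes> k \<in> R_class M K m"
    and "y \<otimes> k \<in> R_class M K m \<Longrightarrow> circ M N K m x (y \<otimes> k) = circ M N K m x y \<otimes> k"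
proof -
  obtain a where a: "a \<in> N" "x = a \<otimes> m" using assms(2) L_class_iff[OF m] by blast
  obtain b where b: "b \<in> K" "y = m \<otimes> b" using assms(3) R_class_iff[OF m] by blast
  have eq: "circ M N K m x y \<otimes> k = a \<otimes> m \<otimes> (b \<otimes> k)" and yk: "y \<otimes> k = m \<otimes> (b \<otimes> k)"
    using a b m assms(4) by (simp_all add: circ_eq[OF monoid_axioms N.subset K.subset m] m_assoc)
  have eq': "circ M N K m x (y \<otimes> k) = circ M N K m x y \<otimes> k"
    unfolding eq unfolding yk a(2) using a b assms(4)
    by (intro circ_eq[OF monoid_axioms N.subset K.subset m]) auto
  then show "circ M N K m x (y \<otimes> k) = circ M N K m x y \<otimes> k" .
  show "circ M N K m x y \<otimes> k \<in> J_class M N K m \<longleftrightarrow> y \<otimes> k \<in> R_class M K m"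
    using J_class_factors(2)[OF m a(1), of "b \<otimes> k"] eq yk b(1) assms(4)
      circ_J[OF m assms(2), of "y \<otimes> k"] eq' by auto
qed

end

section \<open>Splitting the filtration by double ideals\<close>

text \<open>The hypotheses say that \<open>b z\<close> is \<open>z\<close> plus terms of smaller
  rank \<open>r\<close>. Injectivity is seen at a support element of maximal rank, surjectivity by
  induction on the rank.\<close>

lemma unitriangular_bij:
  fixes r :: "'x \<Rightarrow> nat"
  assumes keys: "\<And>z. z \<in> C \<Longrightarrow> Poly_Mapping.keys (b z) \<subseteq> C"
    and tri: "\<And>z u. z \<in> C \<Longrightarrow> u \<in> C \<Longrightarrow> \<not> r u < r z \<Longrightarrow> Poly_Mapping.lookup (b z) u = (if u = z then 1 else 0)"
  shows "bij_betw (lext b) {f. Poly_Mapping.keys f \<subseteq> C} {f. Poly_Mapping.keys f \<subseteq> C}"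
proof -
  have into: "Poly_Mapping.keys (lext b f) \<subseteq> C" if "Poly_Mapping.keys f \<subseteq> C" for f
    by (rule keys_lext) (use keys that in auto)
  have ker: "f = 0" if f: "Poly_Mapping.keys f \<subseteq> C" and 0: "lext b f = 0" for f
  proof (rule ccontr)
    assume "f \<noteq> 0"
    then have ne: "Poly_Mapping.keys f \<noteq> {}" by simp
    then have "Max (r ` Poly_Mapping.keys f) \<in> r ` Poly_Mapping.keys f" by (intro Max_in) auto
    then obtain z where "z \<in> Poly_Mapping.keys f" "r z = Max (r ` Poly_Mapping.keys f)" by force
    then have z: "z \<in> Poly_Mapping.keys f" "\<And>x. x \<in> Poly_Mapping.keys f \<Longrightarrow> r x \<le> r z" by simp_all
    \<comment> \<open>By maximality of \<open>r z\<close>, no basis element in the support of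
      \<open>f\<close> other than \<open>z\<close> itself contributes to the coefficient at
      \<open>z\<close>.\<close>
    have "Poly_Mapping.lookup (lext b f) z = (\<Sum>x\<in>Poly_Mapping.keys f. if x = z then Poly_Mapping.lookup f x else 0)"
      unfolding lookup_lext[OF finite_keys subset_refl] 
      using tri[of _ z] z f by (intro sum.cong refl) (auto simp: subset_iff not_less)
    also have "\<dots> = Poly_Mapping.lookup f z" using z(1) by simp
    finally show False using z(1) 0 by (simp add: in_keys_iff)
  qed
  have "inj_on (lext b) {f. Poly_Mapping.keys f \<subseteq> C}"
  proof (rule inj_onI)
    fix f g assume "f \<in> {f. Poly_Mapping.keys f \<subseteq> C}" "g \<in> {f. Poly_Mapping.keys f \<subseteq> C}" "lext b f = lext b g"
    then have "Poly_Mapping.keys (f - g) \<subseteq> C" "lext b (f - g) = 0"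
      using keys_diff[of f g] by (auto simp: clinear_diff[OF clinear_lext])
    then show "f = g" using ker by fastforce
  qed
  moreover have span: "g \<in> lext b ` {f. Poly_Mapping.keys f \<subseteq> C}"
    if g: "\<And>u. u \<in> Poly_Mapping.keys g \<Longrightarrow> basis_vec u \<in> lext b ` {f. Poly_Mapping.keys f \<subseteq> C}" for g
  proof -
    have "\<forall>u\<in>Poly_Mapping.keys g. \<exists>f. Poly_Mapping.keys f \<subseteq> C \<and> lext b f = basis_vec u"
      using g by (metis (no_types, lifting) imageE mem_Collect_eq)
    then obtain F where F: "\<forall>u\<in>Poly_Mapping.keys g. Poly_Mapping.keys (F u) \<subseteq> C \<and> lext b (F u) = basis_vec u"
      by metis
    let ?f = "\<Sum>u\<in>Poly_Mapping.keys g. pscale (Poly_Mapping.lookup g u) (F u)"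
    have "lext b ?f = lext basis_vec g"
      unfolding lext_def[of basis_vec] clinear_sum[OF clinear_lext] clinear_pscale[OF clinear_lext]
      using F by (intro sum.cong) auto
    moreover have "Poly_Mapping.keys ?f \<subseteq> C"
      using F by (intro keys_sum_subset keys_pscale_subset) blast
    ultimately show ?thesis unfolding lext_basis_vec_id by (metis (mono_tags, lifting) image_eqI mem_Collect_eq)
  qed
  have basis: "basis_vec z \<in> lext b ` {f. Poly_Mapping.keys f \<subseteq> C}" if "z \<in> C" for z
    using that
  proof (induction "r z" arbitrary: z rule: less_induct)
    case less
    \<comment> \<open>The correction term is supported in smaller rank, so its basis vectors already
      have preimages.\<close>
    let ?g = "b z - basis_vec z"
    have "u \<in> C \<and> r u < r z" if u: "u \<in> Poly_Mapping.keys ?g" for u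
    proof
      show "u \<in> C" using u keys[OF less(2)] keys_diff[of "b z" "basis_vec z"] less(2) by auto
      then show "r u < r z" using u tri[OF less(2), of u]
        by (auto simp: in_keys_iff lookup_minus lookup_basis_vec split: if_splits)
    qed
    then have "?g \<in> lext b ` {f. Poly_Mapping.keys f \<subseteq> C}" by (intro span[of ?g] less(1)) auto
    then obtain f where f: "Poly_Mapping.keys f \<subseteq> C" "lext b f = ?g" by auto
    have "lext b (basis_vec z - f) = basis_vec z" by (simp add: clinear_diff[OF clinear_lext] f(2))
    moreover have "Poly_Mapping.keys (basis_vec z - f) \<subseteq> C"
      using f(1) less(2) keys_diff[of "basis_vec z" f] by auto
    ultimately show ?case by (metis (mono_tags, lifting) image_eqI mem_Collect_eq)
  qed
  have "{f. Poly_Mapping.keys f \<subseteq> C} \<subseteq> lext b ` {f. Poly_Mapping.keys f \<subseteq> C}"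
    by (rule subsetI, rule span, rule basis) auto
  ultimately show ?thesis using into by (auto simp: bij_betw_def)
qed

lemma sum_swap_pairs:
  "(\<Sum>a\<in>A. \<Sum>b\<in>B. \<Sum>c\<in>C. \<Sum>d\<in>D. t a b c d) = (\<Sum>c\<in>C. \<Sum>d\<in>D. \<Sum>a\<in>A. \<Sum>b\<in>B. t a b c d)"
proof -
  have "(\<Sum>a\<in>A. \<Sum>b\<in>B. \<Sum>c\<in>C. \<Sum>d\<in>D. t a b c d) = (\<Sum>(a, b)\<in>A \<times> B. \<Sum>(c, d)\<in>C \<times> D. t a b c d)"
    by (simp flip: sum.cartesian_product)
  also have "\<dots> = (\<Sum>(c, d)\<in>C \<times> D. \<Sum>(a, b)\<in>A \<times> B. t a b c d)"
    unfolding case_prod_unfold by (rule sum.swap)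
  finally show ?thesis by (simp flip: sum.cartesian_product)
qed

context finite_submonoid_pair begin

text \<open>The action on the associated graded module of the filtration by double ideals, realized
  on C[M] itself: a product that falls into a strictly smaller double ideal becomes zero.\<close>

definition gr_left :: "'a \<Rightarrow> 'a \<Rightarrow> 'a \<Rightarrow>\<^sub>0 complex" where
  "gr_left n z = (if ideal (n \<otimes> z) = ideal z then basis_vec (n \<otimes> z) else 0)"

definition gr_right :: "'a \<Rightarrow> 'a \<Rightarrow> 'a \<Rightarrow>\<^sub>0 complex" where
  "gr_right z k = (if ideal (z \<otimes> k) = ideal z then basis_vec (z \<otimes> k) else 0)"

text \<open>The two-sided product is truncated only once, at the end; compatibility with the
  one-sided truncations is the content of the next two lemmas.\<close>

definition gr_act :: "'a \<Rightarrow> 'a \<Rightarrow> 'a \<Rightarrow> 'a \<Rightarrow>\<^sub>0 complex" where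
  "gr_act n z k = (if ideal (n \<otimes> z \<otimes> k) = ideal z then basis_vec (n \<otimes> z \<otimes> k) else 0)"

text \<open>Multiplication can only shrink double ideals. In a descending chain the two ends agree
  exactly when every step is an equality, so truncating in two stages or once gives the same
  result.\<close>

lemma lext_gr_left:
  assumes x: "x \<in> N" and n: "n \<in> N" and z: "z \<in> carrier M" and k: "k \<in> K"
  shows "lext (gr_left x) (gr_act n z k) = gr_act (x \<otimes> n) z k"
proof -
  have eq: "x \<otimes> (n \<otimes> z \<otimes> k) = (x \<otimes> n) \<otimes> z \<otimes> k" using assms by (simp add: m_assoc)
  have "ideal (n \<otimes> z \<otimes> k) \<subseteq> ideal z" using ideal_mult_subset[OF n k z] .
  moreover have "ideal (x \<otimes> (n \<otimes> z \<otimes> k)) \<subseteq> ideal (n \<otimes> z \<otimes> k)"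
    using ideal_mult_subset[OF x K.one_closed, of "n \<otimes> z \<otimes> k"] assms by simp
  ultimately show ?thesis
    by (auto simp: gr_act_def gr_left_def clinear_zero[OF clinear_lext] simp flip: eq)
qed

lemma lext_gr_right:
  assumes x: "x \<in> K" and n: "n \<in> N" and z: "z \<in> carrier M" and k: "k \<in> K"
  shows "lext (\<lambda>z. gr_right z x) (gr_act n z k) = gr_act n z (k \<otimes> x)"
proof -
  have eq: "n \<otimes> z \<otimes> k \<otimes> x = n \<otimes> z \<otimes> (k \<otimes> x)" using assms by (simp add: m_assoc)
  have "ideal (n \<otimes> z \<otimes> k) \<subseteq> ideal z" using ideal_mult_subset[OF n k z] .
  moreover have "ideal (n \<otimes> z \<otimes> k \<otimes> x) \<subseteq> ideal (n \<otimes> z \<otimes> k)"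
    using ideal_mult_subset[OF N.one_closed x, of "n \<otimes> z \<otimes> k"] assms by simp
  ultimately show ?thesis
    by (auto simp: gr_act_def gr_right_def clinear_zero[OF clinear_lext] simp flip: eq)
qed

text \<open>Averaging the identity map over separability idempotents of both algebras turns it into a
  bimodule map from the regular to the truncated actions; the truncated action agrees with the
  regular one modulo elements generating smaller ideals, so the average is unitriangular.\<close>

lemma regular_iso_graded:
  assumes ssN: "semisimple_ring (monoid_algebra (M\<lparr>carrier := N\<rparr>))"
    and ssK: "semisimple_ring (monoid_algebra (M\<lparr>carrier := K\<rparr>))"
  obtains \<phi> where "clinear \<phi>"
    "bij_betw \<phi> {f. Poly_Mapping.keys f \<subseteq> carrier M} {f. Poly_Mapping.keys f \<subseteq> carrier M}"
    "\<And>a v. Poly_Mapping.keys a \<subseteq> N \<Longrightarrow> Poly_Mapping.keys v \<subseteq> carrier M \<Longrightarrow>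
      \<phi> (bilin (\<lambda>n x. basis_vec (n \<otimes> x)) a v) = bilin gr_left a (\<phi> v)"
    "\<And>v b. Poly_Mapping.keys b \<subseteq> K \<Longrightarrow> Poly_Mapping.keys v \<subseteq> carrier M \<Longrightarrow>
      \<phi> (bilin (\<lambda>x k. basis_vec (x \<otimes> k)) v b) = bilin gr_right (\<phi> v) b"
proof -
  have mN: "monoid (M\<lparr>carrier := N\<rparr>)" and mK: "monoid (M\<lparr>carrier := K\<rparr>)"
    by (auto intro: submonoid.submonoid_is_monoid N.submonoid_axioms K.submonoid_axioms monoid_axioms)
  obtain e where e: "\<And>x F. x \<in> N \<Longrightarrow>
      (\<Sum>n\<in>N. \<Sum>n'\<in>N. e n n' * F (x \<otimes> n) n') = (\<Sum>n\<in>N. \<Sum>n'\<in>N. e n n' * F n (n' \<otimes> x))"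
    "\<And>F. (\<Sum>n\<in>N. \<Sum>n'\<in>N. e n n' * F (n \<otimes> n')) = (F \<one> :: complex)"
    using monoid.separability_idempotent[OF mN _ ssN] finite_NK(1) by auto
  obtain d where d: "\<And>x F. x \<in> K \<Longrightarrow>
      (\<Sum>k\<in>K. \<Sum>k'\<in>K. d k k' * F (x \<otimes> k) k') = (\<Sum>k\<in>K. \<Sum>k'\<in>K. d k k' * F k (k' \<otimes> x))"
    "\<And>F. (\<Sum>k\<in>K. \<Sum>k'\<in>K. d k k' * F (k \<otimes> k')) = (F \<one> :: complex)"
    using monoid.separability_idempotent[OF mK _ ssK] finite_NK(2) by auto
  \<comment> \<open>The outer legs \<open>n\<close> and \<open>k'\<close> act by the truncated
    action, the inner legs \<open>n'\<close> and \<open>k\<close> by ordinary multiplication. A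
    factor multiplied onto \<open>z\<close> thus meets an inner leg, and the Casimir identity
    carries it to the outer leg on the same side.\<close>
  define \<phi>0 where "\<phi>0 z = (\<Sum>n\<in>N. \<Sum>n'\<in>N. \<Sum>k\<in>K. \<Sum>k'\<in>K.
    pscale (e n n' * d k k') (gr_act n (n' \<otimes> z \<otimes> k) k'))" for z
  have keys_act: "Poly_Mapping.keys (gr_act n w k) \<subseteq> carrier M" if "n \<in> N" "w \<in> carrier M" "k \<in> K" for n w k
    using that by (auto simp: gr_act_def)
  have keys: "Poly_Mapping.keys (\<phi>0 z) \<subseteq> carrier M" if z: "z \<in> carrier M" for z
    unfolding \<phi>0_def by (intro keys_sum_subset keys_pscale_subset keys_act) (use z in auto)
  have expandN: "Poly_Mapping.lookup (\<phi>0 z) u = (\<Sum>n\<in>N. \<Sum>n'\<in>N. e n n' *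
      (\<Sum>k\<in>K. \<Sum>k'\<in>K. d k k' * Poly_Mapping.lookup (gr_act n (n' \<otimes> z \<otimes> k) k') u))" for z u
    by (simp add: \<phi>0_def lookup_sum sum_distrib_left mult.assoc)
  \<comment> \<open>The same coefficient with the sums over \<open>K\<close> outermost, as needed
    for the Casimir identity of \<open>d\<close>.\<close>
  have expandK: "Poly_Mapping.lookup (\<phi>0 z) u = (\<Sum>k\<in>K. \<Sum>k'\<in>K. d k k' *
      (\<Sum>n\<in>N. \<Sum>n'\<in>N. e n n' * Poly_Mapping.lookup (gr_act n (n' \<otimes> z \<otimes> k) k') u))" for z u
    unfolding expandN sum_distrib_left by (subst sum_swap_pairs) (intro sum.cong refl, simp add: ac_simps)
  have left: "\<phi>0 (x \<otimes> z) = lext (gr_left x) (\<phi>0 z)" if x: "x \<in> N" and z: "z \<in> carrier M" for x z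
  proof (rule poly_mapping_eqI)
    fix u
    define F where "F p q = (\<Sum>k\<in>K. \<Sum>k'\<in>K. d k k' * Poly_Mapping.lookup (gr_act p (q \<otimes> z \<otimes> k) k') u)" for p q
    have "Poly_Mapping.lookup (\<phi>0 (x \<otimes> z)) u = (\<Sum>n\<in>N. \<Sum>n'\<in>N. e n n' * F n (n' \<otimes> x))"
      unfolding expandN F_def using x z by (intro sum.cong refl) (simp add: m_assoc)
    also have "\<dots> = (\<Sum>n\<in>N. \<Sum>n'\<in>N. e n n' * F (x \<otimes> n) n')" by (rule e(1)[OF x, symmetric])
    also have "\<dots> = Poly_Mapping.lookup (lext (gr_left x) (\<phi>0 z)) u"
      unfolding \<phi>0_def clinear_sum[OF clinear_lext] clinear_pscale[OF clinear_lext]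
        lookup_sum lookup_pscale F_def sum_distrib_left
      using x z by (intro sum.cong refl) (simp add: lext_gr_left mult.assoc)
    finally show "Poly_Mapping.lookup (\<phi>0 (x \<otimes> z)) u = Poly_Mapping.lookup (lext (gr_left x) (\<phi>0 z)) u" .
  qed
  have right: "\<phi>0 (z \<otimes> x) = lext (\<lambda>z. gr_right z x) (\<phi>0 z)" if x: "x \<in> K" and z: "z \<in> carrier M" for x z
  proof (rule poly_mapping_eqI)
    fix u
    define F where "F p q = (\<Sum>n\<in>N. \<Sum>n'\<in>N. e n n' * Poly_Mapping.lookup (gr_act n (n' \<otimes> z \<otimes> p) q) u)" for p q
    have "Poly_Mapping.lookup (\<phi>0 (z \<otimes> x)) u = (\<Sum>k\<in>K. \<Sum>k'\<in>K. d k k' * F (x \<otimes> k) k')"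
      unfolding expandK F_def using x z by (intro sum.cong refl) (simp add: m_assoc)
    also have "\<dots> = (\<Sum>k\<in>K. \<Sum>k'\<in>K. d k k' * F k (k' \<otimes> x))" by (rule d(1)[OF x])
    also have "\<dots> = (\<Sum>k\<in>K. \<Sum>k'\<in>K. \<Sum>n\<in>N. \<Sum>n'\<in>N.
        e n n' * d k k' * Poly_Mapping.lookup (lext (\<lambda>z. gr_right z x) (gr_act n (n' \<otimes> z \<otimes> k) k')) u)"
      unfolding F_def sum_distrib_left
      using x z by (intro sum.cong refl) (simp add: lext_gr_right mult.assoc mult.left_commute)
    also have "\<dots> = Poly_Mapping.lookup (lext (\<lambda>z. gr_right z x) (\<phi>0 z)) u"
      unfolding \<phi>0_def clinear_sum[OF clinear_lext] clinear_pscale[OF clinear_lext]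
        lookup_sum lookup_pscale by (rule sum_swap_pairs)
    finally show "Poly_Mapping.lookup (\<phi>0 (z \<otimes> x)) u = Poly_Mapping.lookup (lext (\<lambda>z. gr_right z x) (\<phi>0 z)) u" .
  qed
  have tri: "Poly_Mapping.lookup (\<phi>0 z) u = (if u = z then 1 else 0)"
    if z: "z \<in> carrier M" and u: "u \<in> carrier M" and nl: "\<not> card (ideal u) < card (ideal z)" for z u
  proof -
    \<comment> \<open>If the full product is \<open>u\<close>, the double ideals descend from that
      of \<open>z\<close> to that of \<open>u\<close>. Since the latter is not smaller in
      cardinality, the whole chain is constant and nothing is truncated.\<close>
    have act: "Poly_Mapping.lookup (gr_act n (n' \<otimes> z \<otimes> k) k') u =
        (if (n \<otimes> n') \<otimes> z \<otimes> (k \<otimes> k') = u then 1 else 0)"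
      if nk: "n \<in> N" "n' \<in> N" "k \<in> K" "k' \<in> K" for n n' k k'
    proof -
      have eq: "n \<otimes> (n' \<otimes> z \<otimes> k) \<otimes> k' = (n \<otimes> n') \<otimes> z \<otimes> (k \<otimes> k')"
        using nk z by (simp add: m_assoc)
      have 1: "ideal (n' \<otimes> z \<otimes> k) \<subseteq> ideal z" using nk z by (intro ideal_mult_subset)
      have 2: "ideal (n \<otimes> (n' \<otimes> z \<otimes> k) \<otimes> k') \<subseteq> ideal (n' \<otimes> z \<otimes> k)"
        using nk z by (intro ideal_mult_subset) auto
      have "ideal (n \<otimes> (n' \<otimes> z \<otimes> k) \<otimes> k') = ideal (n' \<otimes> z \<otimes> k)" if "(n \<otimes> n') \<otimes> z \<otimes> (k \<otimes> k') = u"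
      proof -
        have fin: "finite (ideal z)" using ideal_subset_carrier[OF z] finite_carrier finite_subset by blast
        have "ideal u = ideal z"
          using 1 2 nl that eq by (intro card_seteq[OF fin]) auto
        with 1 2 that eq show ?thesis by simp
      qed
      then show ?thesis unfolding gr_act_def eq by (auto simp: lookup_basis_vec)
    qed
    have "Poly_Mapping.lookup (\<phi>0 z) u = (\<Sum>n\<in>N. \<Sum>n'\<in>N. e n n' *
      (\<Sum>k\<in>K. \<Sum>k'\<in>K. d k k' * (if (n \<otimes> n') \<otimes> z \<otimes> (k \<otimes> k') = u then 1 else 0)))"
      unfolding expandN by (intro sum.cong refl arg_cong2[of _ _ _ _ "(*)"]) (simp add: act)
    \<comment> \<open>Without truncation only the products of the legs occur, and these collapse to
      the unit, first for \<open>d\<close> and then for \<open>e\<close>.\<close>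
    also have "\<dots> = (\<Sum>n\<in>N. \<Sum>n'\<in>N. e n n' * (if (n \<otimes> n') \<otimes> z \<otimes> \<one> = u then 1 else 0))"
      by (simp only: d(2)[of "\<lambda>k. if _ \<otimes> z \<otimes> k = u then 1 else 0"])
    also have "\<dots> = (if \<one> \<otimes> z \<otimes> \<one> = u then 1 else 0)"
      by (rule e(2)[of "\<lambda>n. if n \<otimes> z \<otimes> \<one> = u then 1 else 0"])
    finally show ?thesis using z by auto
  qed
  show ?thesis
  proof (rule that[of "lext \<phi>0"])
    show "clinear (lext \<phi>0)" by (rule clinear_lext)
    show "bij_betw (lext \<phi>0) {f. Poly_Mapping.keys f \<subseteq> carrier M} {f. Poly_Mapping.keys f \<subseteq> carrier M}"
      by (rule unitriangular_bij[where r = "\<lambda>u. card (ideal u)"]) (use keys tri in auto)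
  next
    fix a v :: "'a \<Rightarrow>\<^sub>0 complex" assume a: "Poly_Mapping.keys a \<subseteq> N" and v: "Poly_Mapping.keys v \<subseteq> carrier M"
    show "lext \<phi>0 (bilin (\<lambda>n x. basis_vec (n \<otimes> x)) a v) = bilin gr_left a (lext \<phi>0 v)"
    proof (rule clinear_ext[OF clinear_compose[OF clinear_lext clinear_bilin1] clinear_bilin1 _ a])
      fix n assume n: "n \<in> N"
      have lext_bilin: "bilin gr_left (basis_vec n) g = lext (gr_left n) g" for g
        by (rule clinear_ext[OF clinear_bilin2 clinear_lext _ subset_UNIV]) simp
      show "lext \<phi>0 (bilin (\<lambda>n x. basis_vec (n \<otimes> x)) (basis_vec n) v) = bilin gr_left (basis_vec n) (lext \<phi>0 v)"
        by (rule clinear_ext[OF clinear_compose[OF clinear_lext clinear_bilin2]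
              clinear_compose[OF clinear_bilin2 clinear_lext] _ v]) (use n left in \<open>simp add: lext_bilin\<close>)
    qed
  next
    fix b v :: "'a \<Rightarrow>\<^sub>0 complex" assume b: "Poly_Mapping.keys b \<subseteq> K" and v: "Poly_Mapping.keys v \<subseteq> carrier M"
    show "lext \<phi>0 (bilin (\<lambda>x k. basis_vec (x \<otimes> k)) v b) = bilin gr_right (lext \<phi>0 v) b"
    proof (rule clinear_ext[OF clinear_compose[OF clinear_lext clinear_bilin2] clinear_bilin2 _ b])
      fix k assume k: "k \<in> K"
      have lext_bilin: "bilin gr_right g (basis_vec k) = lext (\<lambda>z. gr_right z k) g" for g
        by (rule clinear_ext[OF clinear_bilin1 clinear_lext _ subset_UNIV]) simp
      show "lext \<phi>0 (bilin (\<lambda>x k. basis_vec (x \<otimes> k)) v (basis_vec k)) = bilin gr_right (lext \<phi>0 v) (basis_vec k)"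
        by (rule clinear_ext[OF clinear_compose[OF clinear_lext clinear_bilin1]
              clinear_compose[OF clinear_bilin1 clinear_lext] _ v]) (use k right in \<open>simp add: lext_bilin\<close>)
    qed
  qed
qed

end

section \<open>The tensor product of the class modules\<close>

context finite_submonoid_pair begin

abbreviation circ_lin :: "'a \<Rightarrow> ('a \<Rightarrow>\<^sub>0 complex) \<Rightarrow> ('a \<Rightarrow>\<^sub>0 complex) \<Rightarrow> 'a \<Rightarrow>\<^sub>0 complex" where
  "circ_lin m \<equiv> bilin (\<lambda>x y. basis_vec (circ M N K m x y))"

text \<open>The additive map from the free abelian group on pairs to C[M] that sends a pair to its
  bilinear \<open>\<circ>\<close>-product; its kernel is later identified with the subgroup of
  tensor relations.\<close>

definition tensor_eval :: "'a \<Rightarrow> (('a \<Rightarrow>\<^sub>0 complex) \<times> ('a \<Rightarrow>\<^sub>0 complex) \<Rightarrow>\<^sub>0 int) \<Rightarrow> 'a \<Rightarrow>\<^sub>0 complex" where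
  "tensor_eval m c = (\<Sum>p\<in>Poly_Mapping.keys c.
     pscale (of_int (Poly_Mapping.lookup c p)) (circ_lin m (fst p) (snd p)))"

abbreviation pairs :: "'a \<Rightarrow> (('a \<Rightarrow>\<^sub>0 complex) \<times> ('a \<Rightarrow>\<^sub>0 complex)) set" where
  "pairs m \<equiv> {v. Poly_Mapping.keys v \<subseteq> L_class M N m} \<times> {w. Poly_Mapping.keys w \<subseteq> R_class M K m}"

text \<open>The fibres turn out to be the cosets that make up the tensor product, so elements of the
  tensor product can be named by elements of C[J].\<close>

definition tensor_fibre :: "'a \<Rightarrow> ('a \<Rightarrow>\<^sub>0 complex) \<Rightarrow> (('a \<Rightarrow>\<^sub>0 complex) \<times> ('a \<Rightarrow>\<^sub>0 complex) \<Rightarrow>\<^sub>0 int) set" where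
  "tensor_fibre m f = {c. Poly_Mapping.keys c \<subseteq> pairs m \<and> tensor_eval m c = f}"

abbreviation tens_rel :: "'a \<Rightarrow> (('a \<Rightarrow>\<^sub>0 complex) \<times> ('a \<Rightarrow>\<^sub>0 complex) \<Rightarrow>\<^sub>0 int) set" where
  "tens_rel m \<equiv> tensor_relations (monoid_algebra (H_monoid M N K m)) (L_bimod M N K m) (R_bimod M N K m)"

abbreviation tens_sub :: "'a \<Rightarrow> (('a \<Rightarrow>\<^sub>0 complex) \<times> ('a \<Rightarrow>\<^sub>0 complex) \<Rightarrow>\<^sub>0 int) set" where
  "tens_sub m \<equiv> generate (free_Abelian_group (pairs m)) (tens_rel m)"

abbreviation tens where
  "tens m \<equiv> tensor_bimod (monoid_algebra (H_monoid M N K m)) (L_bimod M N K m) (R_bimod M N K m)"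

lemma L_bimod_simps:
  "carrier (L_bimod M N K m) = {v. Poly_Mapping.keys v \<subseteq> L_class M N m}"
  "v \<otimes>\<^bsub>L_bimod M N K m\<^esub> v' = v + v'"
  "lact (L_bimod M N K m) = bilin (\<lambda>n x. if n \<otimes> x \<in> L_class M N m then basis_vec (n \<otimes> x) else 0)"
  "ract (L_bimod M N K m) = circ_lin m"
  by (simp_all add: L_bimod_def linear_bimod_def)

lemma R_bimod_simps:
  "carrier (R_bimod M N K m) = {v. Poly_Mapping.keys v \<subseteq> R_class M K m}"
  "w \<otimes>\<^bsub>R_bimod M N K m\<^esub> w' = w + w'"
  "lact (R_bimod M N K m) = circ_lin m"
  "ract (R_bimod M N K m) = bilin (\<lambda>y k. if y \<otimes> k \<in> R_class M K m then basis_vec (y \<otimes> k) else 0)"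
  by (simp_all add: R_bimod_def linear_bimod_def)

lemma H_monoid_simps:
  "carrier (H_monoid M N K m) = H_class M N K m"
  by (simp add: H_monoid_def)

lemma tens_simps:
  "carrier (tens m) = rcosets\<^bsub>free_Abelian_group (pairs m)\<^esub> (tens_sub m)"
  "monoid.mult (tens m) = set_mult (free_Abelian_group (pairs m))"
  "\<one>\<^bsub>tens m\<^esub> = tens_sub m"
  "lact (tens m) a C = (\<Union>c\<in>C. tens_sub m #>\<^bsub>free_Abelian_group (pairs m)\<^esub>
     frag_extend (\<lambda>(v, w). frag_of (lact (L_bimod M N K m) a v, w)) c)"
  "ract (tens m) C b = (\<Union>c\<in>C. tens_sub m #>\<^bsub>free_Abelian_group (pairs m)\<^esub>
     frag_extend (\<lambda>(v, w). frag_of (v, ract (R_bimod M N K m) w b)) c)"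
  by (simp_all add: tensor_bimod_def Let_def monoid.extend_def FactGroup_def L_bimod_simps(1) R_bimod_simps(1))

lemma tensor_eval_superset:
  assumes "finite P" "Poly_Mapping.keys c \<subseteq> P"
  shows "tensor_eval m c = (\<Sum>p\<in>P. pscale (of_int (Poly_Mapping.lookup c p)) (circ_lin m (fst p) (snd p)))"
  unfolding tensor_eval_def using assms by (intro sum.mono_neutral_left) (auto simp: in_keys_iff)

lemma tensor_eval_add: "tensor_eval m (c + d) = tensor_eval m c + tensor_eval m d"
proof -
  let ?P = "Poly_Mapping.keys c \<union> Poly_Mapping.keys d"
  have [simp]: "pscale (a + b) f = pscale a f + pscale b f" for a b and f :: "'a \<Rightarrow>\<^sub>0 complex"
    by (rule poly_mapping_eqI) (simp add: lookup_add distrib_right)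
  show ?thesis
    by (simp add: tensor_eval_superset[of ?P] keys_add lookup_add sum.distrib)
qed

lemma tensor_eval_0 [simp]: "tensor_eval m 0 = 0"
  by (simp add: tensor_eval_def)

lemma tensor_eval_minus: "tensor_eval m (- c) = - tensor_eval m c"
  using tensor_eval_add[of m c "- c"] by (simp add: eq_neg_iff_add_eq_0 add.commute)

lemma tensor_eval_diff: "tensor_eval m (c - d) = tensor_eval m c - tensor_eval m d"
  using tensor_eval_add[of m c "- d"] by (simp add: tensor_eval_minus)

lemma tensor_eval_frag_of [simp]: "tensor_eval m (frag_of p) = circ_lin m (fst p) (snd p)"
  by (simp add: tensor_eval_def)

lemma tensor_eval_sum: "tensor_eval m (\<Sum>i\<in>I. c i) = (\<Sum>i\<in>I. tensor_eval m (c i))"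
  by (induction I rule: infinite_finite_induct) (auto simp: tensor_eval_add)

context
  fixes m assumes m: "m \<in> carrier M"
begin

abbreviation (input) F where "F \<equiv> free_Abelian_group (pairs m)"
abbreviation (input) T where "T \<equiv> tens_sub m"

lemma finite_classes: "finite (L_class M N m)" "finite (R_class M K m)" "finite (H_class M N K m)"
    "finite (J_class M N K m)"
  using L_class_carrier R_class_carrier H_class_carrier J_class_carrier finite_carrier
  by (meson finite_subset)+

lemma circ_lin_J:
  assumes "Poly_Mapping.keys v \<subseteq> L_class M N m" "Poly_Mapping.keys w \<subseteq> R_class M K m"
  shows "Poly_Mapping.keys (circ_lin m v w) \<subseteq> J_class M N K m"
  by (rule keys_bilin) (use circ_J[OF m] assms in auto)

lemma circ_lin_L:
  assumes "Poly_Mapping.keys v \<subseteq> L_class M N m" "Poly_Mapping.keys r \<subseteq> H_class M N K m"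
  shows "Poly_Mapping.keys (circ_lin m v r) \<subseteq> L_class M N m"
  by (rule keys_bilin) (use circ_L_closed[OF m] assms in auto)

lemma circ_lin_R:
  assumes "Poly_Mapping.keys r \<subseteq> H_class M N K m" "Poly_Mapping.keys w \<subseteq> R_class M K m"
  shows "Poly_Mapping.keys (circ_lin m r w) \<subseteq> R_class M K m"
  by (rule keys_bilin) (use circ_R_closed[OF m] assms in auto)

lemma circ_lin_assoc:
  assumes v: "Poly_Mapping.keys v \<subseteq> L_class M N m" and r: "Poly_Mapping.keys r \<subseteq> H_class M N K m"
    and w: "Poly_Mapping.keys w \<subseteq> R_class M K m"
  shows "circ_lin m (circ_lin m v r) w = circ_lin m v (circ_lin m r w)"
proof (rule clinear_ext[OF clinear_compose[OF clinear_bilin1 clinear_bilin1] clinear_bilin1 _ v])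
  fix x assume x: "x \<in> L_class M N m"
  show "circ_lin m (circ_lin m (basis_vec x) r) w = circ_lin m (basis_vec x) (circ_lin m r w)"
  proof (rule clinear_ext[OF clinear_compose[OF clinear_bilin1 clinear_bilin2]
        clinear_compose[OF clinear_bilin2 clinear_bilin1] _ r])
    fix h assume h: "h \<in> H_class M N K m"
    show "circ_lin m (circ_lin m (basis_vec x) (basis_vec h)) w =
        circ_lin m (basis_vec x) (circ_lin m (basis_vec h) w)"
      by (rule clinear_ext[OF clinear_bilin2 clinear_compose[OF clinear_bilin2 clinear_bilin2] _ w])
        (use x h in \<open>simp add: circ_assoc[OF m]\<close>)
  qed
qed

lemma tensor_eval_keys:
  assumes "Poly_Mapping.keys c \<subseteq> pairs m"
  shows "Poly_Mapping.keys (tensor_eval m c) \<subseteq> J_class M N K m"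
  unfolding tensor_eval_def
proof (intro keys_sum_subset keys_pscale_subset circ_lin_J)
  fix p assume "p \<in> Poly_Mapping.keys c"
  then have "p \<in> pairs m" using assms by blast
  then show "Poly_Mapping.keys (fst p) \<subseteq> L_class M N m" "Poly_Mapping.keys (snd p) \<subseteq> R_class M K m" by auto
qed

lemma tens_rel_cases:
  assumes "c \<in> tens_rel m"
  obtains
    (left) v v' w where "c = frag_of (v + v', w) - frag_of (v, w) - frag_of (v', w)"
      "(v, w) \<in> pairs m" "(v', w) \<in> pairs m"
  | (right) v w w' where "c = frag_of (v, w + w') - frag_of (v, w) - frag_of (v, w')"
      "(v, w) \<in> pairs m" "(v, w') \<in> pairs m"
  | (balanced) v r w where "c = frag_of (circ_lin m v r, w) - frag_of (v, circ_lin m r w)"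
      "(v, w) \<in> pairs m" "Poly_Mapping.keys r \<subseteq> H_class M N K m"
  using assms unfolding tensor_relations_def L_bimod_simps R_bimod_simps monoid_algebra_simps H_monoid_simps
  by blast

lemma tens_relI:
  "\<lbrakk>(v, w) \<in> pairs m; (v', w) \<in> pairs m\<rbrakk> \<Longrightarrow>
    frag_of (v + v', w) - frag_of (v, w) - frag_of (v', w) \<in> tens_rel m"
  "\<lbrakk>(v, w) \<in> pairs m; (v, w') \<in> pairs m\<rbrakk> \<Longrightarrow>
    frag_of (v, w + w') - frag_of (v, w) - frag_of (v, w') \<in> tens_rel m"
  "\<lbrakk>(v, w) \<in> pairs m; Poly_Mapping.keys r \<subseteq> H_class M N K m\<rbrakk> \<Longrightarrow>
    frag_of (circ_lin m v r, w) - frag_of (v, circ_lin m r w) \<in> tens_rel m"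
  unfolding tensor_relations_def L_bimod_simps R_bimod_simps monoid_algebra_simps H_monoid_simps
  by blast+

lemma tens_rel_subset: "tens_rel m \<subseteq> carrier F"
proof
  fix c assume "c \<in> tens_rel m"
  then show "c \<in> carrier F"
  proof (cases rule: tens_rel_cases)
    case (left v v' w)
    then have "(v + v', w) \<in> pairs m" by (simp add: keys_add_subset)
    with left show ?thesis
      unfolding carrier_free_Abelian_group_iff left(1) by (intro keys_diff_subset keys_frag_of_subset)
  next
    case (right v w w')
    then have "(v, w + w') \<in> pairs m" by (simp add: keys_add_subset)
    with right show ?thesis
      unfolding carrier_free_Abelian_group_iff right(1) by (intro keys_diff_subset keys_frag_of_subset)
  next
    case (balanced v r w)
    then have "(circ_lin m v r, w) \<in> pairs m" "(v, circ_lin m r w) \<in> pairs m"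
      by (simp_all add: circ_lin_L circ_lin_R)
    then show ?thesis
      unfolding carrier_free_Abelian_group_iff balanced(1) by (intro keys_diff_subset keys_frag_of_subset)
  qed
qed

lemma T_subset: "c \<in> T \<Longrightarrow> Poly_Mapping.keys c \<subseteq> pairs m"
  using group.generate_incl[OF group_free_Abelian_group tens_rel_subset]
  unfolding carrier_free_Abelian_group_iff[symmetric] by blast

lemma T_zero: "0 \<in> T"
  using generate.one[of F "tens_rel m"] by simp

lemma T_add: "c \<in> T \<Longrightarrow> d \<in> T \<Longrightarrow> c + d \<in> T"
  using generate.eng[of c F "tens_rel m" d] by simp

lemma T_minus: "c \<in> T \<Longrightarrow> - c \<in> T"
  using group.generate_m_inv_closed[OF group_free_Abelian_group tens_rel_subset, of c]
    inv_free_Abelian_group[OF T_subset, of c] by simp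

lemma T_diff: "c \<in> T \<Longrightarrow> d \<in> T \<Longrightarrow> c - d \<in> T"
  using T_add[of c "- d"] T_minus[of d] by simp

lemma T_sum: "(\<And>i. i \<in> I \<Longrightarrow> c i \<in> T) \<Longrightarrow> (\<Sum>i\<in>I. c i) \<in> T"
  by (induction I rule: infinite_finite_induct) (auto simp: T_zero T_add)

lemma T_incl: "c \<in> tens_rel m \<Longrightarrow> c \<in> T"
  by (rule generate.incl)

lemma tensor_eval_rel:
  assumes "c \<in> tens_rel m"
  shows "tensor_eval m c = 0"
  using assms
proof (cases rule: tens_rel_cases)
  case (left v v' w)
  then show ?thesis by (simp add: tensor_eval_diff clinear_add[OF clinear_bilin1])
next
  case (right v w w')
  then show ?thesis by (simp add: tensor_eval_diff clinear_add[OF clinear_bilin2])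
next
  case (balanced v r w)
  then show ?thesis by (simp add: tensor_eval_diff circ_lin_assoc)
qed

lemma tensor_eval_T: "c \<in> T \<Longrightarrow> tensor_eval m c = 0"
proof (induction rule: generate.induct)
  case (inv h)
  then show ?case
    using inv_free_Abelian_group[OF T_subset[OF T_incl[OF inv]]] by (simp add: tensor_eval_minus tensor_eval_rel)
qed (auto simp: tensor_eval_rel tensor_eval_add)

section \<open>Congruence modulo the tensor relations and normal forms\<close>

definition congT where "congT c d \<longleftrightarrow> c - d \<in> T"

lemma congT_refl: "congT c c" by (simp add: congT_def T_zero)

lemma congT_sym: "congT c d \<Longrightarrow> congT d c" using T_minus[of "c - d"] by (simp add: congT_def)

lemma congT_trans [trans]: "congT c d \<Longrightarrow> congT d e \<Longrightarrow> congT c e"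
  using T_add[of "c - d" "d - e"] by (simp add: congT_def)

lemma congT_add: "congT c d \<Longrightarrow> congT c' d' \<Longrightarrow> congT (c + c') (d + d')"
  using T_add[of "c - d" "c' - d'"] by (simp add: congT_def algebra_simps)

lemma congT_diff: "congT c d \<Longrightarrow> congT c' d' \<Longrightarrow> congT (c - c') (d - d')"
  using T_diff[of "c - d" "c' - d'"] by (simp add: congT_def algebra_simps)

lemma congT_sum: "(\<And>i. i \<in> I \<Longrightarrow> congT (c i) (d i)) \<Longrightarrow> congT (\<Sum>i\<in>I. c i) (\<Sum>i\<in>I. d i)"
  using T_sum[of I "\<lambda>i. c i - d i"] by (simp add: congT_def sum_subtractf)

lemma congT_left:
  assumes "Poly_Mapping.keys v \<subseteq> L_class M N m" "Poly_Mapping.keys v' \<subseteq> L_class M N m"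
    "Poly_Mapping.keys w \<subseteq> R_class M K m"
  shows "congT (frag_of (v + v', w)) (frag_of (v, w) + frag_of (v', w))"
  using T_incl[OF tens_relI(1)[of v w v']] assms by (simp add: congT_def diff_diff_eq)

lemma congT_right:
  assumes "Poly_Mapping.keys v \<subseteq> L_class M N m" "Poly_Mapping.keys w \<subseteq> R_class M K m"
    "Poly_Mapping.keys w' \<subseteq> R_class M K m"
  shows "congT (frag_of (v, w + w')) (frag_of (v, w) + frag_of (v, w'))"
  using T_incl[OF tens_relI(2)[of v w w']] assms by (simp add: congT_def diff_diff_eq)

lemma congT_balanced:
  assumes "Poly_Mapping.keys v \<subseteq> L_class M N m" "Poly_Mapping.keys r \<subseteq> H_class M N K m"
    "Poly_Mapping.keys w \<subseteq> R_class M K m"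
  shows "congT (frag_of (circ_lin m v r, w)) (frag_of (v, circ_lin m r w))"
  using T_incl[OF tens_relI(3)[of v w r]] assms by (simp add: congT_def)

text \<open>Additivity applied to \<open>0 + 0\<close> makes the generator congruent to twice
  itself.\<close>

lemma congT_left_zero:
  assumes "Poly_Mapping.keys w \<subseteq> R_class M K m"
  shows "congT (frag_of (0, w)) 0"
  using congT_sym[OF congT_diff[OF congT_left[of 0 0 w] congT_refl[of "frag_of (0, w)"]]] assms by simp

lemma congT_right_zero:
  assumes "Poly_Mapping.keys v \<subseteq> L_class M N m"
  shows "congT (frag_of (v, 0)) 0"
  using congT_sym[OF congT_diff[OF congT_right[of v 0 0] congT_refl[of "frag_of (v, 0)"]]] assms by simp

lemma congT_left_sum:
  assumes "\<And>i. i \<in> I \<Longrightarrow> Poly_Mapping.keys (v i) \<subseteq> L_class M N m" "Poly_Mapping.keys w \<subseteq> R_class M K m"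
  shows "congT (frag_of (\<Sum>i\<in>I. v i, w)) (\<Sum>i\<in>I. frag_of (v i, w))"
  using assms(1)
proof (induction I rule: infinite_finite_induct)
  case (insert i I)
  have "congT (frag_of (v i + (\<Sum>i\<in>I. v i), w)) (frag_of (v i, w) + frag_of (\<Sum>i\<in>I. v i, w))"
    by (rule congT_left[OF _ _ assms(2)]) (use insert(4) in \<open>auto intro!: keys_sum_subset\<close>)
  also have "congT \<dots> (frag_of (v i, w) + (\<Sum>i\<in>I. frag_of (v i, w)))"
    by (rule congT_add[OF congT_refl]) (use insert in auto)
  finally show ?case using insert(1,2) by simp
qed (use congT_left_zero[OF assms(2)] in auto)

lemma congT_right_sum:
  assumes "\<And>i. i \<in> I \<Longrightarrow> Poly_Mapping.keys (w i) \<subseteq> R_class M K m" "Poly_Mapping.keys v \<subseteq> L_class M N m"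
  shows "congT (frag_of (v, \<Sum>i\<in>I. w i)) (\<Sum>i\<in>I. frag_of (v, w i))"
  using assms(1)
proof (induction I rule: infinite_finite_induct)
  case (insert i I)
  have "congT (frag_of (v, w i + (\<Sum>i\<in>I. w i))) (frag_of (v, w i) + frag_of (v, \<Sum>i\<in>I. w i))"
    by (rule congT_right[OF assms(2)]) (use insert(4) in \<open>auto intro!: keys_sum_subset\<close>)
  also have "congT \<dots> (frag_of (v, w i) + (\<Sum>i\<in>I. frag_of (v, w i)))"
    by (rule congT_add[OF congT_refl]) (use insert in auto)
  finally show ?case using insert(1,2) by simp
qed (use congT_right_zero[OF assms(2)] in auto)

lemma circ_lin_single: "circ_lin m (Poly_Mapping.single x a) (Poly_Mapping.single y b) =
    Poly_Mapping.single (circ M N K m x y) (a * b)"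
proof -
  have "circ_lin m (pscale a (basis_vec x)) (pscale b (basis_vec y)) =
      pscale (a * b) (basis_vec (circ M N K m x y))"
    by (simp only: clinear_pscale[OF clinear_bilin1] clinear_pscale[OF clinear_bilin2]
        bilin_basis_vec pscale_pscale mult.commute)
  then show ?thesis unfolding pscale_basis_vec .
qed

text \<open>Equal products are linked by some \<open>h\<close> in \<open>H\<close> with
  \<open>x = x0 \<circ> h\<close> and \<open>y0 = h \<circ> y\<close>, so moving \<open>h\<close>
  across the tensor sign turns one pure tensor into the other.\<close>

lemma congT_single:
  assumes "x \<in> L_class M N m" "y \<in> R_class M K m" "x0 \<in> L_class M N m" "y0 \<in> R_class M K m"
    and eq: "circ M N K m x0 y0 = circ M N K m x y"
  shows "congT (frag_of (Poly_Mapping.single x a, Poly_Mapping.single y b))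
    (frag_of (Poly_Mapping.single x0 (a * b), basis_vec y0))"
proof -
  obtain h where h: "h \<in> H_class M N K m" "x = circ M N K m x0 h" "y0 = circ M N K m h y"
    using circ_eq_imp_H[OF m assms(3,1,4,2) eq] by blast
  \<comment> \<open>The relations contain no explicit complex scalars; a scalar \<open>d\<close>
    crosses the tensor sign as the element \<open>Poly_Mapping.single m d\<close> of C[H],
    \<open>m\<close> being the identity of \<open>H\<close>.\<close>
  have scalar: "congT (frag_of (Poly_Mapping.single u (c * d), Poly_Mapping.single w b))
      (frag_of (Poly_Mapping.single u c, Poly_Mapping.single w (d * b)))"
    if "u \<in> L_class M N m" "w \<in> R_class M K m" for u w c d b
    using congT_balanced[of "Poly_Mapping.single u c" "Poly_Mapping.single m d" "Poly_Mapping.single w b"]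
      that self_in_classes(3)[OF m] by (simp add: circ_lin_single circ_one[OF m])
  have "congT (frag_of (Poly_Mapping.single x a, Poly_Mapping.single y b))
      (frag_of (Poly_Mapping.single x (a * b), Poly_Mapping.single y 1))"
    using congT_sym[OF scalar[of x y a b 1]] assms by simp
  also have "congT \<dots> (frag_of (Poly_Mapping.single x0 1, Poly_Mapping.single y0 (a * b)))"
    using congT_balanced[of "Poly_Mapping.single x0 1" "Poly_Mapping.single h (a * b)" "Poly_Mapping.single y 1"]
      assms h by (simp add: circ_lin_single)
  also have "congT \<dots> (frag_of (Poly_Mapping.single x0 (a * b), basis_vec y0))"
    using congT_sym[OF scalar[of x0 y0 1 "a * b" 1]] assms by simp
  finally show ?thesis .
qed

definition factor :: "'a \<Rightarrow> 'a \<times> 'a" where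
  "factor z = (SOME p. p \<in> L_class M N m \<times> R_class M K m \<and> circ M N K m (fst p) (snd p) = z)"

lemma factor:
  assumes "z \<in> J_class M N K m"
  shows "fst (factor z) \<in> L_class M N m" "snd (factor z) \<in> R_class M K m"
    "circ M N K m (fst (factor z)) (snd (factor z)) = z"
proof -
  have "\<exists>p. p \<in> L_class M N m \<times> R_class M K m \<and> circ M N K m (fst p) (snd p) = z"
    using assms J_class_eq_circ[OF m] by (auto simp: image_iff)
  from someI_ex[OF this] show "fst (factor z) \<in> L_class M N m" "snd (factor z) \<in> R_class M K m"
    "circ M N K m (fst (factor z)) (snd (factor z)) = z"
    by (auto simp: factor_def mem_Times_iff)
qed

text \<open>A section of \<open>tensor_eval\<close> on C[J], built from one chosen factorization per
  element. It is additive only modulo the relations, because the generator of a sum of vectors is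
  not the sum of the generators.\<close>

definition sec :: "('a \<Rightarrow>\<^sub>0 complex) \<Rightarrow> (('a \<Rightarrow>\<^sub>0 complex) \<times> ('a \<Rightarrow>\<^sub>0 complex) \<Rightarrow>\<^sub>0 int)" where
  "sec f = (\<Sum>z\<in>J_class M N K m. frag_of (Poly_Mapping.single (fst (factor z)) (Poly_Mapping.lookup f z), basis_vec (snd (factor z))))"

lemma sec_keys: "Poly_Mapping.keys (sec f) \<subseteq> pairs m"
  unfolding sec_def by (intro keys_sum_subset keys_frag_of_subset) (auto simp: factor)

lemma tensor_eval_sec:
  assumes "Poly_Mapping.keys f \<subseteq> J_class M N K m"
  shows "tensor_eval m (sec f) = f"
proof -
  have "tensor_eval m (sec f) = (\<Sum>z\<in>J_class M N K m. Poly_Mapping.single z (Poly_Mapping.lookup f z))"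
    unfolding sec_def tensor_eval_sum by (intro sum.cong) (auto simp: circ_lin_single factor)
  with sum_single_lookup[OF finite_classes(4) assms] show ?thesis by simp
qed

lemma sec_add: "congT (sec (f + g)) (sec f + sec g)"
  unfolding sec_def lookup_add single_add sum.distrib[symmetric]
  by (intro congT_sum congT_left) (auto simp: factor)

lemma sec_0: "congT (sec 0) 0"
proof -
  have "congT (sec 0) (\<Sum>z\<in>J_class M N K m. 0)"
    unfolding sec_def by (intro congT_sum) (auto intro!: congT_left_zero simp: factor)
  then show ?thesis by simp
qed

lemma sec_diff: "congT (sec (f - g)) (sec f - sec g)"
  using congT_sym[OF congT_diff[OF sec_add[of "f - g" g] congT_refl[of "sec g"]]] by simp

lemma sec_sum: "congT (sec (\<Sum>i\<in>I. f i)) (\<Sum>i\<in>I. sec (f i))"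
proof (induction I rule: infinite_finite_induct)
  case (insert i I)
  have "congT (sec (f i + (\<Sum>i\<in>I. f i))) (sec (f i) + sec (\<Sum>i\<in>I. f i))" by (rule sec_add)
  also have "congT \<dots> (sec (f i) + (\<Sum>i\<in>I. sec (f i)))"
    by (rule congT_add[OF congT_refl insert(3)])
  finally show ?case using insert(1,2) by simp
qed (auto simp: sec_0)

lemma sec_single:
  assumes z: "z \<in> J_class M N K m"
  shows "congT (sec (Poly_Mapping.single z c)) (frag_of (Poly_Mapping.single (fst (factor z)) c, basis_vec (snd (factor z))))"
proof -
  let ?u = "frag_of (Poly_Mapping.single (fst (factor z)) c, basis_vec (snd (factor z)))"
  have "congT (sec (Poly_Mapping.single z c)) (\<Sum>u\<in>J_class M N K m. if u = z then ?u else 0)"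
    unfolding sec_def
  proof (rule congT_sum)
    fix u assume u: "u \<in> J_class M N K m"
    show "congT (frag_of (Poly_Mapping.single (fst (factor u)) (Poly_Mapping.lookup (Poly_Mapping.single z c) u),
        basis_vec (snd (factor u)))) (if u = z then ?u else 0)"
      using u by (auto simp: lookup_single factor intro!: congT_refl congT_left_zero)
  qed
  then show ?thesis using z finite_classes(4) by simp
qed

text \<open>Normal form modulo the relations: an element is determined by its evaluation. This is
  the inclusion of the kernel in the relation subgroup. For a single generator, both entries are
  expanded into basis vectors and each resulting tensor is moved to the chosen factorization of its
  product.\<close>

lemma congT_sec:
  assumes "Poly_Mapping.keys c \<subseteq> pairs m"
  shows "congT c (sec (tensor_eval m c))"
  using assms
proof (induction c rule: frag_induction)
  case zero
  show ?case using congT_sym[OF sec_0] by simp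
next
  case (diff a b)
  show ?case unfolding tensor_eval_diff
    by (rule congT_trans[OF congT_diff[OF diff] congT_sym[OF sec_diff]])
next
  case (one p)
  obtain v w where p: "p = (v, w)" by fastforce
  with one have v: "Poly_Mapping.keys v \<subseteq> L_class M N m" and w: "Poly_Mapping.keys w \<subseteq> R_class M K m" by auto
  let ?L = "L_class M N m" and ?R = "R_class M K m" and ?l = Poly_Mapping.lookup
  let ?v = "\<lambda>x. Poly_Mapping.single x (?l v x)" and ?w = "\<lambda>y. Poly_Mapping.single y (?l w y)"
  note vs = sum_single_lookup[OF finite_classes(1) v] and ws = sum_single_lookup[OF finite_classes(2) w]
  have "congT (frag_of (\<Sum>x\<in>?L. ?v x, w)) (\<Sum>x\<in>?L. frag_of (?v x, w))"
    by (rule congT_left_sum[OF _ w]) auto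
  then have "congT (frag_of (v, w)) (\<Sum>x\<in>?L. frag_of (?v x, w))" unfolding vs .
  also have "congT (\<Sum>x\<in>?L. frag_of (?v x, w)) (\<Sum>x\<in>?L. \<Sum>y\<in>?R. frag_of (?v x, ?w y))"
  proof (rule congT_sum)
    fix x assume "x \<in> ?L"
    then have "congT (frag_of (?v x, \<Sum>y\<in>?R. ?w y)) (\<Sum>y\<in>?R. frag_of (?v x, ?w y))"
      by (intro congT_right_sum) auto
    then show "congT (frag_of (?v x, w)) (\<Sum>y\<in>?R. frag_of (?v x, ?w y))" unfolding ws .
  qed
  also have "congT \<dots> (\<Sum>x\<in>?L. \<Sum>y\<in>?R. sec (circ_lin m (?v x) (?w y)))"
  proof (intro congT_sum)
    fix x y assume xy: "x \<in> ?L" "y \<in> ?R"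
    note J = circ_J[OF m xy]
    have "congT (frag_of (?v x, ?w y)) (frag_of (Poly_Mapping.single (fst (factor (circ M N K m x y)))
        (?l v x * ?l w y), basis_vec (snd (factor (circ M N K m x y)))))"
      by (rule congT_single) (use xy factor[OF J] in auto)
    also have "congT \<dots> (sec (circ_lin m (?v x) (?w y)))"
      unfolding circ_lin_single by (rule congT_sym[OF sec_single[OF J]])
    finally show "congT (frag_of (?v x, ?w y)) (sec (circ_lin m (?v x) (?w y)))" .
  qed
  also have "congT \<dots> (\<Sum>x\<in>?L. sec (\<Sum>y\<in>?R. circ_lin m (?v x) (?w y)))"
    by (intro congT_sum congT_sym[OF sec_sum])
  also have "congT \<dots> (sec (\<Sum>x\<in>?L. \<Sum>y\<in>?R. circ_lin m (?v x) (?w y)))"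
    by (rule congT_sym[OF sec_sum])
  also have "(\<Sum>x\<in>?L. \<Sum>y\<in>?R. circ_lin m (?v x) (?w y)) = circ_lin m v w"
    unfolding clinear_sum[OF clinear_bilin2, symmetric] clinear_sum[OF clinear_bilin1, symmetric] ws
    by (simp only: clinear_sum[OF clinear_bilin1, symmetric] vs)
  finally show ?case by (simp add: p)
qed

text \<open>Hence evaluation identifies the tensor product with C[J]: it kills all relations, and an
  element evaluating to zero is congruent to the normal form of zero.\<close>

lemma T_eq_kernel: "T = tensor_fibre m 0"
proof (intro equalityI subsetI)
  fix c assume "c \<in> T"
  then show "c \<in> tensor_fibre m 0" by (simp add: tensor_fibre_def T_subset tensor_eval_T)
next
  fix c assume "c \<in> tensor_fibre m 0"
  then have "congT c (sec 0)" using congT_sec[of c] by (simp add: tensor_fibre_def)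
  then have "congT c 0" using sec_0 by (rule congT_trans)
  then show "c \<in> T" by (simp add: congT_def)
qed

lemma coset_eq_fibre:
  assumes c: "Poly_Mapping.keys c \<subseteq> pairs m"
  shows "T #>\<^bsub>F\<^esub> c = tensor_fibre m (tensor_eval m c)"
proof (intro equalityI subsetI)
  fix d assume "d \<in> T #>\<^bsub>F\<^esub> c"
  then obtain t where t: "t \<in> T" "d = t + c" by (auto simp: r_coset_def)
  then show "d \<in> tensor_fibre m (tensor_eval m c)"
    using keys_add_subset[OF T_subset[OF t(1)] c] by (simp add: tensor_fibre_def tensor_eval_add tensor_eval_T)
next
  fix d assume d: "d \<in> tensor_fibre m (tensor_eval m c)"
  then have "d - c \<in> T"
    unfolding T_eq_kernel using keys_diff_subset[OF _ c, of d] by (simp add: tensor_fibre_def tensor_eval_diff)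
  moreover have "d = (d - c) + c" by simp
  ultimately show "d \<in> T #>\<^bsub>F\<^esub> c" unfolding r_coset_def by force
qed

abbreviation (input) CJ :: "('a \<Rightarrow>\<^sub>0 complex) set" where "CJ \<equiv> {f. Poly_Mapping.keys f \<subseteq> J_class M N K m}"

lemma sec_in_fibre: "f \<in> CJ \<Longrightarrow> sec f \<in> tensor_fibre m f"
  by (simp add: tensor_fibre_def sec_keys tensor_eval_sec)

lemma inj_on_tensor_fibre: "inj_on (tensor_fibre m) CJ"
proof (rule inj_onI)
  fix f g assume fg: "f \<in> CJ" "g \<in> CJ" "tensor_fibre m f = tensor_fibre m g"
  then have "sec f \<in> tensor_fibre m f" "sec f \<in> tensor_fibre m g" using sec_in_fibre[of f] by simp_all
  then show "f = g" by (simp add: tensor_fibre_def)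
qed

lemma tens_carrier: "carrier (tens m) = tensor_fibre m ` CJ"
proof -
  have "carrier (tens m) = (\<lambda>c. tensor_fibre m (tensor_eval m c)) ` {c. Poly_Mapping.keys c \<subseteq> pairs m}"
    by (auto simp: tens_simps RCOSETS_def carrier_free_Abelian_group_iff coset_eq_fibre)
  also have "\<dots> = tensor_fibre m ` CJ"
  proof (intro equalityI subsetI)
    fix C assume "C \<in> tensor_fibre m ` CJ"
    then obtain f where f: "f \<in> CJ" "C = tensor_fibre m f" by blast
    then have "C = tensor_fibre m (tensor_eval m (sec f))" by (simp add: tensor_eval_sec)
    then show "C \<in> (\<lambda>c. tensor_fibre m (tensor_eval m c)) ` {c. Poly_Mapping.keys c \<subseteq> pairs m}"
      using sec_keys by blast
  qed (use tensor_eval_keys in blast)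
  finally show ?thesis .
qed

lemma tens_mult:
  assumes "f \<in> CJ" "g \<in> CJ"
  shows "tensor_fibre m f \<otimes>\<^bsub>tens m\<^esub> tensor_fibre m g = tensor_fibre m (f + g)"
proof (intro equalityI subsetI)
  fix c assume "c \<in> tensor_fibre m f \<otimes>\<^bsub>tens m\<^esub> tensor_fibre m g"
  then obtain a b where "a \<in> tensor_fibre m f" "b \<in> tensor_fibre m g" "c = a + b"
    by (auto simp: tens_simps set_mult_def)
  then show "c \<in> tensor_fibre m (f + g)"
    using keys_add_subset[of a "pairs m" b] by (simp add: tensor_fibre_def tensor_eval_add)
next
  fix c assume "c \<in> tensor_fibre m (f + g)"
  then have "c - sec g \<in> tensor_fibre m f"
    using keys_diff_subset[OF _ sec_keys, of c g] assms by (simp add: tensor_fibre_def tensor_eval_diff tensor_eval_sec)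
  moreover have "c = (c - sec g) + sec g" by simp
  ultimately show "c \<in> tensor_fibre m f \<otimes>\<^bsub>tens m\<^esub> tensor_fibre m g"
    using sec_in_fibre[OF assms(2)] unfolding tens_simps set_mult_def by force
qed

lemma tens_one: "\<one>\<^bsub>tens m\<^esub> = tensor_fibre m 0"
  by (simp add: tens_simps T_eq_kernel)

text \<open>Transported from addition on C[J] along the fibres; the description of the carrier of
  the direct sum asks for groups as summands.\<close>

lemma group_tens: "group (tens m)"
proof (rule groupI)
  fix C assume "C \<in> carrier (tens m)"
  then obtain f where f: "f \<in> CJ" "C = tensor_fibre m f" by (auto simp: tens_carrier)
  then have "- f \<in> CJ" by simp
  with f show "\<exists>D\<in>carrier (tens m). D \<otimes>\<^bsub>tens m\<^esub> C = \<one>\<^bsub>tens m\<^esub>"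
    by (intro bexI[of _ "tensor_fibre m (- f)"]) (simp add: tens_mult tens_one, simp add: tens_carrier)
qed (auto simp: tens_carrier tens_mult tens_one keys_add_subset add.assoc)

text \<open>On basis vectors the condition for a nonzero result is membership in \<open>L\<close> on
  one side and equality of double ideals on the other; \<open>L_class_mult_iff\<close> shows that
  they agree.\<close>

lemma circ_lin_lact:
  assumes a: "Poly_Mapping.keys a \<subseteq> N" and v: "Poly_Mapping.keys v \<subseteq> L_class M N m"
    and w: "Poly_Mapping.keys w \<subseteq> R_class M K m"
  shows "circ_lin m (lact (L_bimod M N K m) a v) w = bilin gr_left a (circ_lin m v w)"
  unfolding L_bimod_simps
proof (rule clinear_ext[OF clinear_compose[OF clinear_bilin1 clinear_bilin1] clinear_bilin1 _ a])
  fix n assume n: "n \<in> N"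
  let ?l = "bilin (\<lambda>n x. if n \<otimes> x \<in> L_class M N m then basis_vec (n \<otimes> x) else 0)"
  show "circ_lin m (?l (basis_vec n) v) w = bilin gr_left (basis_vec n) (circ_lin m v w)"
  proof (rule clinear_ext[OF clinear_compose[OF clinear_bilin1 clinear_bilin2]
        clinear_compose[OF clinear_bilin2 clinear_bilin1] _ v])
    fix x assume x: "x \<in> L_class M N m"
    show "circ_lin m (?l (basis_vec n) (basis_vec x)) w = bilin gr_left (basis_vec n) (circ_lin m (basis_vec x) w)"
    proof (rule clinear_ext[OF clinear_bilin2 clinear_compose[OF clinear_bilin2 clinear_bilin2] _ w])
      fix y assume y: "y \<in> R_class M K m"
      note J = circ_J[OF m x y]
      have "n \<otimes> circ M N K m x y \<in> carrier M" using J n by (auto simp: J_class_def)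
      then have "n \<otimes> x \<in> L_class M N m \<longleftrightarrow> ideal (n \<otimes> circ M N K m x y) = ideal (circ M N K m x y)"
        using L_class_mult_iff(1)[OF m x y n] J by (auto simp: J_class_def)
      then show "circ_lin m (?l (basis_vec n) (basis_vec x)) (basis_vec y) =
          bilin gr_left (basis_vec n) (circ_lin m (basis_vec x) (basis_vec y))"
        using L_class_mult_iff(2)[OF m x y n] by (simp add: gr_left_def clinear_zero[OF clinear_bilin1])
    qed
  qed
qed

lemma circ_lin_ract:
  assumes b: "Poly_Mapping.keys b \<subseteq> K" and v: "Poly_Mapping.keys v \<subseteq> L_class M N m"
    and w: "Poly_Mapping.keys w \<subseteq> R_class M K m"
  shows "circ_lin m v (ract (R_bimod M N K m) w b) = bilin gr_right (circ_lin m v w) b"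
  unfolding R_bimod_simps
proof (rule clinear_ext[OF clinear_compose[OF clinear_bilin2 clinear_bilin2] clinear_bilin2 _ b])
  fix k assume k: "k \<in> K"
  let ?r = "bilin (\<lambda>y k. if y \<otimes> k \<in> R_class M K m then basis_vec (y \<otimes> k) else 0)"
  show "circ_lin m v (?r w (basis_vec k)) = bilin gr_right (circ_lin m v w) (basis_vec k)"
  proof (rule clinear_ext[OF clinear_bilin1
        clinear_compose[OF clinear_bilin1 clinear_bilin1] _ v])
    fix x assume x: "x \<in> L_class M N m"
    show "circ_lin m (basis_vec x) (?r w (basis_vec k)) = bilin gr_right (circ_lin m (basis_vec x) w) (basis_vec k)"
    proof (rule clinear_ext[OF clinear_compose[OF clinear_bilin2 clinear_bilin1]
          clinear_compose[OF clinear_bilin1 clinear_bilin2] _ w])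
      fix y assume y: "y \<in> R_class M K m"
      note J = circ_J[OF m x y]
      have "circ M N K m x y \<otimes> k \<in> carrier M" using J k by (auto simp: J_class_def)
      then have "y \<otimes> k \<in> R_class M K m \<longleftrightarrow> ideal (circ M N K m x y \<otimes> k) = ideal (circ M N K m x y)"
        using R_class_mult_iff(1)[OF m x y k] J by (auto simp: J_class_def)
      then show "circ_lin m (basis_vec x) (?r (basis_vec y) (basis_vec k)) =
          bilin gr_right (circ_lin m (basis_vec x) (basis_vec y)) (basis_vec k)"
        using R_class_mult_iff(2)[OF m x y k] by (simp add: gr_right_def clinear_zero[OF clinear_bilin2])
    qed
  qed
qed

text \<open>The outer actions on the tensor product are unions of cosets over all representatives.
  If the map \<open>h\<close> on pairs induces \<open>G\<close> on evaluations, all these cosets are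
  the same fibre, and since \<open>sec f\<close> provides a representative the union is exactly this
  fibre.\<close>

lemma UN_coset_frag_extend:
  assumes h: "\<And>p. p \<in> pairs m \<Longrightarrow> h p \<in> pairs m" and G: "clinear G"
    and eval: "\<And>p. p \<in> pairs m \<Longrightarrow> circ_lin m (fst (h p)) (snd (h p)) = G (circ_lin m (fst p) (snd p))"
    and f: "f \<in> CJ"
  shows "(\<Union>c\<in>tensor_fibre m f. T #>\<^bsub>F\<^esub> frag_extend (\<lambda>p. frag_of (h p)) c) = tensor_fibre m (G f)"
proof -
  have ev: "tensor_eval m (frag_extend (\<lambda>p. frag_of (h p)) c) = G (tensor_eval m c)"
    if "Poly_Mapping.keys c \<subseteq> pairs m" for c
    using that
  proof (induction c rule: frag_induction)
    case zero
    then show ?case by (simp add: clinear_zero[OF G])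
  next
    case (one p)
    then show ?case using eval[of p] by simp
  next
    case (diff a b)
    then show ?case by (simp add: frag_extend_diff tensor_eval_diff clinear_diff[OF G])
  qed
  have "T #>\<^bsub>F\<^esub> frag_extend (\<lambda>p. frag_of (h p)) c = tensor_fibre m (G f)" if c: "c \<in> tensor_fibre m f" for c
  proof -
    have k: "Poly_Mapping.keys c \<subseteq> pairs m" using c by (simp add: tensor_fibre_def)
    have "Poly_Mapping.keys (frag_extend (\<lambda>p. frag_of (h p)) c) \<subseteq> pairs m"
    proof
      fix q assume "q \<in> Poly_Mapping.keys (frag_extend (\<lambda>p. frag_of (h p)) c)"
      then obtain p where "p \<in> Poly_Mapping.keys c" "q = h p"
        using keys_frag_extend[of "\<lambda>p. frag_of (h p)" c] by auto
      then show "q \<in> pairs m" using h k by blast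
    qed
    from coset_eq_fibre[OF this] show ?thesis using ev[OF k] c by (simp add: tensor_fibre_def)
  qed
  then show ?thesis using sec_in_fibre[OF f] by blast
qed

lemma tens_lact:
  assumes a: "Poly_Mapping.keys a \<subseteq> N" and f: "f \<in> CJ"
  shows "lact (tens m) a (tensor_fibre m f) = tensor_fibre m (bilin gr_left a f)"
proof -
  define h where "h p = (lact (L_bimod M N K m) a (fst p), snd p)" for p :: "('a \<Rightarrow>\<^sub>0 complex) \<times> ('a \<Rightarrow>\<^sub>0 complex)"
  have "Poly_Mapping.keys (lact (L_bimod M N K m) a v) \<subseteq> L_class M N m" for v
    unfolding L_bimod_simps by (rule keys_bilin) auto
  then have "h p \<in> pairs m" if "p \<in> pairs m" for p using that by (auto simp: h_def)
  moreover have "circ_lin m (fst (h p)) (snd (h p)) = bilin gr_left a (circ_lin m (fst p) (snd p))"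
    if "p \<in> pairs m" for p using that by (auto simp: h_def circ_lin_lact[OF a])
  ultimately show ?thesis
    using UN_coset_frag_extend[OF _ clinear_bilin2 _ f, of h gr_left a]
    by (simp add: tens_simps h_def case_prod_unfold)
qed

lemma tens_ract:
  assumes b: "Poly_Mapping.keys b \<subseteq> K" and f: "f \<in> CJ"
  shows "ract (tens m) (tensor_fibre m f) b = tensor_fibre m (bilin gr_right f b)"
proof -
  define h where "h p = (fst p, ract (R_bimod M N K m) (snd p) b)" for p :: "('a \<Rightarrow>\<^sub>0 complex) \<times> ('a \<Rightarrow>\<^sub>0 complex)"
  have "Poly_Mapping.keys (ract (R_bimod M N K m) w b) \<subseteq> R_class M K m" for w
    unfolding R_bimod_simps by (rule keys_bilin) auto
  then have "h p \<in> pairs m" if "p \<in> pairs m" for p using that by (auto simp: h_def)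
  moreover have "circ_lin m (fst (h p)) (snd (h p)) = bilin gr_right (circ_lin m (fst p) (snd p)) b"
    if "p \<in> pairs m" for p using that by (auto simp: h_def circ_lin_ract[OF b])
  ultimately show ?thesis
    using UN_coset_frag_extend[OF _ clinear_bilin1 _ f, of h gr_right b]
    by (simp add: tens_simps h_def case_prod_unfold)
qed

end

end

section \<open>The decomposition\<close>

context finite_submonoid_pair begin

lemma complete_reps_J:
  assumes \<Delta>: "complete_reps (carrier M // LR_rel M N K) \<Delta>"
  shows "\<Delta> \<subseteq> carrier M" "disjoint_family_on (J_class M N K) \<Delta>"
    "carrier M = (\<Union>m\<in>\<Delta>. J_class M N K m)"
proof -
  have cls: "LR_rel M N K `` {z} = J_class M N K z" if "z \<in> carrier M" for z
    using that by (auto simp: LR_rel_def J_class_def)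
  then have Q: "carrier M // LR_rel M N K = J_class M N K ` carrier M"
    by (auto simp: quotient_def)
  show sub: "\<Delta> \<subseteq> carrier M"
    using \<Delta> J_class_carrier unfolding complete_reps_def Q by blast
  show "disjoint_family_on (J_class M N K) \<Delta>"
    unfolding disjoint_family_on_def
  proof (intro ballI impI)
    fix m m' assume mm: "m \<in> \<Delta>" "m' \<in> \<Delta>" "m \<noteq> m'"
    show "J_class M N K m \<inter> J_class M N K m' = {}"
    proof (rule ccontr)
      assume "J_class M N K m \<inter> J_class M N K m' \<noteq> {}"
      then have "m' \<in> J_class M N K m" using sub mm by (auto simp: J_class_def)
      moreover have "m \<in> J_class M N K m" using self_in_classes sub mm by blast
      moreover have "\<exists>!x. x \<in> \<Delta> \<and> x \<in> J_class M N K m"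
        using \<Delta> sub mm unfolding complete_reps_def Q by blast
      ultimately show False using mm by blast
    qed
  qed
  have "z \<in> (\<Union>m\<in>\<Delta>. J_class M N K m)" if z: "z \<in> carrier M" for z
  proof -
    obtain m where "m \<in> \<Delta>" "m \<in> J_class M N K z"
      using \<Delta> z unfolding complete_reps_def Q by blast
    then show ?thesis using z by (auto simp: J_class_def)
  qed
  then show "carrier M = (\<Union>m\<in>\<Delta>. J_class M N K m)" using J_class_carrier by blast
qed

text \<open>The generated equivalence is equality of \<open>\<circ>\<close>-products: every step
  preserves the product, and two pairs with equal product are related by a single step.\<close>

lemma set_tensor_fibres:
  assumes m: "m \<in> carrier M"
  shows "inj_on (tensor_incl M N K m) (set_tensor M N K m)"
    "tensor_incl M N K m ` set_tensor M N K m = J_class M N K m"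
proof -
  let ?P = "L_class M N m \<times> R_class M K m" and ?c = "\<lambda>p. circ M N K m (fst p) (snd p)"
  have equiv_iff: "(p, q) \<in> tensor_equiv M N K m \<longleftrightarrow> p \<in> ?P \<and> q \<in> ?P \<and> ?c p = ?c q" for p q
  proof
    assume "(p, q) \<in> tensor_equiv M N K m"
    then show "p \<in> ?P \<and> q \<in> ?P \<and> ?c p = ?c q"
      using congruentD[OF circ_respects_tensor_equiv[OF monoid_axioms N.submonoid_axioms K.submonoid_axioms m], of p q]
      by (auto simp: tensor_equiv_def case_prod_unfold)
  next
    assume pq: "p \<in> ?P \<and> q \<in> ?P \<and> ?c p = ?c q"
    obtain x y x' y' where xy: "p = (x, y)" "q = (x', y')" by fastforce
    with pq obtain h where h: "h \<in> H_class M N K m" "x' = circ M N K m x h" "y = circ M N K m h y'"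
      using circ_eq_imp_H[OF m, of x x' y y'] by auto
    \<comment> \<open>The step runs from \<open>q = (x \<circ> h, y')\<close> to
      \<open>p = (x, h \<circ> y')\<close>; the symmetric closure supplies the converse
      direction.\<close>
    with pq xy have "(q, p) \<in> tensor_step M N K m" unfolding tensor_step_def by blast
    with pq show "(p, q) \<in> tensor_equiv M N K m" by (auto simp: tensor_equiv_def)
  qed
  have cls: "tensor_equiv M N K m `` {p} = {q \<in> ?P. ?c q = ?c p}" if "p \<in> ?P" for p
    using that by (auto simp: equiv_iff)
  have incl: "tensor_incl M N K m (tensor_equiv M N K m `` {p}) = ?c p" if "p \<in> ?P" for p
  proof -
    have "(\<lambda>(x, y). circ M N K m x y) ` {q \<in> ?P. ?c q = ?c p} = {?c p}" using that by force
    then show ?thesis unfolding tensor_incl_def cls[OF that] by simp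
  qed
  have st: "set_tensor M N K m = (\<lambda>p. tensor_equiv M N K m `` {p}) ` ?P"
    by (auto simp: set_tensor_def quotient_def)
  show "inj_on (tensor_incl M N K m) (set_tensor M N K m)"
  proof (rule inj_onI)
    fix C D assume "C \<in> set_tensor M N K m" "D \<in> set_tensor M N K m"
      and eq: "tensor_incl M N K m C = tensor_incl M N K m D"
    then obtain p q where pq: "p \<in> ?P" "q \<in> ?P" "C = tensor_equiv M N K m `` {p}" "D = tensor_equiv M N K m `` {q}"
      unfolding st by blast
    then show "C = D" using eq incl[OF pq(1)] incl[OF pq(2)] cls[OF pq(1)] cls[OF pq(2)] by simp
  qed
  show "tensor_incl M N K m ` set_tensor M N K m = J_class M N K m"
    unfolding st image_image J_class_eq_circ[OF m] using incl by (intro image_cong) auto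
qed

text \<open>The form in which representatives are used: every element lies in the orbit of a
  representative, and two representatives related by \<open>H\<close> coincide.\<close>

lemma L_reps:
  assumes m: "m \<in> carrier M" and A: "complete_reps (L_orbits M N K m) A"
  shows "A \<subseteq> L_class M N m"
    "x \<in> L_class M N m \<Longrightarrow> \<exists>x'\<in>A. \<exists>h\<in>H_class M N K m. x = circ M N K m x' h"
    "x \<in> A \<Longrightarrow> x' \<in> A \<Longrightarrow> h \<in> H_class M N K m \<Longrightarrow> x' = circ M N K m x h \<Longrightarrow> x = x'"
proof -
  note c = A[unfolded complete_reps_def L_orbits_def]
  show sub: "A \<subseteq> L_class M N m" using c circ_L_closed[OF m] by auto
  show "\<exists>x'\<in>A. \<exists>h\<in>H_class M N K m. x = circ M N K m x' h" if x: "x \<in> L_class M N m"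
  proof -
    obtain x' where x': "x' \<in> A" "x' \<in> circ M N K m x ` H_class M N K m" using c x by blast
    then obtain h where h: "h \<in> H_class M N K m" "x' = circ M N K m x h" by blast
    \<comment> \<open>The representative is \<open>x' = x \<circ> h\<close>, but \<open>x\<close> is
      wanted in terms of \<open>x'\<close>. Writing this as
      \<open>x' \<circ> m = x \<circ> h\<close> lets \<open>circ_eq_imp_H\<close> produce the
      element of \<open>H\<close> that leads back.\<close>
    have "circ M N K m x' m = circ M N K m x h" using circ_one(1)[OF m] sub x' h by auto
    then show ?thesis
      using circ_eq_imp_H[OF m _ x self_in_classes(2)[OF m] H_classD(2)[OF h(1)], of x'] sub x'(1) by blast
  qed
  show "x = x'" if xx: "x \<in> A" "x' \<in> A" "h \<in> H_class M N K m" "x' = circ M N K m x h" for h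
  proof -
    have xL: "x \<in> L_class M N m" using sub xx by blast
    have "\<exists>!u. u \<in> A \<and> u \<in> circ M N K m x ` H_class M N K m"
      by (rule bspec[OF conjunct2[OF c] imageI[OF xL]])
    moreover have "x = circ M N K m x m" using circ_one(1)[OF m xL] by simp
    then have "x \<in> circ M N K m x ` H_class M N K m" using self_in_classes(3)[OF m] by (rule image_eqI)
    ultimately show ?thesis using xx by blast
  qed
qed

lemma R_reps:
  assumes m: "m \<in> carrier M" and B: "complete_reps (R_orbits M N K m) B"
  shows "B \<subseteq> R_class M K m"
    "y \<in> R_class M K m \<Longrightarrow> \<exists>y'\<in>B. \<exists>h\<in>H_class M N K m. y = circ M N K m h y'"
    "y \<in> B \<Longrightarrow> y' \<in> B \<Longrightarrow> h \<in> H_class M N K m \<Longrightarrow> y' = circ M N K m h y \<Longrightarrow> y = y'"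
proof -
  note c = B[unfolded complete_reps_def R_orbits_def]
  show sub: "B \<subseteq> R_class M K m" using c circ_R_closed[OF m] by auto
  show "\<exists>y'\<in>B. \<exists>h\<in>H_class M N K m. y = circ M N K m h y'" if y: "y \<in> R_class M K m"
  proof -
    obtain y' where y': "y' \<in> B" "y' \<in> (\<lambda>h. circ M N K m h y) ` H_class M N K m" using c y by blast
    then obtain h where h: "h \<in> H_class M N K m" "y' = circ M N K m h y" by blast
    have "circ M N K m h y = circ M N K m m y'" using circ_one(2)[OF m] sub y' h by auto
    then show ?thesis
      using circ_eq_imp_H[OF m H_classD(1)[OF h(1)] self_in_classes(1)[OF m] y, of y'] sub y'(1) by blast
  qed
  show "y = y'" if yy: "y \<in> B" "y' \<in> B" "h \<in> H_class M N K m" "y' = circ M N K m h y" for h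
  proof -
    have yR: "y \<in> R_class M K m" using sub yy by blast
    have "\<exists>!u. u \<in> B \<and> u \<in> (\<lambda>h. circ M N K m h y) ` H_class M N K m"
      by (rule bspec[OF conjunct2[OF c] imageI[OF yR]])
    moreover have "y = circ M N K m m y" using circ_one(2)[OF m yR] by simp
    then have "y \<in> (\<lambda>h. circ M N K m h y) ` H_class M N K m" using self_in_classes(3)[OF m] by (rule image_eqI)
    ultimately show ?thesis using yy by blast
  qed
qed

text \<open>For existence, the two \<open>H\<close>-parts of the factors of \<open>z\<close> merge
  into one by associativity. For uniqueness, \<open>circ_eq_imp_H\<close> shows that the
  representatives lie in common orbits.\<close>

lemma J_class_double_cosets:
  assumes m: "m \<in> carrier M" and A: "complete_reps (L_orbits M N K m) A"
    and B: "complete_reps (R_orbits M N K m) B"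
  shows "J_class M N K m =
      (\<Union>x\<in>A. \<Union>y\<in>B. {circ M N K m (circ M N K m x h) y | h. h \<in> H_class M N K m})"
    "\<lbrakk>x \<in> A; x' \<in> A; y \<in> B; y' \<in> B; h \<in> H_class M N K m; h' \<in> H_class M N K m;
      circ M N K m (circ M N K m x h) y = circ M N K m (circ M N K m x' h') y'\<rbrakk> \<Longrightarrow> x = x' \<and> y = y'"
proof -
  note XL = L_reps[OF m A] and YR = R_reps[OF m B]
  show "J_class M N K m =
      (\<Union>x\<in>A. \<Union>y\<in>B. {circ M N K m (circ M N K m x h) y | h. h \<in> H_class M N K m})"
  proof (intro equalityI subsetI)
    fix z assume "z \<in> J_class M N K m"
    then obtain u v where uv: "u \<in> L_class M N m" "v \<in> R_class M K m" "z = circ M N K m u v"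
      unfolding J_class_eq_circ[OF m] by auto
    obtain x h where x: "x \<in> A" "h \<in> H_class M N K m" "u = circ M N K m x h" using XL(2)[OF uv(1)] by blast
    obtain y h' where y: "y \<in> B" "h' \<in> H_class M N K m" "v = circ M N K m h' y" using YR(2)[OF uv(2)] by blast
    have xy: "x \<in> L_class M N m" "y \<in> R_class M K m" using x y XL(1) YR(1) by blast+
    have "z = circ M N K m (circ M N K m (circ M N K m x h) h') y"
      using circ_assoc[OF m _ y(2) xy(2), of u] uv x(3) y(3) by simp
    also have "\<dots> = circ M N K m (circ M N K m x (circ M N K m h h')) y"
      using circ_assoc[OF m xy(1) x(2) H_classD(2)[OF y(2)]] by simp
    finally show "z \<in> (\<Union>x\<in>A. \<Union>y\<in>B. {circ M N K m (circ M N K m x h) y | h. h \<in> H_class M N K m})"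
      using x(1) y(1) circ_H_closed[OF m x(2) y(2)] by blast
  next
    fix z assume "z \<in> (\<Union>x\<in>A. \<Union>y\<in>B. {circ M N K m (circ M N K m x h) y | h. h \<in> H_class M N K m})"
    then show "z \<in> J_class M N K m"
      using circ_J[OF m circ_L_closed[OF m]] XL(1) YR(1) by blast
  qed
  show "x = x' \<and> y = y'"
    if "x \<in> A" "x' \<in> A" "y \<in> B" "y' \<in> B" and h: "h \<in> H_class M N K m" "h' \<in> H_class M N K m"
      and eq: "circ M N K m (circ M N K m x h) y = circ M N K m (circ M N K m x' h') y'" for h h'
  proof -
    have cls: "x \<in> L_class M N m" "x' \<in> L_class M N m" "y \<in> R_class M K m" "y' \<in> R_class M K m"
      using that XL(1) YR(1) by blast+
    \<comment> \<open>Regrouping one side isolates \<open>x\<close>: a first application of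
      \<open>circ_eq_imp_H\<close> puts \<open>x' \<circ> h'\<close> into the orbit of
      \<open>x\<close>, and a second one removes \<open>h'\<close>, giving \<open>x\<close> in the
      orbit of \<open>x'\<close>.\<close>
    have "circ M N K m x (circ M N K m h y) = circ M N K m (circ M N K m x' h') y'"
      using eq circ_assoc[OF m cls(1) h(1) cls(3)] by simp
    then obtain k where k: "k \<in> H_class M N K m" "circ M N K m x' h' = circ M N K m x k"
      using circ_eq_imp_H[OF m cls(1) circ_L_closed[OF m cls(2) h(2)] circ_R_closed[OF m h(1) cls(3)] cls(4)] by blast
    then obtain l where "l \<in> H_class M N K m" "x = circ M N K m x' l"
      using circ_eq_imp_H[OF m cls(2,1) H_classD(2)[OF h(2)] H_classD(2)[OF k(1)]] by blast
    then have "x' = x" using XL(3)[of x' x] that by blast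
    have "circ M N K m (circ M N K m x h) y = circ M N K m x' (circ M N K m h' y')"
      using eq circ_assoc[OF m cls(2) h(2) cls(4)] by simp
    then obtain k where k: "k \<in> H_class M N K m" "y = circ M N K m k (circ M N K m h' y')"
      using circ_eq_imp_H[OF m circ_L_closed[OF m cls(1) h(1)] cls(2,3) circ_R_closed[OF m h(2) cls(4)]] by blast
    then have "y = circ M N K m (circ M N K m k h') y'"
      using circ_assoc[OF m H_classD(1)[OF k(1)] h(2) cls(4)] by simp
    then have "y' = y" using YR(3)[of y' y] that circ_H_closed[OF m k(1) h(2)] by blast
    with \<open>x' = x\<close> show ?thesis by simp
  qed
qed

text \<open>The truncated action sends a basis element to zero or to one with the same double ideal,
  so it respects the decomposition of C[M] into the spaces C[J].\<close>

lemma restrict_pm_left: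
  assumes a: "Poly_Mapping.keys a \<subseteq> N" and f: "Poly_Mapping.keys f \<subseteq> carrier M"
  shows "restrict_pm (J_class M N K m) (bilin gr_left a f) = bilin gr_left a (restrict_pm (J_class M N K m) f)"
proof (rule clinear_ext[OF clinear_compose[OF clinear_restrict_pm clinear_bilin1] clinear_bilin1 _ a])
  fix n assume n: "n \<in> N"
  show "restrict_pm (J_class M N K m) (bilin gr_left (basis_vec n) f) =
      bilin gr_left (basis_vec n) (restrict_pm (J_class M N K m) f)"
    by (rule clinear_ext[OF clinear_compose[OF clinear_restrict_pm clinear_bilin2]
          clinear_compose[OF clinear_bilin2 clinear_restrict_pm] _ f])
      (use n in \<open>auto simp: gr_left_def restrict_pm_basis_vec J_class_def
          clinear_zero[OF clinear_restrict_pm] clinear_zero[OF clinear_bilin2]\<close>)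
qed

lemma restrict_pm_right:
  assumes b: "Poly_Mapping.keys b \<subseteq> K" and f: "Poly_Mapping.keys f \<subseteq> carrier M"
  shows "restrict_pm (J_class M N K m) (bilin gr_right f b) = bilin gr_right (restrict_pm (J_class M N K m) f) b"
proof (rule clinear_ext[OF clinear_compose[OF clinear_restrict_pm clinear_bilin2] clinear_bilin2 _ b])
  fix k assume k: "k \<in> K"
  show "restrict_pm (J_class M N K m) (bilin gr_right f (basis_vec k)) =
      bilin gr_right (restrict_pm (J_class M N K m) f) (basis_vec k)"
    by (rule clinear_ext[OF clinear_compose[OF clinear_restrict_pm clinear_bilin1]
          clinear_compose[OF clinear_bilin1 clinear_restrict_pm] _ f])
      (use k in \<open>auto simp: gr_right_def restrict_pm_basis_vec J_class_def
          clinear_zero[OF clinear_restrict_pm] clinear_zero[OF clinear_bilin1]\<close>)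
qed

text \<open>Since the index set is finite, the finitely supported families in
  \<open>sum_group\<close> are all extensional families.\<close>

lemma direct_sum_simps:
  assumes "\<Delta> \<subseteq> carrier M"
  shows "carrier (direct_sum_bimod \<Delta> tens) = (\<Pi>\<^sub>E m\<in>\<Delta>. tensor_fibre m ` {f. Poly_Mapping.keys f \<subseteq> J_class M N K m})"
    "monoid.mult (direct_sum_bimod \<Delta> tens) = (\<lambda>f g. \<lambda>m\<in>\<Delta>. f m \<otimes>\<^bsub>tens m\<^esub> g m)"
    "lact (direct_sum_bimod \<Delta> tens) = (\<lambda>a f. \<lambda>m\<in>\<Delta>. lact (tens m) a (f m))"
    "ract (direct_sum_bimod \<Delta> tens) = (\<lambda>f b. \<lambda>m\<in>\<Delta>. ract (tens m) (f m) b)"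
proof -
  have fin: "finite \<Delta>" using assms finite_carrier finite_subset by blast
  have "carrier (direct_sum_bimod \<Delta> tens) = carrier (sum_group \<Delta> tens)"
    by (simp add: direct_sum_bimod_def monoid.extend_def)
  also have "\<dots> = (\<Pi>\<^sub>E m\<in>\<Delta>. carrier (tens m))"
    using fin assms group_tens by (subst carrier_sum_group) auto
  also have "\<dots> = (\<Pi>\<^sub>E m\<in>\<Delta>. tensor_fibre m ` {f. Poly_Mapping.keys f \<subseteq> J_class M N K m})"
    using assms tens_carrier by (intro PiE_cong) blast
  finally show "carrier (direct_sum_bimod \<Delta> tens) = (\<Pi>\<^sub>E m\<in>\<Delta>. tensor_fibre m ` {f. Poly_Mapping.keys f \<subseteq> J_class M N K m})" .
  show "monoid.mult (direct_sum_bimod \<Delta> tens) = (\<lambda>f g. \<lambda>m\<in>\<Delta>. f m \<otimes>\<^bsub>tens m\<^esub> g m)"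
    "lact (direct_sum_bimod \<Delta> tens) = (\<lambda>a f. \<lambda>m\<in>\<Delta>. lact (tens m) a (f m))"
    "ract (direct_sum_bimod \<Delta> tens) = (\<lambda>f b. \<lambda>m\<in>\<Delta>. ract (tens m) (f m) b)"
    by (simp_all add: direct_sum_bimod_def monoid.extend_def)
qed

lemma regular_bimod_simps:
  "carrier (regular_bimod M) = {f. Poly_Mapping.keys f \<subseteq> carrier M}"
  "monoid.mult (regular_bimod M) = (+)"
  "lact (regular_bimod M) = bilin (\<lambda>n x. basis_vec (n \<otimes> x))"
  "ract (regular_bimod M) = bilin (\<lambda>x k. basis_vec (x \<otimes> k))"
  by (simp_all add: regular_bimod_def linear_bimod_def)

text \<open>The isomorphism is the composite of the averaged map \<open>\<phi>\<close> from the
  regular to the truncated actions and the map \<open>\<Psi>\<close> that splits C[M] along the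
  classes and reads each component as a tensor.\<close>

lemma regular_bimod_iso:
  assumes \<Delta>: "complete_reps (carrier M // LR_rel M N K) \<Delta>"
    and ssN: "semisimple_ring (monoid_algebra (M\<lparr>carrier := N\<rparr>))"
    and ssK: "semisimple_ring (monoid_algebra (M\<lparr>carrier := K\<rparr>))"
  shows "bimod_iso (monoid_algebra (M\<lparr>carrier := N\<rparr>)) (monoid_algebra (M\<lparr>carrier := K\<rparr>))
    (regular_bimod M) (direct_sum_bimod \<Delta> tens)"
proof -
  note sub = complete_reps_J(1)[OF \<Delta>] and disj = complete_reps_J(2)[OF \<Delta>] and cover = complete_reps_J(3)[OF \<Delta>]
  let ?C = "{f :: 'a \<Rightarrow>\<^sub>0 complex. Poly_Mapping.keys f \<subseteq> carrier M}"
  obtain \<phi> where lin: "clinear \<phi>" and bij: "bij_betw \<phi> ?C ?C"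
    and left: "\<And>a v. Poly_Mapping.keys a \<subseteq> N \<Longrightarrow> Poly_Mapping.keys v \<subseteq> carrier M \<Longrightarrow>
      \<phi> (bilin (\<lambda>n x. basis_vec (n \<otimes> x)) a v) = bilin gr_left a (\<phi> v)"
    and right: "\<And>v b. Poly_Mapping.keys b \<subseteq> K \<Longrightarrow> Poly_Mapping.keys v \<subseteq> carrier M \<Longrightarrow>
      \<phi> (bilin (\<lambda>x k. basis_vec (x \<otimes> k)) v b) = bilin gr_right (\<phi> v) b"
    using regular_iso_graded[OF ssN ssK] by blast
  have \<phi>C: "Poly_Mapping.keys (\<phi> v) \<subseteq> carrier M" if "Poly_Mapping.keys v \<subseteq> carrier M" for v
    using bij that by (auto simp: bij_betw_def)
  define \<Psi> where "\<Psi> f = (\<lambda>m\<in>\<Delta>. tensor_fibre m (restrict_pm (J_class M N K m) f))" for f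
  let ?P = "\<Pi>\<^sub>E m\<in>\<Delta>. tensor_fibre m ` {f. Poly_Mapping.keys f \<subseteq> J_class M N K m}"
  have rk: "restrict_pm (J_class M N K m) f \<in> {f. Poly_Mapping.keys f \<subseteq> J_class M N K m}" for m f
    by (simp add: restrict_pm_keys)
  have "bij_betw \<Psi> ?C ?P"
  proof (rule bij_betwI')
    fix f g assume fg: "f \<in> ?C" "g \<in> ?C"
    show "(\<Psi> f = \<Psi> g) = (f = g)"
    proof
      assume eq: "\<Psi> f = \<Psi> g"
      have res: "restrict_pm (J_class M N K m) f = restrict_pm (J_class M N K m) g" if "m \<in> \<Delta>" for m
        using fun_cong[OF eq, of m] that inj_onD[OF inj_on_tensor_fibre _ rk rk] sub by (auto simp: \<Psi>_def)
      show "f = g"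
      proof (rule poly_mapping_eqI)
        fix z
        show "Poly_Mapping.lookup f z = Poly_Mapping.lookup g z"
        proof (cases "z \<in> carrier M")
          case True
          then obtain m where m: "m \<in> \<Delta>" "z \<in> J_class M N K m" using cover by blast
          show ?thesis
            using arg_cong[OF res[OF m(1)], of "\<lambda>f. Poly_Mapping.lookup f z"] m(2) by (simp add: lookup_restrict_pm)
        qed (use fg in \<open>simp add: lookup_eq_0\<close>)
      qed
    qed simp
  next
    show "\<Psi> f \<in> ?P" for f using rk by (auto simp: \<Psi>_def)
  next
    fix c assume c: "c \<in> ?P"
    have "\<exists>f. Poly_Mapping.keys f \<subseteq> J_class M N K m \<and> c m = tensor_fibre m f" if "m \<in> \<Delta>" for m
      using PiE_mem[OF c that] by blast
    then obtain g where g: "\<And>m. m \<in> \<Delta> \<Longrightarrow> Poly_Mapping.keys (g m) \<subseteq> J_class M N K m \<and> c m = tensor_fibre m (g m)"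
      by metis
    \<comment> \<open>The components are glued by addition; disjointness of the classes ensures that
      projecting the sum to one class returns the component there.\<close>
    let ?f = "\<Sum>m\<in>\<Delta>. g m"
    have fin: "finite \<Delta>" using sub finite_carrier finite_subset by blast
    have "restrict_pm (J_class M N K m) ?f = g m" if m: "m \<in> \<Delta>" for m
    proof (rule poly_mapping_eqI)
      fix z
      have other: "Poly_Mapping.lookup (g m') z = 0" if "m' \<in> \<Delta>" "m' \<noteq> m" "z \<in> J_class M N K m" for m'
      proof -
        have "z \<notin> J_class M N K m'" using disj that m by (auto simp: disjoint_family_on_def)
        then show ?thesis using g[OF that(1)] by (intro lookup_eq_0[of _ "J_class M N K m'"]) simp_all
      qed
      show "Poly_Mapping.lookup (restrict_pm (J_class M N K m) ?f) z = Poly_Mapping.lookup (g m) z"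
      proof (cases "z \<in> J_class M N K m")
        case True
        have "(\<Sum>m'\<in>\<Delta>. Poly_Mapping.lookup (g m') z) = (\<Sum>m'\<in>{m}. Poly_Mapping.lookup (g m') z)"
          using fin m other True by (intro sum.mono_neutral_right) auto
        then show ?thesis using True by (simp add: lookup_restrict_pm lookup_sum)
      next
        case False
        then have "Poly_Mapping.lookup (g m) z = 0" using g[OF m] by (intro lookup_eq_0[of _ "J_class M N K m"]) simp_all
        with False show ?thesis by (simp add: lookup_restrict_pm)
      qed
    qed
    then have "\<Psi> ?f = c" using c g by (auto simp: \<Psi>_def fun_eq_iff PiE_iff extensional_def)
    moreover have "Poly_Mapping.keys ?f \<subseteq> carrier M"
      by (rule keys_sum_subset) (use g J_class_carrier in blast)
    then have "?f \<in> ?C" by simp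
    ultimately show "\<exists>f\<in>?C. c = \<Psi> f" by blast
  qed
  then have bij': "bij_betw (\<lambda>v. \<Psi> (\<phi> v)) ?C ?P"
    using bij_betw_trans[OF bij] by (simp add: comp_def)
  show ?thesis
    unfolding bimod_iso_def
  proof (intro bexI[of _ "\<lambda>v. \<Psi> (\<phi> v)"] conjI ballI)
    fix a v assume "a \<in> carrier (monoid_algebra (M\<lparr>carrier := N\<rparr>))" "v \<in> carrier (regular_bimod M)"
    then have av: "Poly_Mapping.keys a \<subseteq> N" "Poly_Mapping.keys v \<subseteq> carrier M" by (simp_all add: regular_bimod_simps)
    show "\<Psi> (\<phi> (lact (regular_bimod M) a v)) = lact (direct_sum_bimod \<Delta> tens) a (\<Psi> (\<phi> v))"
      unfolding regular_bimod_simps direct_sum_simps[OF sub] left[OF av] \<Psi>_def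
      using sub tens_lact[OF _ av(1) rk] restrict_pm_left[OF av(1) \<phi>C[OF av(2)]] by (auto simp: restrict_def fun_eq_iff)
  next
    fix b v assume "b \<in> carrier (monoid_algebra (M\<lparr>carrier := K\<rparr>))" "v \<in> carrier (regular_bimod M)"
    then have bv: "Poly_Mapping.keys b \<subseteq> K" "Poly_Mapping.keys v \<subseteq> carrier M" by (simp_all add: regular_bimod_simps)
    show "\<Psi> (\<phi> (ract (regular_bimod M) v b)) = ract (direct_sum_bimod \<Delta> tens) (\<Psi> (\<phi> v)) b"
      unfolding regular_bimod_simps direct_sum_simps[OF sub] right[OF bv] \<Psi>_def
      using sub tens_ract[OF _ bv(1) rk] restrict_pm_right[OF bv(1) \<phi>C[OF bv(2)]] by (auto simp: restrict_def fun_eq_iff)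
  next
    have hom: "\<Psi> (f + g) = (\<lambda>m\<in>\<Delta>. \<Psi> f m \<otimes>\<^bsub>tens m\<^esub> \<Psi> g m)" for f g
      using sub tens_mult[OF _ rk rk] by (auto simp: \<Psi>_def clinear_add[OF clinear_restrict_pm] restrict_def fun_eq_iff)
    show "(\<lambda>v. \<Psi> (\<phi> v)) \<in> iso (regular_bimod M) (direct_sum_bimod \<Delta> tens)"
      unfolding iso_def hom_def regular_bimod_simps direct_sum_simps[OF sub]
      using bij' bij_betw_imp_funcset[OF bij'] by (simp add: clinear_add[OF lin] hom)
  qed
qed

end

theorem theorem3p40:
  fixes M :: "('a, 'c) monoid_scheme" and N K \<Delta> :: "'a set"
    and \<alpha> \<beta> :: "'a \<Rightarrow> nat" and x y :: "'a \<Rightarrow> nat \<Rightarrow> 'a"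
  assumes M: "monoid M" "finite (carrier M)"
    and N: "submonoid N M" and K: "submonoid K M"
    and \<Delta>: "complete_reps (carrier M // LR_rel M N K) \<Delta>"
    and x: "\<And>m. m \<in> \<Delta> \<Longrightarrow> inj_on (x m) {1..\<alpha> m} \<and>
              complete_reps (L_orbits M N K m) (x m ` {1..\<alpha> m})"
    and y: "\<And>m. m \<in> \<Delta> \<Longrightarrow> inj_on (y m) {1..\<beta> m} \<and>
              complete_reps (R_orbits M N K m) (y m ` {1..\<beta> m})"
  shows "(disjoint_family_on (J_class M N K) \<Delta> \<and>
          carrier M = (\<Union>m\<in>\<Delta>. J_class M N K m)) \<and>
         ((\<forall>m\<in>\<Delta>. inj_on (tensor_incl M N K m) (set_tensor M N K m)) \<and>
          disjoint_family_on (\<lambda>m. tensor_incl M N K m ` set_tensor M N K m) \<Delta> \<and>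
          carrier M = (\<Union>m\<in>\<Delta>. tensor_incl M N K m ` set_tensor M N K m)) \<and>
         (disjoint_family_on
            (\<lambda>(m, i, j). {circ M N K m (circ M N K m (x m i) h) (y m j) | h. h \<in> H_class M N K m})
            (SIGMA m:\<Delta>. {1..\<alpha> m} \<times> {1..\<beta> m}) \<and>
          carrier M = (\<Union>m\<in>\<Delta>. \<Union>i\<in>{1..\<alpha> m}. \<Union>j\<in>{1..\<beta> m}.
            {circ M N K m (circ M N K m (x m i) h) (y m j) | h. h \<in> H_class M N K m})) \<and>
         (semisimple_ring (monoid_algebra (M\<lparr>carrier := N\<rparr>)) \<and>
          semisimple_ring (monoid_algebra (M\<lparr>carrier := K\<rparr>)) \<longrightarrow>
          bimod_iso (monoid_algebra (M\<lparr>carrier := N\<rparr>)) (monoid_algebra (M\<lparr>carrier := K\<rparr>))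
            (regular_bimod M)
            (direct_sum_bimod \<Delta> (\<lambda>m. tensor_bimod (monoid_algebra (H_monoid M N K m))
               (L_bimod M N K m) (R_bimod M N K m))))"
proof -
  interpret finite_submonoid_pair M N K
    using M N K by (simp add: finite_submonoid_pair_def submonoid_pair_def finite_submonoid_pair_axioms_def)
  note sub = complete_reps_J(1)[OF \<Delta>] and disj = complete_reps_J(2)[OF \<Delta>] and cover = complete_reps_J(3)[OF \<Delta>]
  have tensor: "tensor_incl M N K m ` set_tensor M N K m = J_class M N K m" if "m \<in> \<Delta>" for m
    using set_tensor_fibres(2) sub that by blast
  let ?D = "\<lambda>m i j. {circ M N K m (circ M N K m (x m i) h) (y m j) | h. h \<in> H_class M N K m}"
  have J: "J_class M N K m = (\<Union>i\<in>{1..\<alpha> m}. \<Union>j\<in>{1..\<beta> m}. ?D m i j)" if "m \<in> \<Delta>" for m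
    using J_class_double_cosets(1)[of m "x m ` {1..\<alpha> m}" "y m ` {1..\<beta> m}"] x[OF that] y[OF that] sub that
    by (simp add: subset_iff)
  have "disjoint_family_on (\<lambda>(m, i, j). ?D m i j) (SIGMA m:\<Delta>. {1..\<alpha> m} \<times> {1..\<beta> m})"
    unfolding disjoint_family_on_def
  proof (intro ballI impI)
    fix p q assume p: "p \<in> (SIGMA m:\<Delta>. {1..\<alpha> m} \<times> {1..\<beta> m})" and q: "q \<in> (SIGMA m:\<Delta>. {1..\<alpha> m} \<times> {1..\<beta> m})"
      and ne: "p \<noteq> q"
    obtain m i j where pe: "p = (m, i, j)" by (cases p)
    obtain m' i' j' where qe: "q = (m', i', j')" by (cases q)
    have mem: "m \<in> \<Delta>" "i \<in> {1..\<alpha> m}" "j \<in> {1..\<beta> m}" "m' \<in> \<Delta>" "i' \<in> {1..\<alpha> m'}" "j' \<in> {1..\<beta> m'}"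
      using p q by (auto simp: pe qe)
    have False if z: "z \<in> ?D m i j" "z \<in> ?D m' i' j'" for z
    proof -
      \<comment> \<open>Disjointness of the \<open>J\<close>-classes settles the outer index, so
        that both representations of \<open>z\<close> use the operation for the same
        \<open>m\<close>.\<close>
      have "z \<in> J_class M N K m" "z \<in> J_class M N K m'" using z mem J by blast+
      then have eq: "m' = m" using disj mem by (auto simp: disjoint_family_on_def)
      obtain h h' where h: "h \<in> H_class M N K m" "h' \<in> H_class M N K m"
        "circ M N K m (circ M N K m (x m i) h) (y m j) = circ M N K m (circ M N K m (x m i') h') (y m j')"
        using z unfolding eq by blast
      have "x m i = x m i' \<and> y m j = y m j'"
        by (rule J_class_double_cosets(2)[of m "x m ` {1..\<alpha> m}" "y m ` {1..\<beta> m}", OF _ _ _ _ _ _ _ h])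
          (use x[OF mem(1)] y[OF mem(1)] mem sub eq in auto)
      \<comment> \<open>The double coset lemma only compares representatives; injectivity of the
        enumerations turns this into equality of indices.\<close>
      then have "i = i'" "j = j'" using x[OF mem(1)] y[OF mem(1)] mem eq by (auto dest: inj_onD)
      then show False using ne eq by (simp add: pe qe)
    qed
    then show "(case p of (m, i, j) \<Rightarrow> ?D m i j) \<inter> (case q of (m, i, j) \<Rightarrow> ?D m i j) = {}"
      unfolding pe qe case_prod_conv by blast
  qed
  moreover have "carrier M = (\<Union>m\<in>\<Delta>. \<Union>i\<in>{1..\<alpha> m}. \<Union>j\<in>{1..\<beta> m}. ?D m i j)"
    unfolding cover using J by (rule SUP_cong[OF refl])
  moreover have "\<forall>m\<in>\<Delta>. inj_on (tensor_incl M N K m) (set_tensor M N K m)"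
    using set_tensor_fibres(1) sub by blast
  moreover have "disjoint_family_on (\<lambda>m. tensor_incl M N K m ` set_tensor M N K m) \<Delta>"
    using disj tensor by (simp add: disjoint_family_on_def)
  moreover have "carrier M = (\<Union>m\<in>\<Delta>. tensor_incl M N K m ` set_tensor M N K m)"
    using cover tensor by simp
  ultimately show ?thesis using disj cover regular_bimod_iso[OF \<Delta>] by blast
qed

end
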